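(* Let $\mathcal{C}$ be a wreath-closed permutation class containing only finitely many simple permutations, let $\mathcal{P}$ be a finite query-complete set of properties, and let $\mathcal{Q}\subseteq\mathcal{P}$. Then the generating function $\sum_n |\{\pi\in\mathcal{C}\cap S_n : \pi=\pi^{-1},\ \pi\in Q\text{ for all }Q\in\mathcal{Q}\}|\,x^n$ of the involutions in $\mathcal{C}$ satisfying every property in $\mathcal{Q}$ is algebraic over $\mathbb{Q}(x)$.
   Context: A permutation $\pi$ contains $\sigma$ if $\pi$ has a subsequence order-isomorphic to $\sigma$; a permutation class is a set of permutations closed downward under containment. An interval of $\pi\in S_n$ is a set of contiguous indices $[a,b]$ whose image under $\pi$ is a set of consecutive integers; $\pi$ is simple if its only intervals have size $0$, $1$, or $n$. For $\sigma\in S_m$ and nonempty permutations $\alpha_1,\dots,\alpha_m$, the inflation $\sigma[\alpha_1,\dots,\alpha_m]$ is the permutation obtained by replacing each entry $\sigma(i)$ by an interval order-isomorphic to $\alpha_i$. A class $\mathcal{C}$ is wreath-closed if $\sigma[\alpha_1,\dots,\alpha_m]\in\mathcal{C}$ whenever $\sigma,\alpha_1,\dots,\alpha_m\in\mathcal{C}$. A property is any set of permutations. A set $\mathcal{P}$ of properties is query-complete if for every permutation $\sigma\in S_m$ and every $P\in\mathcal{P}$, whether $\sigma[\alpha_1,\dots,\alpha_m]\in P$ is determined by $\sigma$ together with the knowledge, for each $i\in[m]$ and each $Q\in\mathcal{P}$, of whether $\alpha_i\in Q$. An involution is a permutation equal to its own inverse. *)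

theory Defs
  imports "HOL-Computational_Algebra.Polynomial_FPS"
begin

definition is_perm :: "nat list \<Rightarrow> bool" where
  "is_perm xs \<longleftrightarrow> distinct xs \<and> set xs = {0..<length xs}"

definition S :: "nat \<Rightarrow> nat list set" where
  "S n = {xs. is_perm xs \<and> length xs = n}"

definition order_iso :: "nat list \<Rightarrow> nat list \<Rightarrow> bool" where
  "order_iso xs ys \<longleftrightarrow> length xs = length ys \<and>
     (\<forall>i<length xs. \<forall>j<length xs. xs ! i < xs ! j \<longleftrightarrow> ys ! i < ys ! j)"

definition contains :: "nat list \<Rightarrow> nat list \<Rightarrow> bool" where
  "contains p sigma \<longleftrightarrow> (\<exists>I. I \<subseteq> {0..<length p} \<and> order_iso (nths p I) sigma)"

definition perm_class :: "nat list set \<Rightarrow> bool" where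
  "perm_class C \<longleftrightarrow> (\<forall>p\<in>C. is_perm p) \<and>
     (\<forall>p sigma. p \<in> C \<and> is_perm sigma \<and> contains p sigma \<longrightarrow> sigma \<in> C)"

definition is_interval :: "nat list \<Rightarrow> nat set \<Rightarrow> bool" where
  "is_interval p I \<longleftrightarrow> (\<exists>a b. a \<le> b \<and> b \<le> length p \<and> I = {a..<b} \<and>
       (\<exists>c. (\<lambda>i. p ! i) ` I = {c..<c + card I}))"

definition simple :: "nat list \<Rightarrow> bool" where
  "simple p \<longleftrightarrow> (\<forall>I. is_interval p I \<longrightarrow> card I \<in> {0, 1, length p})"

definition inflate :: "nat list \<Rightarrow> nat list list \<Rightarrow> nat list" where
  "inflate sigma alphas = concat (map (\<lambda>i. map (\<lambda>v. v +
      sum_list (map (\<lambda>j. length (alphas ! j)) (filter (\<lambda>j. sigma ! j < sigma ! i) [0..<length sigma])))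
      (alphas ! i)) [0..<length sigma])"

definition wreath_closed :: "nat list set \<Rightarrow> bool" where
  "wreath_closed C \<longleftrightarrow> (\<forall>sigma alphas. sigma \<in> C \<and> length alphas = length sigma \<and>
      (\<forall>a\<in>set alphas. a \<in> C \<and> a \<noteq> []) \<longrightarrow> inflate sigma alphas \<in> C)"

text \<open>A property is any set of permutations.\<close>
definition query_complete :: "nat list set set \<Rightarrow> bool" where
  "query_complete PP \<longleftrightarrow> (\<forall>sigma alphas betas P.
      is_perm sigma \<and> P \<in> PP \<and> length alphas = length sigma \<and> length betas = length sigma \<and>
      (\<forall>a\<in>set alphas. is_perm a \<and> a \<noteq> []) \<and> (\<forall>b\<in>set betas. is_perm b \<and> b \<noteq> []) \<and>
      (\<forall>i<length sigma. \<forall>Q\<in>PP. alphas ! i \<in> Q \<longleftrightarrow> betas ! i \<in> Q)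
      \<longrightarrow> (inflate sigma alphas \<in> P \<longleftrightarrow> inflate sigma betas \<in> P))"

definition involution :: "nat list \<Rightarrow> bool" where
  "involution p \<longleftrightarrow> (\<forall>i<length p. p ! (p ! i) = i)"

text \<open>A formal power series over Q is algebraic over Q(x) iff it satisfies a nontrivial
  polynomial equation with coefficients in Q[x] (denominators cleared).\<close>
definition algebraic_fps :: "rat fps \<Rightarrow> bool" where
  "algebraic_fps F \<longleftrightarrow> (\<exists>ps :: rat poly list. (\<exists>q\<in>set ps. q \<noteq> 0) \<and>
      (\<Sum>i<length ps. fps_of_poly (ps ! i) * F ^ i) = 0)"

end

theory Submission
  imports Defs "HOL-Library.Sublist"
begin

text \<open>Replacing \<open>C\<close> by the inverse-closed class \<open>{p \<in> C. pinv p \<in> C}\<close> and recording for each permutation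
  also the properties of its inverse, both the class and the properties become symmetric. By the
  substitution decomposition a permutation is a single point, a sum or a skew sum with indecomposable
  first summand, or an inflation of a simple permutation of length at least three, in each case
  uniquely. Taking inverses respects the decomposition, so an involution is an inflation of a simple
  involution whose blocks at fixed points are involutions while the two blocks of a 2-cycle are
  inverse to each other; the first skew component of a skew decomposable involution is inverse to the
  last one. This gives a polynomial system for the generating functions \<open>I t (x)\<close> of
  the involutions and \<open>A t (x\<^sup>2)\<close> of all permutations of type \<open>t\<close>, and such systems
  have algebraic solutions.\<close>

section \<open>Algebraicity of solutions of polynomial systems\<close>

unbundle fps_syntax

text \<open>A power series solution of an arbitrary polynomial system need not be algebraic
  (\<open>Y = Y\<close> has every solution). What saves the systems here is that each term on a
  right-hand side is divisible by x or is a product of at least two unknowns, all without constant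
  term. The right-hand sides are then x-adic contractions and the solution is unique; uniqueness is
  what permits passing to a perturbed system, where elimination is mere dimension counting, and
  coming back. This condition also shapes the equations: the empty permutation is kept out of the
  unknowns, and a bare unknown never stands on a right-hand side. Query-completeness is silent about
  inverses, yet one block of a 2-cycle is the inverse of the other; once types record the properties
  of the inverse too, inversion acts on them as a swap. Arbitrary permutations enter the involution
  equations only in mirror pairs, hence at \<open>x^2\<close>. Their own equations are those for all
  permutations with x replaced by \<open>x^2\<close>, so no further powers of x arise and the system
  stays finite.\<close>

lemma fps_X_power_dvd_iff:
  fixes F :: "'a::comm_ring_1 fps"
  shows "fps_X ^ k dvd F \<longleftrightarrow> (\<forall>n<k. F $ n = 0)"
proof
  assume "fps_X ^ k dvd F"
  then obtain G where "F = fps_X ^ k * G" by (auto simp: dvd_def)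
  then show "\<forall>n<k. F $ n = 0" by (simp add: fps_X_power_mult_nth)
next
  assume *: "\<forall>n<k. F $ n = 0"
  have "F = fps_X ^ k * fps_shift k F"
    by (rule fps_ext) (simp add: fps_X_power_mult_nth *)
  then show "fps_X ^ k dvd F" by (metis dvd_triv_left)
qed

lemma fps_X_dvd_iff:
  fixes F :: "'a::comm_ring_1 fps"
  shows "fps_X dvd F \<longleftrightarrow> F $ 0 = 0"
  using fps_X_power_dvd_iff[of 1 F] by simp

text \<open>A polynomial in unknowns indexed by \<open>'i\<close> over \<open>'r[x]\<close>: a list
  of terms, where \<open>(c, l)\<close> stands for the coefficient \<open>c\<close> times the
  monomial that lists its unknowns with repetition in \<open>l\<close>.\<close>

definition peval :: "('i \<Rightarrow> 'r::comm_ring_1 fps) \<Rightarrow> ('r poly \<times> 'i list) list \<Rightarrow> 'r fps" where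
  "peval Y ts = (\<Sum>(c, l)\<leftarrow>ts. fps_of_poly c * prod_list (map Y l))"

definition over :: "'i set \<Rightarrow> ('r poly \<times> 'i list) list \<Rightarrow> bool" where
  "over V ts \<longleftrightarrow> (\<forall>(c, l)\<in>set ts. set l \<subseteq> V)"

text \<open>On series without constant term, such a polynomial improves x-adic agreement by one
  order, see \<open>peval_diff_dvd_Suc\<close>.\<close>

definition contractive :: "('r::zero poly \<times> 'i list) list \<Rightarrow> bool" where
  "contractive ts \<longleftrightarrow> (\<forall>(c, l)\<in>set ts. coeff c 0 = 0 \<or> 2 \<le> length l)"

lemma peval_Nil [simp]: "peval Y [] = 0"
  and peval_Cons [simp]: "peval Y ((c, l) # ts) = fps_of_poly c * prod_list (map Y l) + peval Y ts"
  and peval_append [simp]: "peval Y (ts @ us) = peval Y ts + peval Y us"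
  by (simp_all add: peval_def)

lemma over_simps [simp]:
  "over V []" "over V ((c, l) # ts) \<longleftrightarrow> set l \<subseteq> V \<and> over V ts"
  "over V (ts @ us) \<longleftrightarrow> over V ts \<and> over V us"
  by (auto simp: over_def)

lemma contractive_simps [simp]:
  "contractive []" "contractive ((c, l) # ts) \<longleftrightarrow> (coeff c 0 = 0 \<or> 2 \<le> length l) \<and> contractive ts"
  "contractive (ts @ us) \<longleftrightarrow> contractive ts \<and> contractive us"
  by (auto simp: contractive_def)

section \<open>x-adic estimates for polynomial expressions\<close>

lemma peval_cong:
  assumes "over V ts" "\<And>j. j \<in> V \<Longrightarrow> U j = W j"
  shows "peval U ts = peval W ts"
  using assms(1)
proof (induction ts)
  case (Cons t ts)
  obtain c l where t: "t = (c, l)" by (cases t)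
  have "map U l = map W l" using Cons.prems assms(2) t by auto
  then have "prod_list (map U l) = prod_list (map W l)" by metis
  then show ?case using Cons t by simp
qed simp

lemma prod_list_diff_dvd:
  fixes U W :: "'i \<Rightarrow> 'r::comm_ring_1 fps"
  assumes "\<And>j. j \<in> set l \<Longrightarrow> d dvd U j - W j"
  shows "d dvd prod_list (map U l) - prod_list (map W l)"
  using assms
proof (induction l)
  case (Cons a l)
  have "prod_list (map U (a # l)) - prod_list (map W (a # l)) =
    U a * (prod_list (map U l) - prod_list (map W l)) + (U a - W a) * prod_list (map W l)"
    by (simp add: algebra_simps)
  then show ?case using Cons by (metis dvd_add dvd_mult dvd_mult2 list.set_intros)
qed simp

text \<open>Every summand of the telescoped difference contains a factor \<open>U j - W j\<close>,
  divisible by \<open>x^k\<close>, and at least one further factor, divisible by x.\<close>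

lemma prod_list_diff_dvd_Suc:
  fixes U W :: "'i \<Rightarrow> 'r::comm_ring_1 fps"
  assumes diff: "\<And>j. j \<in> set l \<Longrightarrow> fps_X ^ k dvd U j - W j"
    and UW: "\<And>j. j \<in> set l \<Longrightarrow> fps_X dvd U j" "\<And>j. j \<in> set l \<Longrightarrow> fps_X dvd W j"
    and len: "2 \<le> length l"
  shows "fps_X ^ Suc k dvd prod_list (map U l) - prod_list (map W l)"
proof -
  obtain a b l' where l: "l = a # b # l'"
    using len by (metis One_nat_def Suc_1 Suc_le_length_iff)
  have 1: "fps_X ^ Suc k dvd U a * (prod_list (map U (b # l')) - prod_list (map W (b # l')))"
    unfolding power_Suc
    by (rule mult_dvd_mono[OF _ prod_list_diff_dvd]) (use assms l in auto)
  have 2: "fps_X ^ Suc k dvd (U a - W a) * prod_list (map W (b # l'))"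
    unfolding power_Suc2
    by (rule mult_dvd_mono) (use assms l in auto)
  have "prod_list (map U l) - prod_list (map W l) =
    U a * (prod_list (map U (b # l')) - prod_list (map W (b # l')))
      + (U a - W a) * prod_list (map W (b # l'))"
    by (simp add: l algebra_simps)
  then show ?thesis using 1 2 by (metis dvd_add)
qed

lemma peval_diff_dvd_Suc:
  fixes U W :: "'i \<Rightarrow> 'r::comm_ring_1 fps"
  assumes "over V ts" "contractive ts"
    and diff: "\<And>j. j \<in> V \<Longrightarrow> fps_X ^ k dvd U j - W j"
    and UW: "\<And>j. j \<in> V \<Longrightarrow> fps_X dvd U j" "\<And>j. j \<in> V \<Longrightarrow> fps_X dvd W j"
  shows "fps_X ^ Suc k dvd peval U ts - peval W ts"
  using assms(1,2)
proof (induction ts)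
  case (Cons t ts)
  obtain c l where t: "t = (c, l)" by (cases t)
  have l: "set l \<subseteq> V" and c: "coeff c 0 = 0 \<or> 2 \<le> length l" using Cons.prems t by auto
  have "fps_X ^ Suc k dvd fps_of_poly c * (prod_list (map U l) - prod_list (map W l))"
    using c
  proof
    assume "coeff c 0 = 0"
    then have "fps_X dvd fps_of_poly c" by (simp add: fps_X_dvd_iff)
    moreover have "fps_X ^ k dvd prod_list (map U l) - prod_list (map W l)"
      by (rule prod_list_diff_dvd) (use l diff in auto)
    ultimately show ?thesis by (simp add: mult_dvd_mono)
  next
    assume "2 \<le> length l"
    then show ?thesis
      by (intro dvd_mult prod_list_diff_dvd_Suc) (use l assms in auto)
  qed
  moreover have "fps_X ^ Suc k dvd peval U ts - peval W ts" using Cons t by simp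
  ultimately have "fps_X ^ Suc k dvd fps_of_poly c * (prod_list (map U l) - prod_list (map W l))
    + (peval U ts - peval W ts)" by (rule dvd_add)
  also have "\<dots> = peval U (t # ts) - peval W (t # ts)" by (simp add: t algebra_simps)
  finally show ?case .
qed simp

lemma fps_eq_if_X_powers_dvd:
  fixes F G :: "'a::comm_ring_1 fps"
  assumes "\<And>k. fps_X ^ k dvd F - G"
  shows "F = G"
proof (rule fps_ext)
  fix n
  show "F $ n = G $ n"
    using assms[of "Suc n"] unfolding fps_X_power_dvd_iff by simp
qed

text \<open>Agreement modulo \<open>x^k\<close> propagates through the contractive right-hand sides
  to agreement modulo \<open>x^(k+1)\<close>.\<close>

lemma system_unique:
  fixes Y Z :: "'i \<Rightarrow> 'r::comm_ring_1 fps"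
  assumes "\<And>i. i \<in> V \<Longrightarrow> over V (p i)" "\<And>i. i \<in> V \<Longrightarrow> contractive (p i)"
    and "\<And>i. i \<in> V \<Longrightarrow> Y i = peval Y (p i)" "\<And>i. i \<in> V \<Longrightarrow> Z i = peval Z (p i)"
    and "\<And>i. i \<in> V \<Longrightarrow> Y i $ 0 = 0" "\<And>i. i \<in> V \<Longrightarrow> Z i $ 0 = 0"
    and "i \<in> V"
  shows "Y i = Z i"
proof -
  have "fps_X ^ k dvd Y i - Z i" if "i \<in> V" for k i
    using that
  proof (induction k arbitrary: i)
    case (Suc k)
    have "fps_X ^ Suc k dvd peval Y (p i) - peval Z (p i)"
      by (rule peval_diff_dvd_Suc[of V]) (use Suc assms in \<open>auto simp: fps_X_dvd_iff\<close>)
    then show ?case using assms(3,4) Suc.prems by metis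
  qed simp
  then show ?thesis using fps_eq_if_X_powers_dvd assms(7) by blast
qed

primrec iter :: "('i \<Rightarrow> ('r poly \<times> 'i list) list) \<Rightarrow> nat \<Rightarrow> 'i \<Rightarrow> 'r::comm_ring_1 fps" where
  "iter p 0 = (\<lambda>_. 0)"
| "iter p (Suc n) = (\<lambda>i. peval (iter p n) (p i))"

text \<open>Fixed point iteration from 0 in the x-adic topology.\<close>

lemma system_exists:
  fixes p :: "'i \<Rightarrow> ('r::comm_ring_1 poly \<times> 'i list) list"
  assumes p: "\<And>i. i \<in> V \<Longrightarrow> over V (p i)" "\<And>i. i \<in> V \<Longrightarrow> contractive (p i)"
  obtains Y where "\<And>i. i \<in> V \<Longrightarrow> Y i = peval Y (p i)" "\<And>i. i \<in> V \<Longrightarrow> Y i $ 0 = 0"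
proof -
  let ?f = "iter p"
  have peval0: "fps_X dvd peval U ts"
    if "over V ts" "contractive ts" "\<And>j. j \<in> V \<Longrightarrow> fps_X dvd U j" for U and ts :: "('r poly \<times> 'i list) list"
    using that
  proof (induction ts)
    case (Cons t ts)
    obtain c l where t: "t = (c, l)" by (cases t)
    have "fps_X dvd fps_of_poly c * prod_list (map U l)"
    proof (cases "coeff c 0 = 0")
      case True
      then show ?thesis by (intro dvd_mult2) (simp add: fps_X_dvd_iff)
    next
      case False
      then have "l \<noteq> []" "set l \<subseteq> V" using Cons.prems t by auto
      then show ?thesis using Cons.prems(3) by (cases l) auto
    qed
    then show ?case using Cons t by (auto intro: dvd_add)
  qed simp
  have f0: "fps_X dvd ?f n i" if "i \<in> V" for n i
    using that by (induction n arbitrary: i) (auto intro: peval0 p)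
  have step: "fps_X ^ n dvd ?f (Suc n) i - ?f n i" if "i \<in> V" for n i
    using that
  proof (induction n arbitrary: i)
    case (Suc n)
    have "fps_X ^ Suc n dvd peval (?f (Suc n)) (p i) - peval (?f n) (p i)"
      by (rule peval_diff_dvd_Suc[of V])
        (use Suc p f0 f0[of _ "Suc n"] in \<open>auto simp del: power_Suc\<close>)
    then show ?case by simp
  qed simp
  have stable: "?f (n + k) i $ m = ?f n i $ m" if "i \<in> V" "m < n" for n k i m
  proof (induction k)
    case (Suc k)
    then show ?case using step[OF that(1), of "n + k"] that(2)
      by (simp add: fps_X_power_dvd_iff)
  qed simp
  \<comment> \<open>The limit, taken coefficientwise: by \<open>stable\<close> the coefficient of
    \<open>x^n\<close> no longer changes from iterate \<open>Suc n\<close> on.\<close>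
  define Y where "Y i = Abs_fps (\<lambda>n. ?f (Suc n) i $ n)" for i
  have Y: "fps_X ^ n dvd Y i - ?f n i" if "i \<in> V" for n i
    unfolding fps_X_power_dvd_iff
  proof (intro allI impI)
    fix m assume "m < n"
    then obtain k where "n = Suc m + k" by (metis less_iff_Suc_add add_Suc)
    then have "?f n i $ m = ?f (Suc m) i $ m" using stable[OF that, of m "Suc m" k] by simp
    then show "(Y i - ?f n i) $ m = 0" unfolding Y_def by simp
  qed
  have Y0: "fps_X dvd Y i" if "i \<in> V" for i
    using f0[OF that, of "Suc 0"] by (simp add: Y_def fps_X_dvd_iff del: iter.simps)
  have "Y i = peval Y (p i)" if i: "i \<in> V" for i
  proof (rule fps_eq_if_X_powers_dvd)
    fix n
    have 1: "fps_X ^ Suc n dvd peval (?f n) (p i) - peval Y (p i)"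
    proof (rule peval_diff_dvd_Suc[of V])
      fix j assume "j \<in> V"
      then show "fps_X ^ n dvd ?f n j - Y j"
        using Y[of j n] by (metis dvd_minus_iff minus_diff_eq)
    qed (use i p f0 Y0 in auto)
    have 2: "fps_X ^ Suc n dvd Y i - peval (?f n) (p i)" using Y[OF i, of "Suc n"] by simp
    have "fps_X ^ Suc n dvd Y i - peval Y (p i)" using dvd_add[OF 1 2] by simp
    then show "fps_X ^ n dvd Y i - peval Y (p i)" by (meson dvd_trans le_SucI le_imp_power_dvd order_refl)
  qed
  then show thesis using that Y0 by (auto simp: fps_X_dvd_iff)
qed

section \<open>Powers of polynomial expressions and linear dependence over a domain\<close>

lemma over_mult:
  fixes Y :: "'i \<Rightarrow> 'r::comm_ring_1 fps"
  assumes "over V ts" "over V us"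
  shows "\<exists>vs. over V vs \<and> peval Y vs = peval Y ts * peval Y us"
  using assms(1)
proof (induction ts)
  case Nil
  then show ?case by (intro exI[of _ "[]"]) simp
next
  case (Cons t ts)
  obtain c l where t: "t = (c, l)" by (cases t)
  have l: "set l \<subseteq> V" using Cons.prems t by simp
  obtain vs where vs: "over V vs" "peval Y vs = peval Y ts * peval Y us"
    using Cons t by auto
  define ws where "ws = map (\<lambda>(d, k). (c * d, l @ k)) us"
  have "over V ws \<and> peval Y ws = fps_of_poly c * prod_list (map Y l) * peval Y us"
    using assms(2) unfolding ws_def
    by (induction us) (auto simp: l algebra_simps fps_of_poly_mult)
  then show ?case using vs
    by (intro exI[of _ "ws @ vs"]) (simp add: t algebra_simps)
qed

lemma over_power:
  fixes Y :: "'i \<Rightarrow> 'r::comm_ring_1 fps"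
  assumes "over V ts"
  shows "\<exists>vs. over V vs \<and> peval Y vs = peval Y ts ^ n"
proof (induction n)
  case 0
  show ?case by (intro exI[of _ "[(1, [])]"]) simp
next
  case (Suc n)
  then show ?case using over_mult[OF assms] by (metis power_Suc)
qed

text \<open>More vectors than coordinates are dependent with coefficients in the domain itself:
  Gaussian elimination without division, by induction on the coordinates.\<close>

lemma linear_dependence:
  fixes c :: "'j \<Rightarrow> 'b \<Rightarrow> 'r::idom"
  assumes "finite B" "finite J" "card B < card J"
  shows "\<exists>a. (\<exists>j\<in>J. a j \<noteq> 0) \<and> (\<forall>l\<in>B. (\<Sum>j\<in>J. a j * c j l) = 0)"
  using assms
proof (induction B arbitrary: J c rule: finite_induct)
  case empty
  then have "J \<noteq> {}" by auto
  then show ?case by (intro exI[of _ "\<lambda>_. 1"]) auto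
next
  case (insert b B)
  show ?case
  proof (cases "\<forall>j\<in>J. c j b = 0")
    case True
    obtain a where "\<exists>j\<in>J. a j \<noteq> 0" "\<forall>l\<in>B. (\<Sum>j\<in>J. a j * c j l) = 0"
      using insert.IH[of J c] insert.prems insert.hyps by auto
    then show ?thesis using True by (intro exI[of _ a]) auto
  next
    case False
    then obtain k where k: "k \<in> J" "c k b \<noteq> 0" by auto
    define J' where "J' = J - {k}"
    have J: "J = insert k J'" "k \<notin> J'" "finite J'" using k insert.prems by (auto simp: J'_def)
    \<comment> \<open>Row \<open>k\<close> is the pivot for coordinate \<open>b\<close>;
      cross-multiplication clears that coordinate in all other rows.\<close>
    define c' where "c' j l = c k b * c j l - c j b * c k l" for j l
    have "card B < card J'" using insert J by simp
    then obtain a where a: "\<exists>j\<in>J'. a j \<noteq> 0" "\<forall>l\<in>B. (\<Sum>j\<in>J'. a j * c' j l) = 0"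
      using insert.IH[of J' c'] J by auto
    \<comment> \<open>The relation among the reduced rows rewritten for the original ones; the
      coefficient of the pivot row collects the subtracted multiples.\<close>
    define a' where "a' j = (if j = k then - (\<Sum>j\<in>J'. a j * c j b) else a j * c k b)" for j
    have sum: "(\<Sum>j\<in>J. a' j * c j l) = (\<Sum>j\<in>J'. a j * c' j l)" for l
    proof -
      have "(\<Sum>j\<in>J. a' j * c j l) = a' k * c k l + (\<Sum>j\<in>J'. a' j * c j l)"
        using J by simp
      also have "(\<Sum>j\<in>J'. a' j * c j l) = (\<Sum>j\<in>J'. a j * c k b * c j l)"
        by (rule sum.cong) (use J in \<open>auto simp: a'_def\<close>)
      finally show ?thesis
        by (simp add: a'_def c'_def algebra_simps sum_subtractf sum_distrib_left)
    qed
    have "(\<Sum>j\<in>J. a' j * c j b) = 0" unfolding sum by (simp add: c'_def mult.commute)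
    moreover have "\<exists>j\<in>J. a' j \<noteq> 0" using a(1) J k by (auto simp: a'_def)
    ultimately show ?thesis using a(2) sum by (intro exI[of _ a']) auto
  qed
qed

section \<open>Specialisation of the deformation parameter at 0\<close>

definition spec :: "rat poly fps \<Rightarrow> rat fps" where
  "spec F = Abs_fps (\<lambda>n. poly (F $ n) 0)"

text \<open>In \<open>rat poly poly\<close> the outer variable is x and the inner one is the
  deformation parameter \<open>eps\<close>; likewise \<open>rat poly fps\<close> is a ring of series
  in x over polynomials in \<open>eps\<close>. Both maps set \<open>eps\<close> to 0.\<close>

definition spec_poly :: "rat poly poly \<Rightarrow> rat poly" where
  "spec_poly = map_poly (\<lambda>q. poly q 0)"

definition lift_poly :: "rat poly \<Rightarrow> rat poly poly" where
  "lift_poly = map_poly (\<lambda>c. [:c:])"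

lemma spec_simps [simp]:
  "spec 0 = 0" "spec 1 = 1" "spec (F + G) = spec F + spec G" "spec (F * G) = spec F * spec G"
  by (rule fps_ext; simp add: spec_def fps_mult_nth poly_sum fps_one_nth)+

lemma spec_power [simp]: "spec (F ^ n) = spec F ^ n"
  by (induction n) auto

lemma spec_sum [simp]: "spec (sum F A) = (\<Sum>a\<in>A. spec (F a))"
  by (induction A rule: infinite_finite_induct) auto

lemma spec_prod_list [simp]: "spec (prod_list xs) = prod_list (map spec xs)"
  by (induction xs) auto

lemma coeff_spec_poly [simp]: "coeff (spec_poly q) n = poly (coeff q n) 0"
  by (simp add: spec_poly_def coeff_map_poly)

lemma coeff_lift_poly [simp]: "coeff (lift_poly q) n = [:coeff q n:]"
  by (simp add: lift_poly_def coeff_map_poly)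

lemma spec_fps_of_poly [simp]: "spec (fps_of_poly q) = fps_of_poly (spec_poly q)"
  by (rule fps_ext) (simp add: spec_def)

lemma spec_lift_poly [simp]: "spec_poly (lift_poly q) = q"
  by (rule poly_eqI) simp

abbreviation eps :: "rat poly poly" where "eps \<equiv> [:[:0, 1:]:]"

lemma spec_eps [simp]: "spec_poly eps = 0"
  by (rule poly_eqI) (simp add: coeff_pCons split: nat.split)

lemma eps_nonzero: "fps_of_poly eps \<noteq> 0"
  using fps_of_poly_eq_iff[of eps 0] by simp

lemma eps_dvd:
  assumes "spec_poly q = 0"
  obtains r where "q = eps * r"
proof -
  have "[:0, 1:] dvd coeff q n" for n
    using assms coeff_spec_poly[of q n] by (simp add: poly_eq_0_iff_dvd)
  then have "eps dvd q" by (simp add: const_poly_dvd_iff)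
  then show thesis using that by (auto simp: dvd_def)
qed

text \<open>A relation may become trivial at \<open>eps = 0\<close>. Then all its coefficients are
  divisible by \<open>eps\<close>, which can be cancelled; this ends because the degree in
  \<open>eps\<close> of one fixed nonzero coefficient drops each time.\<close>

lemma divide_out_eps:
  fixes Z :: "rat poly fps"
  assumes "finite J" "j \<in> J" "coeff (a j) n \<noteq> 0"
    and "(\<Sum>j\<in>J. fps_of_poly (a j) * Z ^ j) = 0"
  shows "\<exists>b. (\<exists>j\<in>J. spec_poly (b j) \<noteq> 0) \<and> (\<Sum>j\<in>J. fps_of_poly (b j) * Z ^ j) = 0"
  using assms(3,4)
proof (induction "degree (coeff (a j) n)" arbitrary: a rule: less_induct)
  case less
  show ?case
  proof (cases "\<exists>j\<in>J. spec_poly (a j) \<noteq> 0")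
    case True
    then show ?thesis using less.prems by blast
  next
    case False
    then have "\<forall>j\<in>J. \<exists>r. a j = eps * r" using eps_dvd by blast
    then obtain b where b: "\<And>j. j \<in> J \<Longrightarrow> a j = eps * b j" by metis
    have c: "coeff (a j) n = [:0, 1:] * coeff (b j) n" using b[OF assms(2)] by simp
    then have nz: "coeff (b j) n \<noteq> 0" using less.prems by auto
    have "degree (coeff (b j) n) < degree (coeff (a j) n)"
      unfolding c using nz by (subst degree_mult_eq) auto
    moreover have "fps_of_poly eps * (\<Sum>j\<in>J. fps_of_poly (b j) * Z ^ j) = 0"
      unfolding less.prems(2)[symmetric] sum_distrib_left
      by (rule sum.cong) (simp_all add: b fps_of_poly_mult mult.assoc)
    then have "(\<Sum>j\<in>J. fps_of_poly (b j) * Z ^ j) = 0"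
      using eps_nonzero by simp
    ultimately show ?thesis using less.hyps nz by blast
  qed
qed

lemma exists_count_ge:
  assumes "finite V" "set l \<subseteq> V" "card V * N < length l"
  shows "\<exists>i\<in>V. N < count_list l i"
proof (rule ccontr)
  assume "\<not> ?thesis"
  then have "(\<Sum>i\<in>V. count_list l i) \<le> (\<Sum>i\<in>V. N)" by (intro sum_mono) auto
  then show False using assms sum_count_set[OF assms(2,1)] by simp
qed

text \<open>The system is deformed to \<open>Y i = p i (Y) + \<epsilon> (Y i)^N\<close> with \<open>N\<close> larger than all degrees.
  Over \<open>\<rat>[x, \<epsilon>, 1/\<epsilon>]\<close> the deformed equations reduce all monomials to finitely many, so the solution
  of the deformed system is algebraic over \<open>\<rat>(x, \<epsilon>)\<close>; \<open>\<epsilon> = 0\<close> gives back the original system.\<close>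

theorem system_algebraic:
  fixes Y :: "'i \<Rightarrow> rat fps"
  assumes V: "finite V"
    and p: "\<And>i. i \<in> V \<Longrightarrow> over V (p i)" "\<And>i. i \<in> V \<Longrightarrow> contractive (p i)"
    and Y: "\<And>i. i \<in> V \<Longrightarrow> Y i = peval Y (p i)" "\<And>i. i \<in> V \<Longrightarrow> Y i $ 0 = 0"
    and q: "over V q"
  shows "algebraic_fps (peval Y q)"
proof -
  define lift :: "(rat poly \<times> 'i list) list \<Rightarrow> (rat poly poly \<times> 'i list) list" where
    "lift = map (\<lambda>(c, l). (lift_poly c, l))"
  have lift_over: "over V (lift ts) \<longleftrightarrow> over V ts" and lift_contr: "contractive ts \<Longrightarrow> contractive (lift ts)"
    for ts by (induction ts) (auto simp: lift_def)
  have spec_lift: "spec (peval Z (lift ts)) = peval (\<lambda>i. spec (Z i)) ts" for Z ts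
    by (induction ts) (auto simp: lift_def comp_def)
  \<comment> \<open>The bound 2 keeps the added term \<open>eps * (Y i)^N\<close> contractive, its
    coefficient not being divisible by x; exceeding all degrees makes it dominate equation
    \<open>i\<close>.\<close>
  obtain N where N: "2 \<le> N" "\<And>i c l. i \<in> V \<Longrightarrow> (c, l) \<in> set (p i) \<Longrightarrow> length l < N"
  proof -
    have "finite (\<Union>i\<in>V. (length \<circ> snd) ` set (p i))" using V by auto
    then obtain M where "\<forall>n\<in>(\<Union>i\<in>V. (length \<circ> snd) ` set (p i)). n < M"
      using finite_nat_set_iff_bounded by blast
    then show thesis using that[of "M + 2"] by fastforce
  qed
  define p' where "p' i = lift (p i) @ [(eps, replicate N i)]" for i
  have p': "over V (p' i)" "contractive (p' i)" if "i \<in> V" for i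
    using that p[OF that] N by (auto simp: p'_def lift_over lift_contr)
  obtain Z where Z: "\<And>i. i \<in> V \<Longrightarrow> Z i = peval Z (p' i)" "\<And>i. i \<in> V \<Longrightarrow> Z i $ 0 = 0"
    using system_exists[of V p'] p' by metis
  \<comment> \<open>At \<open>eps = 0\<close> the added term disappears, so both families solve the
    original contractive system.\<close>
  have spec_Z: "spec (Z i) = Y i" if "i \<in> V" for i
  proof (rule system_unique[of V p])
    fix i assume i: "i \<in> V"
    have "spec (Z i) = spec (peval Z (p' i))" using Z(1)[OF i] by simp
    then show "spec (Z i) = peval (\<lambda>i. spec (Z i)) (p i)"
      by (simp add: p'_def spec_lift)
    show "spec (Z i) $ 0 = 0" using Z(2)[OF i] by (simp add: spec_def)
  qed (use that p Y in auto)
  define mon where "mon l = prod_list (map Z l)" for l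
  \<comment> \<open>A longer monomial contains some unknown more than \<open>N\<close> times, by the
    pigeonhole principle, and can be reduced.\<close>
  define BL where "BL = {l. set l \<subseteq> V \<and> length l \<le> card V * N}"
  have finBL: "finite BL" unfolding BL_def using V by (rule finite_lists_length_le)
  define Sp where "Sp = {z. \<exists>c. z = (\<Sum>l\<in>BL. fps_of_poly (c l) * mon l)}"
  have Sp_add: "y + z \<in> Sp" if yz: "y \<in> Sp" "z \<in> Sp" for y z
  proof -
    obtain c d where "y = (\<Sum>l\<in>BL. fps_of_poly (c l) * mon l)" "z = (\<Sum>l\<in>BL. fps_of_poly (d l) * mon l)"
      using yz by (auto simp: Sp_def)
    then have "y + z = (\<Sum>l\<in>BL. fps_of_poly (c l + d l) * mon l)"
      by (simp add: fps_of_poly_add algebra_simps sum.distrib)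
    then show ?thesis unfolding Sp_def by (intro CollectI exI[of _ "\<lambda>l. c l + d l"])
  qed
  have Sp_mult: "fps_of_poly b * y \<in> Sp" if y: "y \<in> Sp" for b y
  proof -
    obtain c where "y = (\<Sum>l\<in>BL. fps_of_poly (c l) * mon l)"
      using y by (auto simp: Sp_def)
    then have "fps_of_poly b * y = (\<Sum>l\<in>BL. fps_of_poly (b * c l) * mon l)"
      by (simp add: fps_of_poly_mult sum_distrib_left mult.assoc)
    then show ?thesis unfolding Sp_def by (intro CollectI exI[of _ "\<lambda>l. b * c l"])
  qed
  have Sp_mon: "mon l \<in> Sp" if "l \<in> BL" for l
  proof -
    have "(\<Sum>k\<in>BL. fps_of_poly (if k = l then 1 else 0) * mon k) = (\<Sum>k\<in>BL. if k = l then mon k else 0)"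
      by (rule sum.cong) auto
    also have "\<dots> = mon l" using finBL that by simp
    finally show ?thesis unfolding Sp_def by (intro CollectI exI[of _ "\<lambda>k. if k = l then 1 else 0"]) simp
  qed
  let ?e = "fps_of_poly eps"
  \<comment> \<open>Membership in the span up to a power of \<open>eps\<close> stands in for
    inverting \<open>eps\<close>, which is not a unit among these series.\<close>
  define M where "M = {z. \<exists>e. ?e ^ e * z \<in> Sp}"
  have e_up: "?e ^ k * z \<in> Sp" if "?e ^ e * z \<in> Sp" "e \<le> k" for e k z
    using that(2,1)
  proof (induction k rule: dec_induct)
    case (step n)
    then show ?case using Sp_mult[of "?e ^ n * z" eps] by (simp add: mult.assoc)
  qed simp
  have M_add: "y + z \<in> M" if yz: "y \<in> M" "z \<in> M" for y z
  proof -
    obtain d e where de: "?e ^ d * y \<in> Sp" "?e ^ e * z \<in> Sp" using yz by (auto simp: M_def)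
    have "?e ^ (max d e) * y \<in> Sp" "?e ^ (max d e) * z \<in> Sp"
      using e_up[OF de(1), of "max d e"] e_up[OF de(2), of "max d e"] by simp_all
    then have "?e ^ (max d e) * (y + z) \<in> Sp" using Sp_add by (simp only: distrib_left)
    then show ?thesis unfolding M_def by blast
  qed
  have M_mult: "fps_of_poly b * y \<in> M" if y: "y \<in> M" for b y
  proof -
    obtain d where d: "?e ^ d * y \<in> Sp" using y unfolding M_def by (elim CollectE exE)
    have "?e ^ d * (fps_of_poly b * y) = fps_of_poly b * (?e ^ d * y)" by (rule mult.left_commute)
    also have "\<dots> \<in> Sp" using d by (rule Sp_mult)
    finally show ?thesis unfolding M_def by (intro CollectI exI)
  qed
  have M_eps: "z \<in> M" if z: "?e * z \<in> M" for z
  proof -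
    obtain d where d: "?e ^ d * (?e * z) \<in> Sp" using z unfolding M_def by (elim CollectE exE)
    have "?e ^ Suc d * z = ?e ^ d * (?e * z)" by (simp only: power_Suc2 mult.assoc)
    also have "\<dots> \<in> Sp" by (rule d)
    finally show ?thesis unfolding M_def by (intro CollectI exI)
  qed
  have M_0: "0 \<in> M" unfolding M_def Sp_def
    by (intro CollectI, rule exI[of _ 0], rule CollectI, rule exI[of _ "\<lambda>_. 0"]) simp
  have M_sub: "peval Z ts * mon l \<in> M"
    if "\<And>c k. (c, k) \<in> set ts \<Longrightarrow> mon (k @ l) \<in> M" for ts l
    using that
  proof (induction ts)
    case (Cons t ts)
    obtain c k where t: "t = (c, k)" by (cases t)
    have "fps_of_poly c * mon (k @ l) \<in> M" using Cons.prems t by (intro M_mult) auto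
    moreover have "peval Z ts * mon l \<in> M" by (rule Cons.IH, erule Cons.prems[OF list.set_intros(2)])
    moreover have "peval Z (t # ts) * mon l = fps_of_poly c * mon (k @ l) + peval Z ts * mon l"
      by (simp add: t mon_def algebra_simps)
    ultimately show ?case using M_add by simp
  qed (simp add: M_0)
  have M_mon: "mon l \<in> M" if "set l \<subseteq> V" for l
    using that
  proof (induction "length l" arbitrary: l rule: less_induct)
    case less
    show ?case
    proof (cases "l \<in> BL")
      case True
      then show ?thesis using Sp_mon unfolding M_def by (intro CollectI exI[of _ 0]) simp
    next
      case False
      then obtain i where i: "i \<in> V" "N < count_list l i"
        using exists_count_ge[OF V less.prems, of N] less.prems by (auto simp: BL_def not_le)
      define k where "k = filter (\<lambda>j. j \<noteq> i) l @ replicate (count_list l i - N) i"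
      have mon_split: "mon l = Z i ^ count_list l i * mon (filter (\<lambda>j. j \<noteq> i) l)" for l
        unfolding mon_def by (induction l) (auto simp: algebra_simps)
      have k: "mon l = Z i ^ N * mon k"
        using i(2) power_add[of "Z i" N "count_list l i - N"]
        unfolding mon_split[of l] by (simp add: k_def mon_def algebra_simps)
      have "length l = count_list l i + length (filter (\<lambda>j. j \<noteq> i) l)"
        by (induction l) auto
      then have len: "length l = length k + N" using i(2) by (simp add: k_def)
      have setk: "set k \<subseteq> V" using less.prems i by (auto simp: k_def)
      \<comment> \<open>Equation \<open>i\<close> solved for \<open>eps * Z i ^ N\<close>: it trades
        \<open>N\<close> factors for a single one or for fewer than \<open>N\<close>, so only
        shorter monomials arise.\<close>
      have "Z i = peval Z (lift (p i)) + ?e * Z i ^ N"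
        using Z(1)[OF i(1)] by (simp add: p'_def)
      then have eN: "?e * Z i ^ N = Z i - peval Z (lift (p i))" by (simp add: algebra_simps)
      have "?e * mon l = (?e * Z i ^ N) * mon k" by (simp add: k mult.assoc)
      also have "\<dots> = mon (i # k) + fps_of_poly (-1) * (peval Z (lift (p i)) * mon k)"
        unfolding eN by (simp add: mon_def algebra_simps fps_of_poly_uminus)
      also have "\<dots> \<in> M"
      proof (rule M_add)
        show "mon (i # k) \<in> M" by (rule less.hyps) (use len N(1) setk i in auto)
        show "fps_of_poly (-1) * (peval Z (lift (p i)) * mon k) \<in> M"
        proof (rule M_mult, rule M_sub)
          fix c k' assume "(c, k') \<in> set (lift (p i))"
          then obtain c' where c': "(c', k') \<in> set (p i)" by (auto simp: lift_def)
          then have "set k' \<subseteq> V" using p(1)[OF i(1)] by (auto simp: over_def)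
          then show "mon (k' @ k) \<in> M"
            using N(2)[OF i(1) c'] len setk by (intro less.hyps) auto
        qed
      qed
      finally show ?thesis by (rule M_eps)
    qed
  qed
  define z where "z = peval Z (lift q)"
  have z: "spec z = peval Y q"
    unfolding z_def spec_lift by (rule peval_cong[OF q spec_Z])
  have zM: "z ^ j \<in> M" for j
  proof -
    obtain vs where vs: "over V vs" "peval Z vs = z ^ j"
      using over_power[of V "lift q" Z j] q unfolding z_def lift_over by auto
    have "peval Z vs * mon [] \<in> M"
      using vs(1) by (intro M_sub) (auto simp: over_def intro!: M_mon)
    then show ?thesis using vs by (simp add: mon_def)
  qed
  then have "\<forall>j. \<exists>e. ?e ^ e * z ^ j \<in> Sp" by (auto simp: M_def)
  then obtain e where e: "\<And>j. ?e ^ e j * z ^ j \<in> Sp" by metis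
  \<comment> \<open>One power of \<open>z\<close> more than there are spanning monomials, which
    forces a linear relation.\<close>
  define J where "J = {..card BL}"
  define E where "E = Max (e ` J)"
  have "\<forall>j\<in>J. \<exists>c. ?e ^ E * z ^ j = (\<Sum>l\<in>BL. fps_of_poly (c l) * mon l)"
  proof
    fix j assume "j \<in> J"
    then have "e j \<le> E" by (simp add: E_def J_def)
    then show "\<exists>c. ?e ^ E * z ^ j = (\<Sum>l\<in>BL. fps_of_poly (c l) * mon l)"
      using e_up[OF e] by (auto simp: Sp_def)
  qed
  then obtain c where c: "\<And>j. j \<in> J \<Longrightarrow> ?e ^ E * z ^ j = (\<Sum>l\<in>BL. fps_of_poly (c j l) * mon l)"
    by metis
  obtain a where a: "\<exists>j\<in>J. a j \<noteq> 0" "\<forall>l\<in>BL. (\<Sum>j\<in>J. a j * c j l) = 0"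
    using linear_dependence[of BL J c] finBL by (auto simp: J_def)
  have "?e ^ E * (\<Sum>j\<in>J. fps_of_poly (a j) * z ^ j) = (\<Sum>j\<in>J. fps_of_poly (a j) * (?e ^ E * z ^ j))"
    by (simp add: sum_distrib_left mult.left_commute)
  also have "\<dots> = (\<Sum>j\<in>J. \<Sum>l\<in>BL. fps_of_poly (a j * c j l) * mon l)"
    by (rule sum.cong) (simp_all add: c sum_distrib_left fps_of_poly_mult mult.assoc)
  also have "\<dots> = (\<Sum>l\<in>BL. fps_of_poly (\<Sum>j\<in>J. a j * c j l) * mon l)"
    by (subst sum.swap) (simp add: fps_of_poly_sum sum_distrib_right)
  also have "\<dots> = 0" using a(2) by simp
  finally have rel: "(\<Sum>j\<in>J. fps_of_poly (a j) * z ^ j) = 0"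
    using eps_nonzero by simp
  have finJ: "finite J" by (simp add: J_def)
  obtain j n where jn: "j \<in> J" "coeff (a j) n \<noteq> 0" using a(1) by (metis coeff_0 poly_eqI)
  then obtain b where b: "\<exists>j\<in>J. spec_poly (b j) \<noteq> 0" "(\<Sum>j\<in>J. fps_of_poly (b j) * z ^ j) = 0"
    using divide_out_eps[OF finJ jn rel] by blast
  define ps where "ps = map (\<lambda>j. spec_poly (b j)) [0..<Suc (card BL)]"
  have "(\<Sum>i<length ps. fps_of_poly (ps ! i) * peval Y q ^ i)
    = (\<Sum>j\<in>J. fps_of_poly (spec_poly (b j)) * spec z ^ j)"
    by (rule sum.cong) (auto simp: ps_def J_def z simp del: upt_Suc)
  also have "\<dots> = spec (\<Sum>j\<in>J. fps_of_poly (b j) * z ^ j)" by simp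
  also have "\<dots> = 0" using b(2) by simp
  finally have "(\<Sum>i<length ps. fps_of_poly (ps ! i) * peval Y q ^ i) = 0" .
  moreover have "\<exists>r\<in>set ps. r \<noteq> 0"
    using b(1) by (auto simp: ps_def J_def image_iff less_Suc_eq_le simp del: upt_Suc)
  ultimately show ?thesis unfolding algebraic_fps_def by blast
qed

section \<open>Inflations and block decompositions\<close>

text \<open>Standardisation: entries are replaced by their ranks. For distinct entries this is the
  unique permutation order-isomorphic to \<open>xs\<close>.\<close>

definition std :: "nat list \<Rightarrow> nat list" where
  "std xs = map (\<lambda>i. card {j. j < length xs \<and> xs ! j < xs ! i}) [0..<length xs]"

lemma length_std [simp]: "length (std xs) = length xs"
  by (simp add: std_def)

lemma std_eq_Nil_iff [simp]: "std xs = [] \<longleftrightarrow> xs = []"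
  by (metis length_0_conv length_std)

lemma std_nth: "i < length xs \<Longrightarrow> std xs ! i = card {j. j < length xs \<and> xs ! j < xs ! i}"
  by (simp add: std_def)

lemma std_less_iff:
  assumes "i < length xs" "j < length xs"
  shows "std xs ! i < std xs ! j \<longleftrightarrow> xs ! i < xs ! j"
proof -
  let ?R = "\<lambda>i. {j. j < length xs \<and> xs ! j < xs ! i}"
  have mono: "?R a \<subseteq> ?R b" if "xs ! a \<le> xs ! b" for a b
    using that by auto
  show ?thesis
  proof
    assume "xs ! i < xs ! j"
    then have "?R i \<subset> ?R j" using assms by auto
    then show "std xs ! i < std xs ! j" using assms by (simp add: std_nth psubset_card_mono)
  next
    assume *: "std xs ! i < std xs ! j"
    show "xs ! i < xs ! j"
    proof (rule ccontr)
      assume "\<not> xs ! i < xs ! j"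
      then have "card (?R j) \<le> card (?R i)" by (intro card_mono mono) auto
      then show False using * assms by (simp add: std_nth)
    qed
  qed
qed

lemma order_iso_std: "order_iso xs (std xs)"
  by (simp add: order_iso_def std_less_iff)

lemma std_cong:
  assumes "order_iso xs ys"
  shows "std xs = std ys"
proof -
  have len: "length xs = length ys" using assms by (simp add: order_iso_def)
  have "{j. j < length xs \<and> xs ! j < xs ! i} = {j. j < length ys \<and> ys ! j < ys ! i}"
    if "i < length xs" for i
    using assms that by (auto simp: order_iso_def)
  then have "std xs ! i = std ys ! i" if "i < length xs" for i
    using that len by (simp only: std_nth)
  then show ?thesis by (intro nth_equalityI) (simp_all add: len)
qed

lemma is_perm_std:
  assumes "distinct xs"
  shows "is_perm (std xs)"
proof -
  have "i = j" if "i < length xs" "j < length xs" "std xs ! i = std xs ! j" for i j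
    using that std_less_iff[OF that(1,2)] std_less_iff[OF that(2,1)] assms
    by (metis linorder_neqE_nat nat_less_le nth_eq_iff_index_eq)
  then have d: "distinct (std xs)" by (auto simp: distinct_conv_nth)
  have "std xs ! i < length xs" if "i < length xs" for i
  proof -
    have "{j. j < length xs \<and> xs ! j < xs ! i} \<subset> {..<length xs}" using that by auto
    then have "card {j. j < length xs \<and> xs ! j < xs ! i} < card {..<length xs}"
      by (intro psubset_card_mono) auto
    then show ?thesis using that by (simp add: std_nth)
  qed
  then have "set (std xs) \<subseteq> {0..<length xs}" by (auto simp: in_set_conv_nth)
  moreover have "card (set (std xs)) = length xs" using d by (simp add: distinct_card)
  ultimately have "set (std xs) = {0..<length xs}" by (intro card_subset_eq) auto
  then show ?thesis using d by (simp add: is_perm_def)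
qed

lemma card_less_nth_distinct:
  assumes "distinct xs"
  shows "card {j. j < length xs \<and> xs ! j < x} = card {y \<in> set xs. y < x}"
proof -
  have "(!) xs ` {j. j < length xs \<and> xs ! j < x} = {y \<in> set xs. y < x}"
    by (auto simp: in_set_conv_nth)
  moreover have "inj_on ((!) xs) {j. j < length xs \<and> xs ! j < x}"
    using assms by (auto simp: inj_on_def nth_eq_iff_index_eq)
  ultimately show ?thesis using card_image by fastforce
qed

lemma std_perm:
  assumes "is_perm p"
  shows "std p = p"
proof (rule nth_equalityI)
  fix i assume "i < length (std p)"
  then have i: "i < length p" by simp
  then have "p ! i \<in> {0..<length p}" using assms nth_mem unfolding is_perm_def by blast
  then have "{y \<in> set p. y < p ! i} = {0..<p ! i}"
    using assms by (auto simp: is_perm_def)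
  then show "std p ! i = p ! i"
    using i assms by (simp add: std_nth card_less_nth_distinct is_perm_def)
qed simp

lemma std_eqI: "is_perm p \<Longrightarrow> order_iso xs p \<Longrightarrow> std xs = p"
  using std_cong std_perm by metis

lemma perm_nth_less: "is_perm p \<Longrightarrow> i < length p \<Longrightarrow> p ! i < length p"
  unfolding is_perm_def by (metis atLeastLessThan_iff nth_mem)

lemma perm_nth_eq_iff:
  "is_perm p \<Longrightarrow> i < length p \<Longrightarrow> j < length p \<Longrightarrow> p ! i = p ! j \<longleftrightarrow> i = j"
  unfolding is_perm_def by (simp add: nth_eq_iff_index_eq)

lemma perm_nth_surj:
  assumes "is_perm p" "v < length p"
  obtains i where "i < length p" "p ! i = v"
  using assms unfolding is_perm_def by (metis atLeastLessThan_iff in_set_conv_nth zero_le)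

section \<open>Inflations and their blocks\<close>

definition off :: "nat list \<Rightarrow> nat list list \<Rightarrow> nat \<Rightarrow> nat" where
  "off sigma as i = (\<Sum>j | j < length sigma \<and> sigma ! j < sigma ! i. length (as ! j))"

definition shifted :: "nat list \<Rightarrow> nat list list \<Rightarrow> nat list list" where
  "shifted sigma as = map (\<lambda>i. map (\<lambda>v. v + off sigma as i) (as ! i)) [0..<length sigma]"

lemma inflate_shifted: "inflate sigma as = concat (shifted sigma as)"
proof -
  have "sum_list (map (\<lambda>j. length (as ! j)) (filter (\<lambda>j. sigma ! j < sigma ! i) [0..<length sigma]))
    = off sigma as i" for i
    by (subst sum_list_distinct_conv_sum_set) (auto simp: off_def intro!: sum.cong)
  then show ?thesis by (simp add: inflate_def shifted_def)
qed

lemma length_shifted [simp]: "length (shifted sigma as) = length sigma"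
  and shifted_nth [simp]:
    "i < length sigma \<Longrightarrow> shifted sigma as ! i = map (\<lambda>v. v + off sigma as i) (as ! i)"
  by (simp_all add: shifted_def)

definition inflatable :: "nat list \<Rightarrow> nat list list \<Rightarrow> bool" where
  "inflatable sigma as \<longleftrightarrow> is_perm sigma \<and> length as = length sigma \<and>
    (\<forall>a\<in>set as. is_perm a \<and> a \<noteq> [])"

text \<open>The view of an inflation from inside \<open>p\<close>: blocks keep the values they have
  in \<open>p\<close> instead of being standardised, so blocks of different decompositions of one
  permutation can be compared as sets.\<close>

definition blocks :: "nat list \<Rightarrow> nat list \<Rightarrow> nat list list \<Rightarrow> bool" where
  "blocks p sigma bs \<longleftrightarrow> concat bs = p \<and> [] \<notin> set bs \<and> is_perm sigma \<and> length sigma = length bs \<and>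
    (\<forall>i<length bs. \<forall>j<length bs. i \<noteq> j \<longrightarrow>
      (\<forall>x\<in>set (bs ! i). \<forall>y\<in>set (bs ! j). x < y \<longleftrightarrow> sigma ! i < sigma ! j))"

lemma blocks_less_iff:
  "blocks p sigma bs \<Longrightarrow> i < length bs \<Longrightarrow> j < length bs \<Longrightarrow> i \<noteq> j \<Longrightarrow> x \<in> set (bs ! i) \<Longrightarrow>
    y \<in> set (bs ! j) \<Longrightarrow> x < y \<longleftrightarrow> sigma ! i < sigma ! j"
  unfolding blocks_def by blast

lemma blocks_length: "blocks p sigma bs \<Longrightarrow> length sigma = length bs"
  by (simp only: blocks_def)

lemma in_set_concat_nth: "x \<in> set (concat bs) \<longleftrightarrow> (\<exists>i<length bs. x \<in> set (bs ! i))"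
  unfolding set_concat set_conv_nth[of bs] by auto

lemma blocks_concat: "blocks p sigma bs \<Longrightarrow> concat bs = p"
  and blocks_perm: "blocks p sigma bs \<Longrightarrow> is_perm sigma"
  unfolding blocks_def by blast+

lemma blocks_mem_iff: "blocks p sigma bs \<Longrightarrow> x \<in> set p \<longleftrightarrow> (\<exists>i<length bs. x \<in> set (bs ! i))"
  by (drule blocks_concat) (metis in_set_concat_nth)

lemma blocks_subset: "blocks p sigma bs \<Longrightarrow> i < length bs \<Longrightarrow> set (bs ! i) \<subseteq> set p"
  using blocks_mem_iff by (intro subsetI) metis

lemma blocks_nonempty:
  assumes "blocks p sigma bs" "i < length bs"
  obtains x where "x \<in> set (bs ! i)"
proof -
  have "[] \<notin> set bs" using assms(1) unfolding blocks_def by blast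
  then have "bs ! i \<noteq> []" using assms(2) nth_mem by metis
  then show thesis using that last_in_set by blast
qed

lemma disjoint_blocks:
  assumes "distinct (concat bs)" "i < length bs" "j < length bs" "i \<noteq> j"
  shows "set (bs ! i) \<inter> set (bs ! j) = {}"
proof -
  have *: "set (bs ! i) \<inter> set (bs ! j) = {}" if "i < j" "j < length bs" for i j
  proof -
    have "bs = take j bs @ bs ! j # drop (Suc j) bs" using that id_take_nth_drop by blast
    then have "concat bs = concat (take j bs) @ bs ! j @ concat (drop (Suc j) bs)"
      by (metis concat.simps(2) concat_append)
    then have "set (concat (take j bs)) \<inter> set (bs ! j) = {}" using assms(1) by auto
    moreover have "bs ! i \<in> set (take j bs)" using that by (auto simp: in_set_conv_nth)
    ultimately show ?thesis by auto
  qed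
  show ?thesis using *[of i j] *[of j i] assms by (cases "i < j") (auto simp: Int_commute)
qed

text \<open>An entry of a permutation equals the number of smaller entries. Those in its own block
  give its value under \<open>std\<close>, and all other ones fill the blocks that are lower in
  \<open>sigma\<close>, which gives \<open>off\<close>.\<close>

lemma inflate_blocks:
  assumes p: "is_perm p" and bs: "blocks p sigma bs"
  shows "inflate sigma (map std bs) = p" "inflatable sigma (map std bs)"
proof -
  have c: "concat bs = p" and m: "length sigma = length bs" and sg: "is_perm sigma"
    using bs by (auto simp: blocks_def)
  have set_p: "x \<in> set p \<longleftrightarrow> (\<exists>i<length bs. x \<in> set (bs ! i))" for x
    using in_set_concat_nth[of x bs] c by simp
  have dist: "distinct (concat bs)" using c p by (simp add: is_perm_def)
  then have disti: "distinct (bs ! i)" if "i < length bs" for i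
    using that by (simp add: distinct_concat_iff)
  have "map (\<lambda>v. v + off sigma (map std bs) i) (map std bs ! i) = bs ! i" if i: "i < length bs" for i
  proof (rule nth_equalityI)
    fix k assume "k < length (map (\<lambda>v. v + off sigma (map std bs) i) (map std bs ! i))"
    then have k: "k < length (bs ! i)" using i by simp
    define x where "x = bs ! i ! k"
    have xi: "x \<in> set (bs ! i)" using k by (simp add: x_def)
    define J where "J = {j. j < length sigma \<and> sigma ! j < sigma ! i}"
    have finJ: "finite J" by (simp add: J_def)
    have "x \<in> set p" using xi i set_p by blast
    then have "{y \<in> set p. y < x} = {0..<x}" using p by (auto simp: is_perm_def)
    then have "x = card {y \<in> set p. y < x}" by simp
    also have "{y \<in> set p. y < x} = {y \<in> set (bs ! i). y < x} \<union> (\<Union>j\<in>J. set (bs ! j))"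
    proof (intro equalityI subsetI)
      fix y assume "y \<in> {y \<in> set p. y < x}"
      then obtain j where j: "j < length bs" "y \<in> set (bs ! j)" "y < x"
        unfolding mem_Collect_eq set_p by blast
      then show "y \<in> {y \<in> set (bs ! i). y < x} \<union> (\<Union>j\<in>J. set (bs ! j))"
        using blocks_less_iff[OF bs j(1) i _ j(2) xi] m by (cases "i = j") (auto simp: J_def)
    next
      fix y assume y: "y \<in> {y \<in> set (bs ! i). y < x} \<union> (\<Union>j\<in>J. set (bs ! j))"
      show "y \<in> {y \<in> set p. y < x}"
      proof (cases "y \<in> set (bs ! i) \<and> y < x")
        case True
        then show ?thesis using i set_p by blast
      next
        case False
        then obtain j where j: "j < length bs" "sigma ! j < sigma ! i" "y \<in> set (bs ! j)"
          using y m by (auto simp: J_def)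
        then have "y < x" using blocks_less_iff[OF bs j(1) i _ j(3) xi] by blast
        then show ?thesis using j set_p by blast
      qed
    qed
    also have "card \<dots> = card {y \<in> set (bs ! i). y < x} + card (\<Union>j\<in>J. set (bs ! j))"
    proof (rule card_Un_disjoint)
      show "{y \<in> set (bs ! i). y < x} \<inter> (\<Union>j\<in>J. set (bs ! j)) = {}"
        using disjoint_blocks[OF dist i] m by (fastforce simp: J_def)
    qed (use finJ in auto)
    also have "card (\<Union>j\<in>J. set (bs ! j)) = (\<Sum>j\<in>J. card (set (bs ! j)))"
      by (rule card_UN_disjoint) (use finJ m disjoint_blocks[OF dist] in \<open>auto simp: J_def\<close>)
    also have "\<dots> = off sigma (map std bs) i"
      unfolding off_def J_def by (rule sum.cong) (use m disti in \<open>auto simp: distinct_card\<close>)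
    also have "card {y \<in> set (bs ! i). y < x} = std (bs ! i) ! k"
      using k disti[OF i] by (simp add: std_nth card_less_nth_distinct x_def)
    finally show "map (\<lambda>v. v + off sigma (map std bs) i) (map std bs ! i) ! k = bs ! i ! k"
      using k i by (simp add: x_def)
  qed (use i in simp)
  then have "shifted sigma (map std bs) = bs"
    by (intro nth_equalityI) (use m in auto)
  then show "inflate sigma (map std bs) = p" by (simp add: inflate_shifted c)
  show "inflatable sigma (map std bs)"
    using bs dist m sg unfolding inflatable_def blocks_def
    by (auto intro!: is_perm_std simp: distinct_concat_iff)
qed

lemma off_less:
  assumes "is_perm sigma" "i < length sigma" "j < length sigma" "sigma ! i < sigma ! j"
  shows "off sigma as i + length (as ! i) \<le> off sigma as j"
proof -
  let ?I = "{k. k < length sigma \<and> sigma ! k < sigma ! i}"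
  have "off sigma as i + length (as ! i) = (\<Sum>k\<in>insert i ?I. length (as ! k))"
    by (subst sum.insert) (auto simp: off_def)
  also have "\<dots> \<le> off sigma as j"
    unfolding off_def by (rule sum_mono2) (use assms in auto)
  finally show ?thesis .
qed

lemma length_inflate:
  "length as = length sigma \<Longrightarrow> length (inflate sigma as) = sum_list (map length as)"
proof -
  assume *: "length as = length sigma"
  have "map length (shifted sigma as) = map length as"
    by (rule nth_equalityI) (simp_all add: *)
  then show ?thesis by (simp add: inflate_shifted length_concat)
qed

text \<open>Converse of \<open>inflate_blocks\<close>. Block \<open>i\<close> takes its values in an
  interval of length \<open>length (as ! i)\<close> starting at \<open>off sigma as i\<close>, and
  by \<open>off_less\<close> these intervals are disjoint and ordered as in
  \<open>sigma\<close>.\<close>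

lemma blocks_inflate:
  assumes "inflatable sigma as"
  shows "blocks (inflate sigma as) sigma (shifted sigma as)"
    and "is_perm (inflate sigma as)"
    and "map std (shifted sigma as) = as"
    and "map length (shifted sigma as) = map length as"
proof -
  let ?m = "length sigma"
  have sg: "is_perm sigma" and len: "length as = ?m"
    and as: "\<And>i. i < ?m \<Longrightarrow> is_perm (as ! i)" "\<And>i. i < ?m \<Longrightarrow> as ! i \<noteq> []"
    using assms by (auto simp: inflatable_def)
  have el: "off sigma as i \<le> x \<and> x < off sigma as i + length (as ! i)"
    if "i < ?m" "x \<in> set (shifted sigma as ! i)" for i x
    using that as(1)[OF that(1)] by (auto simp: is_perm_def)
  have lt: "x < y"
    if "i < ?m" "j < ?m" "sigma ! i < sigma ! j" "x \<in> set (shifted sigma as ! i)"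
      "y \<in> set (shifted sigma as ! j)" for i j x y
    using off_less[OF sg that(1-3), of as] el[OF that(1,4)] el[OF that(2,5)] by linarith
  have iff: "x < y \<longleftrightarrow> sigma ! i < sigma ! j"
    if "i < ?m" "j < ?m" "i \<noteq> j" "x \<in> set (shifted sigma as ! i)"
      "y \<in> set (shifted sigma as ! j)" for i j x y
    using lt[of i j x y] lt[of j i y x] that perm_nth_eq_iff[OF sg that(1,2)] by linarith
  show "blocks (inflate sigma as) sigma (shifted sigma as)"
    unfolding blocks_def inflate_shifted length_shifted
  proof (intro conjI allI impI ballI)
    show "[] \<notin> set (shifted sigma as)" using as(2) by (auto simp: shifted_def)
  next
    fix i j x y
    assume "i < length sigma" "j < length sigma" "i \<noteq> j" "x \<in> set (shifted sigma as ! i)"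
      "y \<in> set (shifted sigma as ! j)"
    then show "x < y \<longleftrightarrow> sigma ! i < sigma ! j" by (rule iff)
  qed (rule refl sg)+
  have disj: "set (shifted sigma as ! i) \<inter> set (shifted sigma as ! j) = {}"
    if "i < ?m" "j < ?m" "i \<noteq> j" for i j
  proof -
    have "sigma ! i \<noteq> sigma ! j" using perm_nth_eq_iff[OF sg that(1,2)] that by simp
    then show ?thesis using lt[OF that(1,2)] lt[OF that(2,1)]
      by (metis disjoint_iff less_irrefl linorder_neqE_nat)
  qed
  have d: "distinct (inflate sigma as)"
    unfolding inflate_shifted distinct_concat_iff
  proof (intro conjI ballI allI impI)
    show "distinct (removeAll [] (shifted sigma as))"
    proof (rule distinct_removeAll)
      show "distinct (shifted sigma as)"
        unfolding distinct_conv_nth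
      proof (intro allI impI)
        fix i j assume ij: "i < length (shifted sigma as)" "j < length (shifted sigma as)" "i \<noteq> j"
        then have "set (shifted sigma as ! i) \<noteq> {}" using as(2) by simp
        then show "shifted sigma as ! i \<noteq> shifted sigma as ! j" using disj[of i j] ij
          by (metis inf.idem length_shifted)
      qed
    qed
    fix ys assume "ys \<in> set (shifted sigma as)"
    then show "distinct ys" using as(1)
      by (auto simp: in_set_conv_nth is_perm_def distinct_map inj_on_def)
  next
    fix ys zs assume "ys \<in> set (shifted sigma as) \<and> zs \<in> set (shifted sigma as) \<and> ys \<noteq> zs"
    then show "set ys \<inter> set zs = {}" using disj by (metis in_set_conv_nth length_shifted)
  qed
  have total: "off sigma as i + length (as ! i) \<le> sum_list (map length as)" if "i < ?m" for i
  proof -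
    have "off sigma as i + length (as ! i) =
      (\<Sum>k\<in>insert i {k. k < ?m \<and> sigma ! k < sigma ! i}. length (as ! k))"
      by (subst sum.insert) (auto simp: off_def)
    also have "\<dots> \<le> (\<Sum>k\<in>{..<?m}. length (as ! k))"
      by (rule sum_mono2) (use that in auto)
    also have "\<dots> = sum_list (map length as)"
      by (simp add: sum_list_sum_nth len atLeast0LessThan)
    finally show ?thesis .
  qed
  have "set (inflate sigma as) \<subseteq> {0..<length (inflate sigma as)}"
  proof
    fix x assume "x \<in> set (inflate sigma as)"
    then obtain i where "i < ?m" "x \<in> set (shifted sigma as ! i)"
      unfolding inflate_shifted in_set_concat_nth by auto
    then show "x \<in> {0..<length (inflate sigma as)}"
      using el[of i x] total[of i] by (simp add: length_inflate len)
  qed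
  then have "set (inflate sigma as) = {0..<length (inflate sigma as)}"
    by (rule card_subset_eq[rotated]) (use d in \<open>auto simp: distinct_card\<close>)
  then show "is_perm (inflate sigma as)" using d by (simp add: is_perm_def)
  show "map std (shifted sigma as) = as"
  proof (rule nth_equalityI)
    fix i assume "i < length (map std (shifted sigma as))"
    then have i: "i < ?m" by simp
    have "std (map (\<lambda>v. v + off sigma as i) (as ! i)) = as ! i"
      by (rule std_eqI) (use as i in \<open>auto simp: order_iso_def\<close>)
    then show "map std (shifted sigma as) ! i = as ! i" using i by simp
  qed (simp add: len)
  show "map length (shifted sigma as) = map length as"
    by (rule nth_equalityI) (simp_all add: len)
qed

lemma blocks_order_iso_unique:
  assumes "blocks p sigma bs" "blocks p tau bs"
  shows "sigma = tau"
proof -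
  have "order_iso sigma tau"
    unfolding order_iso_def
  proof (intro conjI allI impI)
    fix i j assume ij: "i < length sigma" "j < length sigma"
    moreover have "length sigma = length bs" using assms(1) by (rule blocks_length)
    ultimately have b: "i < length bs" "j < length bs" by simp_all
    then obtain x y where "x \<in> set (bs ! i)" "y \<in> set (bs ! j)"
      using assms(1) unfolding blocks_def by (metis last_in_set nth_mem)
    then show "sigma ! i < sigma ! j \<longleftrightarrow> tau ! i < tau ! j"
      using blocks_less_iff[OF assms(1) b] blocks_less_iff[OF assms(2) b] by (cases "i = j") auto
  qed (use assms blocks_length in metis)
  then show ?thesis using assms std_eqI std_perm unfolding blocks_def by metis
qed

lemma concat_eq_lengths:
  "concat xs = concat ys \<Longrightarrow> map length xs = map length ys \<Longrightarrow> xs = ys"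
  by (induction xs arbitrary: ys) auto

text \<open>The block lengths tell where the concatenation is cut; quotient and standardised blocks
  can then be read off.\<close>

lemma inflate_inject:
  assumes "inflatable sigma as" "inflatable tau bs" "inflate sigma as = inflate tau bs"
    and "map length as = map length bs"
  shows "sigma = tau \<and> as = bs"
proof -
  have "shifted sigma as = shifted tau bs"
    by (rule concat_eq_lengths)
      (use assms blocks_inflate(4)[OF assms(1)] blocks_inflate(4)[OF assms(2)] in
        \<open>simp_all add: inflate_shifted\<close>)
  then show ?thesis
    using blocks_inflate[OF assms(1)] blocks_inflate[OF assms(2)] assms(3) blocks_order_iso_unique
    by metis
qed

section \<open>Simple permutations and the substitution decomposition\<close>

lemma convex_nat_set:
  assumes "finite M" "M \<noteq> {}" "\<And>i j k. i \<in> M \<Longrightarrow> k \<in> M \<Longrightarrow> i < j \<Longrightarrow> j < k \<Longrightarrow> j \<in> M"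
  shows "M = {Min M..<Min M + card M}"
proof -
  have "M = {Min M..<Suc (Max M)}"
  proof (intro equalityI subsetI)
    fix x assume x: "x \<in> {Min M..<Suc (Max M)}"
    show "x \<in> M"
    proof (cases "x = Min M \<or> x = Max M")
      case True
      then show ?thesis using assms(1,2) Min_in Max_in by metis
    next
      case False
      then show ?thesis using assms(3)[of "Min M" "Max M" x] assms(1,2) x Min_in Max_in by auto
    qed
  qed (use assms(1) in \<open>auto simp: less_Suc_eq_le\<close>)
  moreover have "Min M \<le> Suc (Max M)" using assms(1,2) by (simp add: le_SucI)
  ultimately show ?thesis by (metis card_atLeastLessThan le_add_diff_inverse)
qed

lemma perm_image_nth: "is_perm p \<Longrightarrow> (!) p ` {0..<length p} = {0..<length p}"
  unfolding is_perm_def by (metis atLeast_upt set_map list.set_map map_nth set_upt)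

text \<open>Intervals as sets convex both in position and in value, a condition that is symmetric
  under inversion and easy to check for sets of blocks.\<close>

lemma is_intervalI:
  assumes sg: "is_perm sigma" and M: "M \<subseteq> {0..<length sigma}"
    and pos: "\<And>i j k. i \<in> M \<Longrightarrow> k \<in> M \<Longrightarrow> i < j \<Longrightarrow> j < k \<Longrightarrow> j \<in> M"
    and val: "\<And>i j k. i \<in> M \<Longrightarrow> k \<in> M \<Longrightarrow> j < length sigma \<Longrightarrow> sigma ! i < sigma ! j \<Longrightarrow>
      sigma ! j < sigma ! k \<Longrightarrow> j \<in> M"
  shows "is_interval sigma M"
proof (cases "M = {}")
  case True
  then show ?thesis unfolding is_interval_def by (intro exI[of _ 0]) auto
next
  case False
  have fin: "finite M" using M finite_subset by blast
  have 1: "M = {Min M..<Min M + card M}" by (rule convex_nat_set[OF fin False]) (use pos in blast)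
  have inj: "inj_on ((!) sigma) M"
    using M perm_nth_eq_iff[OF sg] unfolding inj_on_def by (metis atLeastLessThan_iff subsetD)
  let ?N = "(!) sigma ` M"
  have N: "?N = {Min ?N..<Min ?N + card ?N}"
  proof (rule convex_nat_set)
    fix a b c assume abc: "a \<in> ?N" "c \<in> ?N" "a < b" "b < c"
    then obtain i k where ik: "i \<in> M" "k \<in> M" "a = sigma ! i" "c = sigma ! k" by blast
    have "c < length sigma" using ik M perm_nth_less[OF sg, of k] by auto
    then obtain j where "j < length sigma" "b = sigma ! j"
      using perm_nth_surj[OF sg, of b] abc(4) by (metis less_trans)
    then show "b \<in> ?N" using val[of i k j] ik abc by blast
  qed (use fin False in auto)
  have c: "card ?N = card M" by (rule card_image[OF inj])
  have "Max M < length sigma" using M fin False by (metis Max_in atLeastLessThan_iff subsetD)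
  moreover have "Min M + card M - 1 \<in> M" using 1 False
    by (metis One_nat_def add_diff_cancel_left' atLeastLessThan_iff card_gt_0_iff diff_Suc_less diff_add_inverse2 fin le_add1 add_diff_assoc Suc_leI nat_add_left_cancel_less)
  ultimately have "Min M + card M \<le> length sigma" using M by fastforce
  then show ?thesis using 1 N c unfolding is_interval_def by (metis le_add1)
qed

lemma is_interval_cases:
  assumes sg: "is_perm sigma" and I: "is_interval sigma I"
  shows "I \<subseteq> {0..<length sigma}"
    and "\<And>i j k. i \<in> I \<Longrightarrow> k \<in> I \<Longrightarrow> i < j \<Longrightarrow> j < k \<Longrightarrow> j \<in> I"
    and "\<And>i j k. i \<in> I \<Longrightarrow> k \<in> I \<Longrightarrow> j < length sigma \<Longrightarrow> sigma ! i < sigma ! j \<Longrightarrow>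
      sigma ! j < sigma ! k \<Longrightarrow> j \<in> I"
proof -
  obtain a b c where abc: "a \<le> b" "b \<le> length sigma" "I = {a..<b}"
    "(\<lambda>i. sigma ! i) ` I = {c..<c + card I}"
    using I unfolding is_interval_def by blast
  show sub: "I \<subseteq> {0..<length sigma}" using abc by auto
  show "j \<in> I" if "i \<in> I" "k \<in> I" "i < j" "j < k" for i j k using that abc(3) by simp
  show "j \<in> I" if *: "i \<in> I" "k \<in> I" "j < length sigma" "sigma ! i < sigma ! j" "sigma ! j < sigma ! k"
    for i j k
  proof -
    have "sigma ! i \<in> {c..<c + card I}" "sigma ! k \<in> {c..<c + card I}"
      using *(1,2) abc(4) by blast+
    then have "sigma ! j \<in> {c..<c + card I}" using *(4,5) by simp
    then obtain l where "l \<in> I" "sigma ! l = sigma ! j" using abc(4) by (metis imageE)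
    then show ?thesis using perm_nth_eq_iff[OF sg, of l j] *(3) sub by auto
  qed
qed

section \<open>Uniqueness of the decomposition over a simple quotient\<close>

definition start :: "nat list list \<Rightarrow> nat \<Rightarrow> nat" where
  "start bs i = length (concat (take i bs))"

lemma start_mono: "i \<le> j \<Longrightarrow> start bs i \<le> start bs j"
proof -
  assume "i \<le> j"
  then have "take j bs = take i bs @ take (j - i) (drop i bs)" by (metis take_add le_add_diff_inverse)
  then show ?thesis by (simp add: start_def)
qed

lemma start_Suc: "i < length bs \<Longrightarrow> start bs (Suc i) = start bs i + length (bs ! i)"
  by (simp add: start_def take_Suc_conv_app_nth)

lemma concat_nth_start:
  assumes "i < length bs" "k < length (bs ! i)"
  shows "start bs i + k < length (concat bs)" "concat bs ! (start bs i + k) = bs ! i ! k"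
proof -
  have "bs = take i bs @ bs ! i # drop (Suc i) bs" using assms id_take_nth_drop by blast
  then have "concat bs = concat (take i bs) @ bs ! i @ concat (drop (Suc i) bs)"
    by (metis concat.simps(2) concat_append)
  then show "start bs i + k < length (concat bs)" "concat bs ! (start bs i + k) = bs ! i ! k"
    using assms(2) by (simp_all add: start_def nth_append)
qed

lemma in_block_position:
  assumes "i < length bs" "x \<in> set (bs ! i)"
  obtains a where "start bs i \<le> a" "a < start bs (Suc i)" "a < length (concat bs)" "concat bs ! a = x"
proof -
  obtain k where "k < length (bs ! i)" "bs ! i ! k = x" using assms(2) by (auto simp: in_set_conv_nth)
  then show thesis using that[of "start bs i + k"] concat_nth_start[OF assms(1)] start_Suc[OF assms(1)]
    by simp
qed

lemma position_in_block:
  assumes "i < length bs" "start bs i \<le> a" "a < start bs (Suc i)"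
  shows "concat bs ! a \<in> set (bs ! i)"
  using concat_nth_start[of i bs "a - start bs i"] assms start_Suc[OF assms(1)]
  by (metis le_add_diff_inverse nat_add_left_cancel_less nth_mem)

text \<open>An interval of \<open>p\<close> described by its values rather than its positions, for
  comparison with the sets of entries of blocks.\<close>

definition convex :: "nat list \<Rightarrow> nat set \<Rightarrow> bool" where
  "convex p V \<longleftrightarrow> V \<subseteq> set p \<and>
    (\<forall>a b c. a < b \<longrightarrow> b < c \<longrightarrow> c < length p \<longrightarrow> p ! a \<in> V \<longrightarrow> p ! c \<in> V \<longrightarrow> p ! b \<in> V) \<and>
    (\<forall>x\<in>V. \<forall>z\<in>V. \<forall>y\<in>set p. x < y \<longrightarrow> y < z \<longrightarrow> y \<in> V)"

lemma convex_block:
  assumes p: "is_perm p" and bs: "blocks p sigma bs" and i: "i < length bs"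
  shows "convex p (set (bs ! i))"
proof -
  have c: "concat bs = p" using bs by (simp add: blocks_def)
  have pos: "start bs i \<le> a \<and> a < start bs (Suc i)" if ap: "a < length p" "p ! a \<in> set (bs ! i)" for a
  proof -
    obtain a' where "start bs i \<le> a'" "a' < start bs (Suc i)" "a' < length p" "p ! a' = p ! a"
      using in_block_position[OF i ap(2)] c by metis
    then show ?thesis using perm_nth_eq_iff[OF p] ap(1) by metis
  qed
  show ?thesis
    unfolding convex_def
  proof (intro conjI allI impI ballI)
    show "set (bs ! i) \<subseteq> set p" using blocks_subset[OF bs i] .
    fix a b c' assume "a < b" "b < c'" "c' < length p" "p ! a \<in> set (bs ! i)" "p ! c' \<in> set (bs ! i)"
    then show "p ! b \<in> set (bs ! i)"
      using pos[of a] pos[of c'] position_in_block[OF i, of b] c by auto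
  next
    fix x z y assume xyz: "x \<in> set (bs ! i)" "z \<in> set (bs ! i)" "y \<in> set p" "x < y" "y < z"
    then obtain j where j: "j < length bs" "y \<in> set (bs ! j)" using c in_set_concat_nth by metis
    show "y \<in> set (bs ! i)"
    proof (cases "j = i")
      case False
      then have "sigma ! i < sigma ! j" "sigma ! j < sigma ! i"
        using blocks_less_iff[OF bs i j(1) _ xyz(1) j(2)] blocks_less_iff[OF bs j(1) i _ j(2) xyz(2)]
          xyz by auto
      then show ?thesis by simp
    qed (use j in simp)
  qed
qed

text \<open>If the first or last entry were the minimum or maximum, deleting it would leave an
  interval of size \<open>length sigma - 1\<close>, which is neither 0, 1 nor the full
  length.\<close>

lemma simple_corner:
  assumes sg: "is_perm sigma" and "simple sigma" and m: "3 \<le> length sigma"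
    and j: "j = 0 \<or> Suc j = length sigma"
  shows "0 < sigma ! j" "Suc (sigma ! j) < length sigma"
proof -
  let ?m = "length sigma"
  have jm: "j < ?m" using j m by auto
  let ?I = "{0..<?m} - {j}"
  have card: "card ?I = ?m - 1" using jm by simp
  have "\<not> is_interval sigma ?I"
    using assms(2) m card unfolding simple_def by fastforce
  obtain i k where ik: "i \<in> ?I" "k \<in> ?I" "sigma ! i < sigma ! j" "sigma ! j < sigma ! k"
  proof (rule ccontr)
    assume neg: "\<not> thesis"
    have "is_interval sigma ?I"
    proof (rule is_intervalI[OF sg])
      show "l \<in> ?I" if "i \<in> ?I" "k \<in> ?I" "i < l" "l < k" for i l k
        using that j by auto
      show "l \<in> ?I" if "i \<in> ?I" "k \<in> ?I" "l < ?m" "sigma ! i < sigma ! l" "sigma ! l < sigma ! k"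
        for i l k
        using neg \<open>\<And>i k. i \<in> ?I \<Longrightarrow> k \<in> ?I \<Longrightarrow> sigma ! i < sigma ! j \<Longrightarrow> sigma ! j < sigma ! k \<Longrightarrow> thesis\<close>[of i k] that
        by (cases "l = j") auto
    qed auto
    then show False using \<open>\<not> is_interval sigma ?I\<close> by blast
  qed
  then show "0 < sigma ! j" by simp
  have "sigma ! k < ?m" using ik perm_nth_less[OF sg] by simp
  then show "Suc (sigma ! j) < ?m" using ik by simp
qed

text \<open>The blocks met by \<open>V\<close> form an interval of \<open>sigma\<close>, because a
  block strictly between two met blocks, in position or in value, lies inside \<open>V\<close>. As
  \<open>sigma\<close> is simple, \<open>V\<close> meets no block, one block, or all of
  them.\<close>

lemma convex_in_block:
  assumes p: "is_perm p" and bs: "blocks p sigma bs" and simp: "simple sigma"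
    and m: "3 \<le> length sigma" and V: "convex p V"
  shows "V = set p \<or> (\<exists>i<length bs. V \<subseteq> set (bs ! i))"
proof -
  note c = blocks_concat[OF bs] and len = blocks_length[OF bs] and sg = blocks_perm[OF bs]
  have Vp: "V \<subseteq> set p" using V by (simp add: convex_def)
  define M where "M = {i. i < length bs \<and> V \<inter> set (bs ! i) \<noteq> {}}"
  have P: "set (bs ! j) \<subseteq> V" if ij: "i \<in> M" "k \<in> M" "i < j" "j < k" for i j k
  proof
    fix y assume y: "y \<in> set (bs ! j)"
    obtain x where x: "x \<in> V" "x \<in> set (bs ! i)" using ij(1) by (auto simp: M_def)
    obtain z where z: "z \<in> V" "z \<in> set (bs ! k)" using ij(2) by (auto simp: M_def)
    have l: "i < length bs" "j < length bs" "k < length bs" using ij by (auto simp: M_def)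
    obtain a where a: "a < start bs (Suc i)" "p ! a = x" using in_block_position[OF l(1) x(2)] c by metis
    obtain b where b: "start bs j \<le> b" "b < start bs (Suc j)" "p ! b = y"
      using in_block_position[OF l(2) y] c by metis
    obtain e where e: "start bs k \<le> e" "e < length p" "p ! e = z"
      using in_block_position[OF l(3) z(2)] c by metis
    have "a < b" "b < e"
      using start_mono[of "Suc i" j bs] start_mono[of "Suc j" k bs] ij a b e by auto
    then show "y \<in> V" using V x z a b e unfolding convex_def by blast
  qed
  have Q: "set (bs ! j) \<subseteq> V"
    if ij: "i \<in> M" "k \<in> M" "j < length bs" "sigma ! i < sigma ! j" "sigma ! j < sigma ! k" for i j k
  proof
    fix y assume y: "y \<in> set (bs ! j)"
    obtain x where x: "x \<in> V" "x \<in> set (bs ! i)" using ij(1) by (auto simp: M_def)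
    obtain z where z: "z \<in> V" "z \<in> set (bs ! k)" using ij(2) by (auto simp: M_def)
    have l: "i < length bs" "j < length bs" "k < length bs" using ij by (auto simp: M_def)
    have "i \<noteq> j" "j \<noteq> k" using ij by auto
    then have "x < y" "y < z"
      using blocks_less_iff[OF bs l(1,2) _ x(2) y] blocks_less_iff[OF bs l(2,3) _ y z(2)] ij by auto
    moreover have "y \<in> set p" using y l blocks_mem_iff[OF bs] by metis
    ultimately show "y \<in> V" using V x z unfolding convex_def by blast
  qed
  have mem: "j \<in> M" if "j < length bs" "set (bs ! j) \<subseteq> V" for j
    using blocks_nonempty[OF bs that(1)] that by (auto simp: M_def)
  have "is_interval sigma M"
  proof (rule is_intervalI[OF sg])
    show "M \<subseteq> {0..<length sigma}" by (auto simp: M_def len)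
    show "j \<in> M" if "i \<in> M" "k \<in> M" "i < j" "j < k" for i j k
      using P[OF that] that mem by (auto simp: M_def)
    show "j \<in> M" if "i \<in> M" "k \<in> M" "j < length sigma" "sigma ! i < sigma ! j" "sigma ! j < sigma ! k"
      for i j k
      using Q[of i k j] that mem len by simp
  qed
  then have "card M \<in> {0, 1, length sigma}" using simp by (simp only: simple_def)
  then consider "card M = 0" | "card M = 1" | "card M = length sigma" by auto
  then show ?thesis
  proof cases
    case 1
    then have "M = {}" by (simp add: M_def)
    then have "V = {}" using Vp blocks_mem_iff[OF bs] unfolding M_def by blast
    then show ?thesis using m len by (intro disjI2 exI[of _ 0]) auto
  next
    case 2
    then obtain i where i: "M = {i}" by (auto simp: card_1_singleton_iff)
    then have "i < length bs" by (auto simp: M_def)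
    moreover have "V \<subseteq> set (bs ! i)"
    proof
      fix x assume x: "x \<in> V"
      then obtain j where j: "j < length bs" "x \<in> set (bs ! j)" using Vp blocks_mem_iff[OF bs] by blast
      then have "j \<in> M" using x by (auto simp: M_def)
      then show "x \<in> set (bs ! i)" using i j by simp
    qed
    ultimately show ?thesis by blast
  next
    case 3
    have "M = {0..<length sigma}"
      by (rule card_subset_eq) (use 3 len in \<open>auto simp: M_def\<close>)
    \<comment> \<open>When all blocks are met, an inner block lies between the first and the last in
      position. The first and last blocks lie between the lowest and the highest in value, by
      \<open>simple_corner\<close>.\<close>
    then have all: "i \<in> M" if "i < length sigma" for i using that by simp
    have "set (bs ! j) \<subseteq> V" if j: "j < length sigma" for j
    proof (cases "j = 0 \<or> Suc j = length sigma")
      case True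
      note sc = simple_corner[OF sg simp m True]
      have m': "0 < length sigma" "length sigma - 1 < length sigma" using m by auto
      obtain i where i: "i < length sigma" "sigma ! i = 0" by (rule perm_nth_surj[OF sg m'(1)])
      obtain k where k: "k < length sigma" "sigma ! k = length sigma - 1"
        by (rule perm_nth_surj[OF sg m'(2)])
      show ?thesis by (rule Q[of i k j]) (use i k sc all j len in auto)
    next
      case False
      have "0 \<in> M" "length sigma - 1 \<in> M" by (rule all, use m in linarith)+
      then show ?thesis by (rule P) (use False j in auto)
    qed
    then have "set p \<subseteq> V" using len blocks_mem_iff[OF bs] by (metis subset_iff)
    then show ?thesis using Vp by auto
  qed
qed

text \<open>The first blocks of both lists share their first entry, so mutual containment makes them
  equal; the rest follows by induction.\<close>

lemma concat_eq_by_subset: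
  assumes "concat bs = concat cs" "distinct (concat bs)" "[] \<notin> set bs" "[] \<notin> set cs"
    and "\<And>b. b \<in> set bs \<Longrightarrow> \<exists>c\<in>set cs. set b \<subseteq> set c"
    and "\<And>c. c \<in> set cs \<Longrightarrow> \<exists>b\<in>set bs. set c \<subseteq> set b"
  shows "bs = cs"
  using assms
proof (induction bs arbitrary: cs)
  case Nil
  then show ?case by (cases cs) auto
next
  case (Cons b bs)
  then obtain c cs' where cs: "cs = c # cs'" by (cases cs) auto
  have dc: "distinct (concat cs)" using Cons.prems by simp
  have uniq: "e = c" if "e \<in> set cs" "x \<in> set e" "x \<in> set c" for e x
    using that dc cs by auto
  have uniq': "e = b" if "e \<in> set (b # bs)" "x \<in> set e" "x \<in> set b" for e x
    using that Cons.prems(2) by auto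
  have ne: "b \<noteq> []" "c \<noteq> []" using Cons.prems cs by auto
  then have hd: "hd b = hd c" using Cons.prems(1) cs by (metis concat.simps(2) hd_append2)
  have hdb: "hd b \<in> set b" "hd b \<in> set c" using ne hd list.set_sel(1) by metis+
  obtain e where e: "e \<in> set cs" "set b \<subseteq> set e" using Cons.prems(5)[of b] by auto
  then have "e = c" using uniq[of e "hd b"] hdb by blast
  obtain f where f: "f \<in> set (b # bs)" "set c \<subseteq> set f" using Cons.prems(6)[of c] cs by auto
  then have "f = b" using uniq'[of f "hd b"] hdb by blast
  have "set b = set c" using e f \<open>e = c\<close> \<open>f = b\<close> by auto
  moreover have "distinct b" "distinct c" using Cons.prems(2) dc cs by auto
  ultimately have "length b = length c" using distinct_card by metis
  then have bc: "b = c" "concat bs = concat cs'" using Cons.prems(1) cs by auto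
  have "bs = cs'"
  proof (rule Cons.IH)
    show "\<exists>c\<in>set cs'. set d \<subseteq> set c" if d: "d \<in> set bs" for d
    proof -
      obtain e where e: "e \<in> set cs" "set d \<subseteq> set e" using Cons.prems(5)[of d] d by auto
      have "d \<noteq> []" using d Cons.prems(3) by auto
      moreover have "set b \<inter> set d = {}" using Cons.prems(2) d by auto
      ultimately have "e \<noteq> c" using e(2) bc(1) by (metis Int_absorb1 set_empty)
      then show ?thesis using e cs by auto
    qed
    show "\<exists>b\<in>set bs. set d \<subseteq> set b" if dd: "d \<in> set cs'" for d
    proof -
      obtain e where e: "e \<in> set (b # bs)" "set d \<subseteq> set e" using Cons.prems(6)[of d] dd cs by auto
      have "d \<noteq> []" using dd Cons.prems(4) cs by auto
      moreover have "set c \<inter> set d = {}" using dc dd cs by auto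
      ultimately have "e \<noteq> b" using e(2) bc(1) by (metis Int_absorb1 set_empty)
      then show ?thesis using e by auto
    qed
  qed (use Cons.prems bc cs in auto)
  then show ?case using bc cs by simp
qed

lemma block_neq_set:
  assumes "is_perm p" "blocks p sigma bs" "2 \<le> length bs" "i < length bs"
  shows "set (bs ! i) \<noteq> set p"
proof
  assume *: "set (bs ! i) = set p"
  obtain j where j: "j < length bs" "j \<noteq> i"
    using assms(3) by (metis One_nat_def Suc_1 Suc_le_lessD less_trans zero_less_Suc zero_neq_one)
  have d: "distinct (concat bs)" using assms(1) blocks_concat[OF assms(2)] by (simp add: is_perm_def)
  have "set (bs ! j) \<subseteq> set p" using blocks_subset[OF assms(2) j(1)] .
  moreover have "set (bs ! j) \<inter> set (bs ! i) = {}"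
    by (rule disjoint_blocks[OF d j(1) assms(4) j(2)])
  moreover obtain x where "x \<in> set (bs ! j)" by (rule blocks_nonempty[OF assms(2) j(1)])
  ultimately show False using * by blast
qed

text \<open>Each block is convex and not all of \<open>p\<close>, so it lies within a block of the
  other decomposition, and conversely. Two blocks would not suffice: \<open>[0, 1, 2]\<close> is a
  sum in two ways.\<close>

lemma simple_blocks_unique:
  assumes p: "is_perm p" and bs: "blocks p sigma bs" "simple sigma" "3 \<le> length sigma"
    and cs: "blocks p tau cs" "simple tau" "3 \<le> length tau"
  shows "sigma = tau \<and> bs = cs"
proof -
  have *: "\<exists>c\<in>set cs. set b \<subseteq> set c"
    if h: "blocks p sigma bs" "3 \<le> length sigma" "blocks p tau cs" "simple tau" "3 \<le> length tau" "b \<in> set bs"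
    for sigma tau bs cs b
  proof -
    obtain i where i: "i < length bs" "b = bs ! i" using h(6) by (metis in_set_conv_nth)
    have "2 \<le> length bs" using h(2) blocks_length[OF h(1)] by simp
    then have "set b \<noteq> set p" using block_neq_set[OF p h(1) _ i(1)] i(2) by simp
    then show ?thesis
      using convex_in_block[OF p h(3-5) convex_block[OF p h(1) i(1)]] i(2) by auto
  qed
  have "bs = cs"
  proof (rule concat_eq_by_subset)
    show "distinct (concat bs)" using bs(1) p by (simp add: blocks_def is_perm_def)
  qed (use bs(1) cs(1) *[OF bs(1,3) cs] *[OF cs(1,3) bs] in \<open>simp_all add: blocks_def\<close>)
  then show ?thesis using blocks_order_iso_unique bs(1) cs(1) by blast
qed

lemma inflate_simple_inject:
  assumes "inflatable sigma as" "simple sigma" "3 \<le> length sigma"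
    and "inflatable tau cs" "simple tau" "3 \<le> length tau"
    and eq: "inflate sigma as = inflate tau cs"
  shows "sigma = tau \<and> as = cs"
proof -
  note b = blocks_inflate[OF assms(1)] and c = blocks_inflate[OF assms(4)]
  have "sigma = tau \<and> shifted sigma as = shifted tau cs"
    by (rule simple_blocks_unique[OF b(2,1) assms(2,3)]) (use c assms eq in simp_all)
  then show ?thesis using b(3) c(3) by metis
qed

section \<open>Existence of a decomposition with simple quotient\<close>

definition uniform :: "nat list list \<Rightarrow> bool" where
  "uniform bs \<longleftrightarrow> (\<forall>b\<in>set bs. \<forall>c\<in>set bs. b \<noteq> c \<longrightarrow>
    (\<forall>x\<in>set b. \<forall>x'\<in>set b. \<forall>y\<in>set c. \<forall>y'\<in>set c. x < y \<longrightarrow> x' < y'))"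

lemma uniformD:
  "uniform bs \<Longrightarrow> b \<in> set bs \<Longrightarrow> c \<in> set bs \<Longrightarrow> b \<noteq> c \<Longrightarrow> x \<in> set b \<Longrightarrow> x' \<in> set b \<Longrightarrow>
    y \<in> set c \<Longrightarrow> y' \<in> set c \<Longrightarrow> x < y \<Longrightarrow> x' < y'"
  unfolding uniform_def by blast

text \<open>\<open>uniform\<close> mentions no quotient, which makes it convenient when blocks are
  merged; the quotient is recovered afterwards as the pattern of the first entries.\<close>

lemma uniform_blocks:
  assumes d: "distinct (concat bs)" and ne: "[] \<notin> set bs" and u: "uniform bs"
  shows "blocks (concat bs) (std (map hd bs)) bs"
proof -
  have hd: "hd (bs ! i) \<in> set (bs ! i)" if "i < length bs" for i
  proof -
    have "bs ! i \<noteq> []" using that ne nth_mem by metis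
    then show ?thesis by simp
  qed
  have neq: "bs ! i \<noteq> bs ! j" if "i < length bs" "j < length bs" "i \<noteq> j" for i j
    using disjoint_blocks[OF d that] hd[OF that(1)] by auto
  have "distinct (map hd bs)"
    unfolding distinct_conv_nth
  proof (intro allI impI)
    fix i j assume ij: "i < length (map hd bs)" "j < length (map hd bs)" "i \<noteq> j"
    then have l: "i < length bs" "j < length bs" by simp_all
    then show "map hd bs ! i \<noteq> map hd bs ! j"
      using disjoint_blocks[OF d l ij(3)] hd[OF l(1)] hd[OF l(2)] by auto
  qed
  then have perm: "is_perm (std (map hd bs))" by (rule is_perm_std)
  have ord: "x < y \<longleftrightarrow> std (map hd bs) ! i < std (map hd bs) ! j"
    if l: "i < length bs" "j < length bs" "i \<noteq> j" and xy: "x \<in> set (bs ! i)" "y \<in> set (bs ! j)" for i j x y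
  proof -
    have "std (map hd bs) ! i < std (map hd bs) ! j \<longleftrightarrow> hd (bs ! i) < hd (bs ! j)"
      using l by (simp add: std_less_iff)
    also have "\<dots> \<longleftrightarrow> x < y"
      using uniformD[OF u nth_mem[OF l(1)] nth_mem[OF l(2)] neq[OF l]] hd[OF l(1)] hd[OF l(2)] xy
      by blast
    finally show ?thesis by simp
  qed
  show ?thesis
    unfolding blocks_def using ord ne perm by (intro conjI allI impI ballI) (assumption | rule refl | simp)+
qed

text \<open>A decomposition with the least number \<open>\<ge> 2\<close> of blocks has a simple quotient, since the blocks
  of a nontrivial interval of the quotient could be merged.\<close>

lemma exists_simple_blocks:
  assumes p: "is_perm p" and len: "2 \<le> length p"
  shows "\<exists>sigma bs. blocks p sigma bs \<and> simple sigma \<and> 2 \<le> length sigma"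
proof -
  define P where "P bs \<longleftrightarrow> concat bs = p \<and> [] \<notin> set bs \<and> uniform bs \<and> 2 \<le> length bs" for bs
  have "P (map (\<lambda>x. [x]) p)" using len by (auto simp: P_def uniform_def)
  then obtain bs where bs: "P bs" and least: "\<And>cs. P cs \<Longrightarrow> length bs \<le> length cs"
    using ex_has_least_nat[of P _ length] by blast
  let ?s = "std (map hd bs)"
  have c: "concat bs = p" and ne: "[] \<notin> set bs" and u: "uniform bs" and l2: "2 \<le> length bs"
    using bs unfolding P_def by blast+
  have d: "distinct (concat bs)" using p c by (simp add: is_perm_def)
  have b: "blocks p ?s bs" using uniform_blocks[OF d ne u] c by simp
  have sp: "is_perm ?s" by (rule blocks_perm[OF b])
  have "simple ?s"
  proof (rule ccontr)
    assume "\<not> simple ?s"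
    then obtain I where I: "is_interval ?s I" "card I \<notin> {0, 1, length bs}"
      unfolding simple_def by auto
    then obtain a e where ae: "a \<le> e" "e \<le> length bs" "I = {a..<e}"
      unfolding is_interval_def by auto
    define B where "B = concat (take (e - a) (drop a bs))"
    define cs where "cs = take a bs @ [B] @ drop e bs"
    have split: "bs = take a bs @ take (e - a) (drop a bs) @ drop e bs"
      using ae(1) by (metis append_take_drop_id drop_drop le_add_diff_inverse2)
    have "take (e - a) (drop a bs) = map ((!) bs) [a..<e]"
      using ae by (intro nth_equalityI) auto
    then have setB: "set B = (\<Union>i\<in>I. set (bs ! i))" using ae(3) by (simp add: B_def)
    \<comment> \<open>The first bound makes the merged list strictly shorter, against minimality;
      the second leaves at least two blocks.\<close>
    have card: "2 \<le> e - a" "e - a < length bs" using I(2) ae by auto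
    \<comment> \<open>Value convexity of \<open>I\<close>: a block outside \<open>I\<close> lies
      wholly above or wholly below the merged block.\<close>
    have key: "(x < y \<longrightarrow> x' < y') \<and> (y < x \<longrightarrow> y' < x')"
      if h: "k < length bs" "k \<notin> I" "x \<in> set B" "x' \<in> set B" "y \<in> set (bs ! k)" "y' \<in> set (bs ! k)"
      for k x x' y y'
    proof -
      obtain i where i: "i \<in> I" "x \<in> set (bs ! i)" using h(3) setB by blast
      obtain j where j: "j \<in> I" "x' \<in> set (bs ! j)" using h(4) setB by blast
      have il: "i < length bs" "j < length bs" using i j ae by auto
      have neq: "i \<noteq> k" "j \<noteq> k" using i j h by auto
      have between: "\<not> (?s ! i' < ?s ! k \<and> ?s ! k < ?s ! j')" if "i' \<in> I" "j' \<in> I" for i' j'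
        using is_interval_cases(3)[OF sp I(1) that, of k] h(1,2) by auto
      have inj: "?s ! i \<noteq> ?s ! k" "?s ! j \<noteq> ?s ! k"
        using perm_nth_eq_iff[OF sp] il h(1) neq by simp_all
      have "x < y \<longleftrightarrow> ?s ! i < ?s ! k" "x' < y' \<longleftrightarrow> ?s ! j < ?s ! k"
        "y < x \<longleftrightarrow> ?s ! k < ?s ! i" "y' < x' \<longleftrightarrow> ?s ! k < ?s ! j"
        using blocks_less_iff[OF b il(1) h(1) neq(1) i(2) h(5)]
          blocks_less_iff[OF b il(2) h(1) neq(2) j(2) h(6)]
          blocks_less_iff[OF b h(1) il(1) neq(1)[symmetric] h(5) i(2)]
          blocks_less_iff[OF b h(1) il(2) neq(2)[symmetric] h(6) j(2)] by blast+
      then show ?thesis using between[OF i(1) j(1)] between[OF j(1) i(1)] inj by auto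
    qed
    have mem: "c = B \<or> (\<exists>k. k < length bs \<and> k \<notin> I \<and> c = bs ! k)" if "c \<in> set cs" for c
    proof -
      have "\<exists>k. k < length bs \<and> k \<notin> I \<and> c = bs ! k" if c: "c \<in> set (take a bs)"
      proof -
        obtain k where "k < length (take a bs)" "take a bs ! k = c" using c by (metis in_set_conv_nth)
        then show ?thesis using ae by (intro exI[of _ k]) auto
      qed
      moreover have "\<exists>k. k < length bs \<and> k \<notin> I \<and> c = bs ! k" if c: "c \<in> set (drop e bs)"
      proof -
        obtain k where "k < length (drop e bs)" "drop e bs ! k = c" using c by (metis in_set_conv_nth)
        then show ?thesis using ae by (intro exI[of _ "e + k"]) auto
      qed
      ultimately show ?thesis using that unfolding cs_def by auto
    qed
    have "P cs"
      unfolding P_def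
    proof (intro conjI)
      have "concat bs = concat cs"
        by (subst split) (simp add: cs_def B_def)
      then show "concat cs = p" using c by simp
      have "B \<noteq> []"
      proof -
        have "a \<in> I" "a < length bs" using card ae by auto
        then obtain x where "x \<in> set (bs ! a)" using blocks_nonempty[OF b] by blast
        then show ?thesis using setB \<open>a \<in> I\<close> by force
      qed
      then show "[] \<notin> set cs" using mem[of "[]"] ne nth_mem by metis
      show "2 \<le> length cs" using card ae by (simp add: cs_def)
      show "uniform cs"
        unfolding uniform_def
      proof (intro ballI impI)
        fix d f x x' y y'
        assume df: "d \<in> set cs" "f \<in> set cs" "d \<noteq> f"
          and xy: "x \<in> set d" "x' \<in> set d" "y \<in> set f" "y' \<in> set f" "x < y"
        consider "d = B" "f \<noteq> B" | "f = B" "d \<noteq> B" | "d \<noteq> B" "f \<noteq> B" using df(3) by blast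
        then show "x' < y'"
        proof cases
          case 1
          then obtain k where "k < length bs" "k \<notin> I" "f = bs ! k" using mem[OF df(2)] by blast
          then show ?thesis using key[of k x x' y y'] xy 1 by blast
        next
          case 2
          then obtain k where "k < length bs" "k \<notin> I" "d = bs ! k" using mem[OF df(1)] by blast
          then show ?thesis using key[of k y y' x x'] xy 2 by blast
        next
          case 3
          then have "d \<in> set bs" "f \<in> set bs" using mem df nth_mem by metis+
          then show ?thesis using uniformD[OF u _ _ df(3) xy] by blast
        qed
      qed
    qed
    then have "length bs \<le> length cs" by (rule least)
    then show False using card ae by (simp add: cs_def)
  qed
  then show ?thesis using b l2 blocks_length[OF b] by (intro exI[of _ ?s] exI[of _ bs]) simp
qed

section \<open>Patterns of blocks inside a class\<close>

lemma class_std: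
  assumes C: "perm_class C" and p: "p \<in> C" and sub: "subseq xs p"
  shows "std xs \<in> C"
proof -
  have perm: "is_perm p" using C p unfolding perm_class_def by blast
  obtain N where N: "xs = nths p N" using sub by (auto simp: subseq_conv_nths)
  have "distinct xs" using perm unfolding N is_perm_def by (intro distinct_nthsI) blast
  then have "is_perm (std xs)" by (rule is_perm_std)
  \<comment> \<open>\<open>contains\<close> asks for an index set within the positions of
    \<open>p\<close>, while \<open>N\<close> may be arbitrary.\<close>
  moreover have "nths p N = nths p (N \<inter> {0..<length p})"
    unfolding nths_def by (rule arg_cong[of _ _ "map fst"], rule filter_cong) (auto dest: set_zip_rightD)
  ultimately have "is_perm (std xs)" "contains p (std xs)"
    unfolding contains_def using order_iso_std[of xs] N
    by (simp, intro exI[of _ "N \<inter> {0..<length p}"], simp)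
  then show ?thesis using C p unfolding perm_class_def by blast
qed

lemma subseq_map_hd: "[] \<notin> set bs \<Longrightarrow> subseq (map hd bs) (concat bs)"
proof (induction bs)
  case (Cons b bs)
  then have "subseq ([hd b] @ map hd bs) (b @ concat bs)"
    by (intro list_emb_append_mono) (auto simp: subseq_singleton_left)
  then show ?case by simp
qed simp

lemma subseq_concat: "b \<in> set bs \<Longrightarrow> subseq b (concat bs)"
  by (metis concat.simps(2) concat_append split_list sublist_appendI sublist_imp_subseq)

text \<open>The quotient is the pattern of the first entries of the blocks, and each block is itself
  a subsequence, so both are contained in \<open>p\<close>.\<close>

lemma class_blocks:
  assumes C: "perm_class C" and p: "p \<in> C" and bs: "blocks p sigma bs"
  shows "sigma \<in> C" "b \<in> set bs \<Longrightarrow> std b \<in> C"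
proof -
  have c: "concat bs = p" by (rule blocks_concat[OF bs])
  show "std b \<in> C" if "b \<in> set bs" using class_std[OF C p] subseq_concat[OF that] c by simp
  have ne: "[] \<notin> set bs" using bs unfolding blocks_def by blast
  have hd: "hd (bs ! i) \<in> set (bs ! i)" if "i < length bs" for i
  proof -
    have "bs ! i \<noteq> []" using that ne nth_mem by metis
    then show ?thesis by simp
  qed
  have "order_iso (map hd bs) sigma"
    unfolding order_iso_def
  proof (intro conjI allI impI)
    fix i j assume "i < length (map hd bs)" "j < length (map hd bs)"
    then have ij: "i < length bs" "j < length bs" by simp_all
    show "map hd bs ! i < map hd bs ! j \<longleftrightarrow> sigma ! i < sigma ! j"
      using blocks_less_iff[OF bs ij _ hd[OF ij(1)] hd[OF ij(2)]] ij by (cases "i = j") auto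
  qed (simp add: blocks_length[OF bs])
  then have "std (map hd bs) = sigma" using std_eqI blocks_perm[OF bs] by blast
  then show "sigma \<in> C" using class_std[OF C p subseq_map_hd[OF ne, unfolded c]] by simp
qed

lemma class_inflate:
  assumes "perm_class C" "inflatable sigma as" "inflate sigma as \<in> C"
  shows "sigma \<in> C" "set as \<subseteq> C"
proof -
  note b = blocks_inflate[OF assms(2)]
  show "sigma \<in> C" by (rule class_blocks[OF assms(1,3) b(1)])
  have "set (map std (shifted sigma as)) \<subseteq> C" using class_blocks(2)[OF assms(1,3) b(1)] by auto
  then show "set as \<subseteq> C" using b(3) by simp
qed

section \<open>Inverses\<close>

definition pinv :: "nat list \<Rightarrow> nat list" where
  "pinv p = map (\<lambda>v. THE i. i < length p \<and> p ! i = v) [0..<length p]"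

lemma length_pinv [simp]: "length (pinv p) = length p"
  by (simp add: pinv_def)

lemma pinv_nth:
  assumes "is_perm p" "i < length p"
  shows "pinv p ! (p ! i) = i"
proof -
  have "(THE j. j < length p \<and> p ! j = p ! i) = i"
    using assms perm_nth_eq_iff by (intro the_equality) auto
  then show ?thesis using perm_nth_less[OF assms] by (simp add: pinv_def)
qed

lemma nth_pinv:
  assumes "is_perm p" "v < length p"
  shows "pinv p ! v < length p" "p ! (pinv p ! v) = v"
proof -
  obtain i where "i < length p" "p ! i = v" by (rule perm_nth_surj[OF assms])
  then show "pinv p ! v < length p" "p ! (pinv p ! v) = v" using pinv_nth[OF assms(1)] by auto
qed

lemma is_perm_pinv:
  assumes "is_perm p"
  shows "is_perm (pinv p)"
proof -
  have d: "distinct (pinv p)"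
    unfolding distinct_conv_nth using nth_pinv[OF assms] by (metis length_pinv)
  have "set (pinv p) \<subseteq> {0..<length p}"
    using nth_pinv[OF assms] by (auto simp: in_set_conv_nth)
  then have "set (pinv p) = {0..<length p}"
    by (rule card_subset_eq[rotated]) (use d in \<open>auto simp: distinct_card\<close>)
  then show ?thesis using d by (simp add: is_perm_def)
qed

lemma pinv_unique:
  assumes "is_perm p" "length q = length p" "\<And>i. i < length p \<Longrightarrow> q ! (p ! i) = i"
  shows "q = pinv p"
proof (rule nth_equalityI)
  fix v assume "v < length q"
  then have "v < length p" using assms by simp
  then obtain i where "i < length p" "p ! i = v" by (rule perm_nth_surj[OF assms(1)])
  then show "q ! v = pinv p ! v" using assms(3) pinv_nth[OF assms(1)] by auto
qed (use assms in simp)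

lemma pinv_pinv:
  assumes "is_perm p"
  shows "pinv (pinv p) = p"
proof -
  have "p = pinv (pinv p)"
    by (rule pinv_unique) (use is_perm_pinv nth_pinv assms in auto)
  then show ?thesis by simp
qed

lemma involution_iff: "is_perm p \<Longrightarrow> involution p \<longleftrightarrow> pinv p = p"
  unfolding involution_def using pinv_unique pinv_nth by metis

lemma pinv_eq_Nil_iff [simp]: "pinv p = [] \<longleftrightarrow> p = []"
  by (metis length_0_conv length_pinv)

lemma concat_index:
  "a < length (concat bs) \<Longrightarrow> \<exists>i<length bs. \<exists>k<length (bs ! i). a = start bs i + k"
proof (induction bs arbitrary: a)
  case (Cons b bs)
  show ?case
  proof (cases "a < length b")
    case True
    then show ?thesis by (intro exI[of _ 0]) (auto simp: start_def)
  next
    case False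
    then have "a - length b < length (concat bs)" using Cons.prems by simp
    from Cons.IH[OF this] obtain i k
      where ik: "i < length bs" "k < length (bs ! i)" "a - length b = start bs i + k" by blast
    then have "a = start (b # bs) (Suc i) + k" using False by (simp add: start_def)
    then show ?thesis using ik by (intro exI[of _ "Suc i"]) auto
  qed
qed simp

lemma start_shifted:
  assumes "length as = length sigma" "i \<le> length sigma"
  shows "start (shifted sigma as) i = (\<Sum>j<i. length (as ! j))"
  using assms(2)
proof (induction i)
  case (Suc i)
  then show ?case using start_Suc[of i "shifted sigma as"] by simp
qed (simp add: start_def)

lemma inflate_nth:
  assumes "length as = length sigma" "i < length sigma" "k < length (as ! i)"
  shows "inflate sigma as ! ((\<Sum>j<i. length (as ! j)) + k) = as ! i ! k + off sigma as i"
  using concat_nth_start(2)[of i "shifted sigma as" k] assms start_shifted[of as sigma i]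
  by (simp add: inflate_shifted)

text \<open>Inversion exchanges positions and values. The value offset of a block becomes its
  starting position and vice versa (\<open>off'\<close> and \<open>start'\<close>), and the block in
  position \<open>v\<close> of the inverse is the inverted block at the position where
  \<open>sigma\<close> takes the value \<open>v\<close>.\<close>

lemma pinv_inflate:
  assumes inf: "inflatable sigma as"
  defines "cs \<equiv> map (\<lambda>v. pinv (as ! (pinv sigma ! v))) [0..<length sigma]"
  shows "pinv (inflate sigma as) = inflate (pinv sigma) cs" "inflatable (pinv sigma) cs"
proof -
  let ?m = "length sigma" and ?t = "pinv sigma"
  have sg: "is_perm sigma" and len: "length as = ?m"
    and as: "\<And>i. i < ?m \<Longrightarrow> is_perm (as ! i)" "\<And>i. i < ?m \<Longrightarrow> as ! i \<noteq> []"
    using inf by (auto simp: inflatable_def)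
  have lc: "length cs = length ?t" by (simp add: cs_def)
  have cs: "cs ! v = pinv (as ! (?t ! v))" if "v < ?m" for v using that by (simp add: cs_def)
  show inf': "inflatable (pinv sigma) cs"
    unfolding inflatable_def
  proof (intro conjI ballI)
    fix a assume "a \<in> set cs"
    then obtain v where v: "v < ?m" "a = pinv (as ! (?t ! v))" by (auto simp: cs_def)
    then show "is_perm a" "a \<noteq> []" using as nth_pinv(1)[OF sg v(1)] is_perm_pinv by auto
  qed (use is_perm_pinv[OF sg] lc in auto)
  have off': "off ?t cs (sigma ! i) = (\<Sum>j<i. length (as ! j))" if i: "i < ?m" for i
  proof -
    have "off ?t cs (sigma ! i) = (\<Sum>v | v < ?m \<and> ?t ! v < i. length (as ! (?t ! v)))"
      unfolding off_def by (rule sum.cong) (use pinv_nth[OF sg i] cs in auto)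
    also have "\<dots> = (\<Sum>j<i. length (as ! j))"
      by (rule sum.reindex_bij_witness[of _ "\<lambda>j. sigma ! j" "\<lambda>v. ?t ! v"])
        (use nth_pinv[OF sg] pinv_nth[OF sg] perm_nth_less[OF sg] i in auto)
    finally show ?thesis .
  qed
  have start': "(\<Sum>v<sigma ! i. length (cs ! v)) = off sigma as i" if i: "i < ?m" for i
  proof -
    have "(\<Sum>v<sigma ! i. length (cs ! v)) = (\<Sum>v<sigma ! i. length (as ! (?t ! v)))"
      by (rule sum.cong) (use perm_nth_less[OF sg i] cs in auto)
    also have "\<dots> = off sigma as i"
      unfolding off_def
      by (rule sum.reindex_bij_witness[of _ "\<lambda>j. sigma ! j" "\<lambda>v. ?t ! v"])
        (use nth_pinv[OF sg] pinv_nth[OF sg] perm_nth_less[OF sg i] in auto)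
    finally show ?thesis .
  qed
  have lens: "length (inflate ?t cs) = length (inflate sigma as)"
  proof -
    have "length (inflate ?t cs) = (\<Sum>v<?m. length (as ! (?t ! v)))"
      using lc cs by (simp add: length_inflate sum_list_sum_nth atLeast0LessThan)
    also have "\<dots> = (\<Sum>j<?m. length (as ! j))"
      by (rule sum.reindex_bij_witness[of _ "\<lambda>j. sigma ! j" "\<lambda>v. ?t ! v"])
        (use nth_pinv[OF sg] pinv_nth[OF sg] perm_nth_less[OF sg] in auto)
    finally show ?thesis using len by (simp add: length_inflate sum_list_sum_nth atLeast0LessThan)
  qed
  have "inflate ?t cs = pinv (inflate sigma as)"
  proof (rule pinv_unique[OF blocks_inflate(2)[OF inf] lens])
    fix a assume "a < length (inflate sigma as)"
    then obtain i k where ik: "i < ?m" "k < length (as ! i)" "a = (\<Sum>j<i. length (as ! j)) + k"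
      using concat_index[of a "shifted sigma as"] start_shifted[OF len]
      by (auto simp: inflate_shifted)
    have "inflate sigma as ! a = (\<Sum>v<sigma ! i. length (cs ! v)) + as ! i ! k"
      using inflate_nth[OF len ik(1,2)] ik(3) start'[OF ik(1)] by simp
    also have "inflate ?t cs ! \<dots> = cs ! (sigma ! i) ! (as ! i ! k) + off ?t cs (sigma ! i)"
      using perm_nth_less[OF sg ik(1)] perm_nth_less[OF as(1)[OF ik(1)] ik(2)] cs pinv_nth[OF sg ik(1)]
      by (intro inflate_nth[OF lc]) auto
    also have "\<dots> = a"
      using perm_nth_less[OF sg ik(1)] cs pinv_nth[OF sg ik(1)] pinv_nth[OF as(1)[OF ik(1)] ik(2)]
        off'[OF ik(1)] ik(3) by simp
    finally show "inflate ?t cs ! (inflate sigma as ! a) = a" .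
  qed
  then show "pinv (inflate sigma as) = inflate ?t cs" by simp
qed

text \<open>An interval of the inverse is carried to an interval of \<open>sigma\<close> of the same
  size, with the conditions on positions and on values trading places.\<close>

lemma simple_pinv:
  assumes sg: "is_perm sigma" and s: "simple sigma"
  shows "simple (pinv sigma)"
  unfolding simple_def
proof (intro allI impI)
  let ?t = "pinv sigma"
  fix J assume J: "is_interval ?t J"
  note ic = is_interval_cases[OF is_perm_pinv[OF sg] J]
  let ?M = "(!) ?t ` J"
  have JM: "j \<in> ?M" if "j < length sigma" "sigma ! j \<in> J" for j
    using that pinv_nth[OF sg] by force
  have MJ: "j < length sigma" "sigma ! j \<in> J" if "j \<in> ?M" for j
    using that nth_pinv[OF sg] ic(1) by auto
  have "is_interval sigma ?M"
  proof (rule is_intervalI[OF sg])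
    show "?M \<subseteq> {0..<length sigma}" using MJ(1) by auto
    show "j \<in> ?M" if "i \<in> ?M" "k \<in> ?M" "i < j" "j < k" for i j k
    proof (rule JM)
      show j: "j < length sigma" using MJ(1)[OF that(2)] that by simp
      show "sigma ! j \<in> J"
        using ic(3)[OF MJ(2)[OF that(1)] MJ(2)[OF that(2)], of "sigma ! j"] that
          pinv_nth[OF sg] j MJ(1) perm_nth_less[OF sg] by simp
    qed
    show "j \<in> ?M" if "i \<in> ?M" "k \<in> ?M" "j < length sigma" "sigma ! i < sigma ! j" "sigma ! j < sigma ! k"
      for i j k
      using JM[OF that(3)] ic(2)[OF MJ(2)[OF that(1)] MJ(2)[OF that(2)] that(4,5)] by blast
  qed
  then have "card ?M \<in> {0, 1, length sigma}" using s unfolding simple_def by blast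
  moreover have "inj_on ((!) ?t) J"
    using ic(1) nth_pinv(2)[OF sg] unfolding inj_on_def
    by (metis atLeastLessThan_iff length_pinv subsetD)
  ultimately show "card J \<in> {0, 1, length ?t}" by (simp add: card_image)
qed

section \<open>Sums and skew sums\<close>

text \<open>The flag \<open>s\<close> selects sums (\<open>True\<close>) or skew sums (\<open>False\<close>).\<close>

definition pm :: "bool \<Rightarrow> nat list" where
  "pm s = (if s then [0, 1] else [1, 0])"

text \<open>A cut is the boundary between two components, so nested decompositions can be compared
  by arithmetic with positions.\<close>

definition cut :: "bool \<Rightarrow> nat list \<Rightarrow> nat \<Rightarrow> bool" where
  "cut s p k \<longleftrightarrow> 0 < k \<and> k < length p \<and>
    (\<forall>i<k. \<forall>j. k \<le> j \<longrightarrow> j < length p \<longrightarrow> (if s then p ! i < p ! j else p ! j < p ! i))"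

definition dec :: "bool \<Rightarrow> nat list \<Rightarrow> bool" where
  "dec s p \<longleftrightarrow> (\<exists>k. cut s p k)"

lemma is_perm_pm: "is_perm (pm s)"
  by (auto simp: is_perm_def pm_def)

lemma length_pm [simp]: "length (pm s) = 2"
  by (simp add: pm_def)

lemma pinv_pm: "pinv (pm s) = pm s"
proof -
  have "involution (pm s)" by (auto simp: involution_def pm_def less_Suc_eq)
  then show ?thesis using involution_iff[OF is_perm_pm] by blast
qed

lemma inflatable_pm: "inflatable (pm s) [a, b] \<longleftrightarrow> is_perm a \<and> a \<noteq> [] \<and> is_perm b \<and> b \<noteq> []"
  by (auto simp: inflatable_def is_perm_pm)

lemma inflate_pm:
  "inflate (pm s) [a, b] = (if s then a @ map (\<lambda>v. v + length a) b else map (\<lambda>v. v + length b) a @ b)"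
  by (simp add: inflate_def pm_def)

lemma cut_blocks:
  assumes p: "is_perm p" and k: "cut s p k"
  shows "blocks p (pm s) [take k p, drop k p]"
proof -
  have lt: "if s then x < y else y < x" if xy: "x \<in> set (take k p)" "y \<in> set (drop k p)" for x y
  proof -
    obtain i where "i < k" "x = p ! i" using xy(1) by (auto simp: in_set_conv_nth)
    moreover obtain j where "j < length (drop k p)" "y = drop k p ! j"
      using xy(2) by (metis in_set_conv_nth)
    ultimately show ?thesis using k by (auto simp: cut_def)
  qed
  have k': "0 < k" "k < length p" using k by (auto simp: cut_def)
  show ?thesis
    unfolding blocks_def
  proof (intro conjI allI impI ballI)
    fix i j x y
    assume ij: "i < length [take k p, drop k p]" "j < length [take k p, drop k p]" "i \<noteq> j"
      and xy: "x \<in> set ([take k p, drop k p] ! i)" "y \<in> set ([take k p, drop k p] ! j)"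
    then consider "i = 0" "j = 1" | "i = 1" "j = 0" by fastforce
    then show "x < y \<longleftrightarrow> pm s ! i < pm s ! j"
    proof cases
      case 1
      then show ?thesis using lt[of x y] xy by (auto simp: pm_def split: if_splits)
    next
      case 2
      then show ?thesis using lt[of y x] xy by (auto simp: pm_def split: if_splits)
    qed
  qed (use k' is_perm_pm in auto)
qed

lemma cut_inflate:
  assumes "is_perm p" "cut s p k"
  shows "inflate (pm s) [std (take k p), std (drop k p)] = p"
    "inflatable (pm s) [std (take k p), std (drop k p)]"
  using inflate_blocks[OF assms(1) cut_blocks[OF assms]] by simp_all

lemma inflate_pm_cut:
  assumes "inflatable (pm s) [a, b]"
  shows "cut s (inflate (pm s) [a, b]) (length a)"
    "length (inflate (pm s) [a, b]) = length a + length b"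
    "std (take (length a) (inflate (pm s) [a, b])) = a"
    "std (drop (length a) (inflate (pm s) [a, b])) = b"
proof -
  note b = blocks_inflate[OF assms] and ab = assms[unfolded inflatable_pm]
  have a_nth: "i < length a \<Longrightarrow> a ! i < length a" and b_nth: "i < length b \<Longrightarrow> b ! i < length b" for i
    using perm_nth_less ab by auto
  show l: "length (inflate (pm s) [a, b]) = length a + length b" by (simp add: inflate_pm)
  show "cut s (inflate (pm s) [a, b]) (length a)"
    unfolding cut_def l using ab a_nth b_nth
    by (auto simp: inflate_pm nth_append trans_less_add1 trans_less_add2)
  have shift: "std (map (\<lambda>v. v + c) p) = p" if "is_perm p" for p c
    by (rule std_eqI[OF that]) (auto simp: order_iso_def)
  show "std (take (length a) (inflate (pm s) [a, b])) = a"
    "std (drop (length a) (inflate (pm s) [a, b])) = b"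
    using ab by (auto simp: inflate_pm shift std_perm)
qed

lemma cut_order_iso: "order_iso p q \<Longrightarrow> cut s p k \<longleftrightarrow> cut s q k"
  unfolding cut_def order_iso_def by (smt (verit, best) order.strict_trans order.strict_trans1)

lemma cut_take: "cut s p k \<Longrightarrow> cut s (take k p) j \<longleftrightarrow> j < k \<and> cut s p j"
  unfolding cut_def
  by (smt (verit, ccfv_threshold) length_take linorder_not_le min_less_iff_conj nth_take
      order.strict_trans order.strict_trans1 min.absorb2 less_imp_le_nat)

lemma cut_drop: "cut s p k \<Longrightarrow> k < l \<Longrightarrow> cut s p l \<Longrightarrow> cut s (drop k p) (l - k)"
  unfolding cut_def by auto

text \<open>Hence the first component is indecomposable exactly when its end is the first cut of the
  whole.\<close>

lemma cut_left_part:
  assumes "inflatable (pm s) [a, b]"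
  shows "cut s a j \<longleftrightarrow> j < length a \<and> cut s (inflate (pm s) [a, b]) j"
proof -
  let ?p = "inflate (pm s) [a, b]"
  have "cut s a j \<longleftrightarrow> cut s (take (length a) ?p) j"
    using cut_order_iso[OF order_iso_std[of "take (length a) ?p"]] inflate_pm_cut(3)[OF assms] by simp
  then show ?thesis using cut_take[OF inflate_pm_cut(1)[OF assms]] by simp
qed

lemma cut_right_part:
  assumes "inflatable (pm s) [a, b]" "length a < l" "cut s (inflate (pm s) [a, b]) l"
  shows "cut s b (l - length a)"
proof -
  let ?p = "inflate (pm s) [a, b]"
  have "cut s (drop (length a) ?p) (l - length a)"
    using cut_drop inflate_pm_cut(1)[OF assms(1)] assms(2,3) by blast
  then show ?thesis
    using cut_order_iso[OF order_iso_std[of "drop (length a) ?p"]] inflate_pm_cut(4)[OF assms(1)] by simp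
qed

lemma inflate_pm_inject_length:
  assumes "inflatable (pm s) [a, b]" "inflatable (pm s) [c, d]"
    and "inflate (pm s) [a, b] = inflate (pm s) [c, d]" "length a = length c"
  shows "a = c \<and> b = d"
proof -
  have "length b = length d"
    using inflate_pm_cut(2)[OF assms(1)] inflate_pm_cut(2)[OF assms(2)] assms(3,4) by simp
  then show ?thesis using inflate_inject[OF assms(1-3)] assms(4) by simp
qed

text \<open>If one first component were shorter, its length would be a cut inside the longer one,
  which is indecomposable. So the lengths agree, and they determine both parts.\<close>

lemma inflate_pm_inject:
  assumes "inflatable (pm s) [a, b]" "inflatable (pm s) [c, d]" "\<not> dec s a" "\<not> dec s c"
    and "inflate (pm s) [a, b] = inflate (pm s) [c, d]"
  shows "a = c \<and> b = d"
proof -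
  have "\<not> length a < length c" "\<not> length c < length a"
    using cut_left_part[OF assms(1)] cut_left_part[OF assms(2)] assms(3-5)
      inflate_pm_cut(1)[OF assms(1)] inflate_pm_cut(1)[OF assms(2)] unfolding dec_def by metis+
  then have "length a = length c" by simp
  then show ?thesis using inflate_pm_inject_length assms by blast
qed

lemma dec_exists:
  assumes p: "is_perm p" and "dec s p"
  obtains a b where "inflatable (pm s) [a, b]" "\<not> dec s a" "p = inflate (pm s) [a, b]"
proof -
  \<comment> \<open>Splitting at the least cut leaves no cut inside the first component.\<close>
  obtain k where k: "cut s p k" and least: "\<And>j. cut s p j \<Longrightarrow> k \<le> j"
    using assms(2) unfolding dec_def by (metis LeastI Least_le)
  let ?a = "std (take k p)" and ?b = "std (drop k p)"
  note ci = cut_inflate[OF p k]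
  have "k < length p" using k by (simp add: cut_def)
  then have "\<not> dec s ?a"
    unfolding dec_def using cut_left_part[OF ci(2)] least ci(1) by fastforce
  then show thesis using that ci by simp
qed

lemma dec_inflate_pm: "inflatable (pm s) [a, b] \<Longrightarrow> dec s (inflate (pm s) [a, b])"
  using inflate_pm_cut(1) unfolding dec_def by blast

text \<open>A cut separates the first entry from the last, so a sum has the first below the last and
  a skew sum has it above.\<close>

lemma dec_exclusive: "\<not> (dec s p \<and> dec (\<not> s) p)"
proof
  assume "dec s p \<and> dec (\<not> s) p"
  then obtain k l where kl: "cut s p k" "cut (\<not> s) p l" by (auto simp: dec_def)
  then have "0 < k" "0 < l" "k \<le> length p - 1" "l \<le> length p - 1" "length p - 1 < length p"
    unfolding cut_def by auto
  then have "if s then p ! 0 < p ! (length p - 1) else p ! (length p - 1) < p ! 0"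
    "if \<not> s then p ! 0 < p ! (length p - 1) else p ! (length p - 1) < p ! 0"
    using kl unfolding cut_def by blast+
  then show False by (cases s) auto
qed

lemma not_dec_singleton: "\<not> dec s [x]"
  by (simp add: dec_def cut_def)

text \<open>A cut splits the permutation into two convex parts, neither of them everything, so each
  lies within one block; but there are at least three blocks.\<close>

lemma simple_inflate_not_dec:
  assumes inf: "inflatable sigma as" and s: "simple sigma" and m: "3 \<le> length sigma"
  shows "\<not> dec s' (inflate sigma as)"
proof
  let ?p = "inflate sigma as" and ?bs = "shifted sigma as"
  note b = blocks_inflate[OF inf]
  assume "dec s' ?p"
  then obtain k where k: "cut s' ?p k" by (auto simp: dec_def)
  note cb = cut_blocks[OF b(2) k]
  let ?cs = "[take k ?p, drop k ?p]"
  have "\<exists>i<length ?bs. set (?cs ! l) \<subseteq> set (?bs ! i)" if l: "l < length ?cs" for l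
  proof -
    have "set (?cs ! l) \<noteq> set ?p" by (rule block_neq_set[OF b(2) cb _ l]) simp
    then show ?thesis
      using convex_in_block[OF b(2,1) s m convex_block[OF b(2) cb l]] by blast
  qed
  from this[of 0] this[of 1] obtain i j where
    ij: "i < length ?bs" "j < length ?bs" "set (take k ?p) \<subseteq> set (?bs ! i)" "set (drop k ?p) \<subseteq> set (?bs ! j)"
    by auto
  \<comment> \<open>Among three blocks one is neither \<open>i\<close> nor \<open>j\<close>; its
    entries would belong to neither part.\<close>
  have "card {0, 1, 2 :: nat} = 3" by simp
  moreover have "card {i, j} \<le> 2" by (simp add: card_insert_if)
  ultimately have "\<not> {0, 1, 2} \<subseteq> {i, j}" using card_mono[of "{i, j}" "{0, 1, 2}"] by fastforce
  then obtain l where l: "l < length ?bs" "l \<noteq> i" "l \<noteq> j" using m by fastforce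
  obtain x where x: "x \<in> set (?bs ! l)" by (rule blocks_nonempty[OF b(1) l(1)])
  then have "x \<in> set ?p" using blocks_subset[OF b(1) l(1)] by blast
  then have "x \<in> set (take k ?p) \<union> set (drop k ?p)" by (metis append_take_drop_id set_append)
  then have "x \<in> set (?bs ! i) \<union> set (?bs ! j)" using ij by blast
  moreover have d: "distinct (concat ?bs)" using b(2) inflate_shifted by (simp add: is_perm_def)
  ultimately show False
    using disjoint_blocks[OF d l(1) ij(1) l(2)] disjoint_blocks[OF d l(1) ij(2) l(3)] x by blast
qed

lemma perm_length_1: "is_perm p \<Longrightarrow> length p = 1 \<Longrightarrow> p = [0]"
  unfolding is_perm_def by (cases p) auto

lemma perm_length_2:
  assumes "is_perm p" "length p = 2"
  obtains s where "p = pm s"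
proof -
  obtain x y where p: "p = [x, y]" using assms(2) by (auto simp: length_Suc_conv numeral_2_eq_2)
  have "set p = {0..<2}" "distinct p" using assms unfolding is_perm_def by metis+
  moreover have "{0..<2} = {0, 1 :: nat}" by auto
  ultimately have "{x, y} = {0, 1}" "x \<noteq> y" unfolding p by simp_all
  then have "x = 0 \<and> y = 1 \<or> x = 1 \<and> y = 0" by (auto simp: doubleton_eq_iff)
  then show thesis using p that[of True] that[of False] by (auto simp: pm_def)
qed

text \<open>A simple quotient of length two is one of the two permutations \<open>pm s\<close>, and
  then the permutation is a sum or a skew sum.\<close>

lemma perm_cases:
  assumes p: "is_perm p" "p \<noteq> []"
  obtains (one) "p = [0]" | (dec) s where "dec s p"
    | (simple) sigma as where "inflatable sigma as" "simple sigma" "3 \<le> length sigma" "p = inflate sigma as"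
proof (cases "length p = 1")
  case True
  then show thesis using perm_length_1 p one by blast
next
  case False
  then have "2 \<le> length p" using p(2) by (cases p) (auto simp: Suc_le_eq)
  then obtain sigma bs where sb: "blocks p sigma bs" "simple sigma" "2 \<le> length sigma"
    using exists_simple_blocks[OF p(1)] by blast
  note ib = inflate_blocks[OF p(1) sb(1)]
  show thesis
  proof (cases "length sigma = 2")
    case True
    obtain s where s: "sigma = pm s" by (rule perm_length_2[OF blocks_perm[OF sb(1)] True])
    have "length bs = 2" using True blocks_length[OF sb(1)] by simp
    then obtain u v where "bs = [u, v]" by (auto simp: length_Suc_conv numeral_2_eq_2)
    then have "dec s p" using dec_inflate_pm[of s "std u" "std v"] ib s by simp
    then show thesis by (rule dec)
  next
    case False
    then show thesis using simple ib sb by fastforce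
  qed
qed

lemma pinv_inflate_pm:
  assumes "inflatable (pm s) [a, b]"
  shows "pinv (inflate (pm s) [a, b]) = (if s then inflate (pm s) [pinv a, pinv b] else inflate (pm s) [pinv b, pinv a])"
    "inflatable (pm s) [pinv a, pinv b]"
proof -
  have "map (\<lambda>v. pinv ([a, b] ! (pm s ! v))) [0..<2] = (if s then [pinv a, pinv b] else [pinv b, pinv a])"
    by (simp add: pm_def upt_rec)
  then show "pinv (inflate (pm s) [a, b]) = (if s then inflate (pm s) [pinv a, pinv b] else inflate (pm s) [pinv b, pinv a])"
    using pinv_inflate(1)[OF assms] by (simp add: pinv_pm)
  show "inflatable (pm s) [pinv a, pinv b]"
    using assms by (simp add: inflatable_pm is_perm_pinv)
qed

text \<open>Inversion reverses the order of skew components, so three of them must be regrouped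
  before they can be compared.\<close>

lemma inflate_pm_assoc:
  "inflate (pm s) [inflate (pm s) [a, b], c] = inflate (pm s) [a, inflate (pm s) [b, c]]"
  by (simp add: inflate_pm add.assoc add.commute)

section \<open>Generating functions of classes of permutations\<close>

text \<open>For positive \<open>k\<close> this is \<open>A(x^k)\<close>, written as a weighted count
  rather than a substitution so that every equation can be obtained from a bijection.\<close>

definition gf :: "nat \<Rightarrow> nat list set \<Rightarrow> rat fps" where
  "gf k A = Abs_fps (\<lambda>n. of_nat (card {p \<in> A. k * length p = n}))"

abbreviation gfp :: "nat \<times> nat list set \<Rightarrow> rat fps" where
  "gfp v \<equiv> gf (fst v) (snd v)"

lemma gf_nth: "gf k A $ n = of_nat (card {p \<in> A. k * length p = n})"
  by (simp add: gf_def)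

lemma finite_perms_weight:
  assumes "\<And>p. p \<in> A \<Longrightarrow> is_perm p" "0 < k"
  shows "finite {p \<in> A. k * length p = n}"
proof (rule finite_subset)
  show "{p \<in> A. k * length p = n} \<subseteq> {p. set p \<subseteq> {0..<n} \<and> length p \<le> n}"
    using assms by (auto simp: is_perm_def) (metis add.commute le_add1 less_le_trans mult_eq_if not_gr_zero)+
qed (rule finite_lists_length_le, simp)

lemma gf_UN:
  assumes "finite K" "\<And>x p. x \<in> K \<Longrightarrow> p \<in> A x \<Longrightarrow> is_perm p" "0 < k"
    and "\<And>x y. x \<in> K \<Longrightarrow> y \<in> K \<Longrightarrow> x \<noteq> y \<Longrightarrow> A x \<inter> A y = {}"
  shows "gf k (\<Union>x\<in>K. A x) = (\<Sum>x\<in>K. gf k (A x))"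
proof (rule fps_ext)
  fix n
  have "{p \<in> (\<Union>x\<in>K. A x). k * length p = n} = (\<Union>x\<in>K. {p \<in> A x. k * length p = n})" by auto
  also have "card \<dots> = (\<Sum>x\<in>K. card {p \<in> A x. k * length p = n})"
    by (rule card_UN_disjoint) (use assms finite_perms_weight in \<open>blast+\<close>)
  finally show "gf k (\<Union>x\<in>K. A x) $ n = (\<Sum>x\<in>K. gf k (A x)) $ n"
    by (simp add: gf_nth fps_sum_nth)
qed

lemma gf_Un:
  assumes "\<And>p. p \<in> A \<union> B \<Longrightarrow> is_perm p" "0 < k" "A \<inter> B = {}"
  shows "gf k (A \<union> B) = gf k A + gf k B"
proof (rule fps_ext)
  fix n
  have "{p \<in> A \<union> B. k * length p = n} = {p \<in> A. k * length p = n} \<union> {p \<in> B. k * length p = n}"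
    by auto
  also have "card \<dots> = card {p \<in> A. k * length p = n} + card {p \<in> B. k * length p = n}"
    by (rule card_Un_disjoint) (use assms finite_perms_weight in \<open>blast+\<close>)
  finally show "gf k (A \<union> B) $ n = (gf k A + gf k B) $ n" by (simp add: gf_nth)
qed

lemma gf_image:
  assumes "inj_on f A" "\<And>a. a \<in> A \<Longrightarrow> k * length (f a) = j * length a"
  shows "gf k (f ` A) = gf j A"
proof (rule fps_ext)
  fix n
  have "{p \<in> f ` A. k * length p = n} = f ` {p \<in> A. j * length p = n}" using assms(2) by auto
  moreover have "inj_on f {p \<in> A. j * length p = n}" using assms(1) by (rule inj_on_subset) auto
  ultimately show "gf k (f ` A) $ n = gf j A $ n" by (simp add: gf_nth card_image)
qed

section \<open>Tuples of permutations and products of series\<close>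

definition tuples :: "(nat \<times> nat list set) list \<Rightarrow> nat list list set" where
  "tuples l = {as. list_all2 (\<lambda>a v. a \<in> snd v) as l}"

definition weight :: "(nat \<times> nat list set) list \<Rightarrow> nat list list \<Rightarrow> nat" where
  "weight l as = (\<Sum>i<length l. fst (l ! i) * length (as ! i))"

lemma tuples_iff:
  "as \<in> tuples l \<longleftrightarrow> length as = length l \<and> (\<forall>i<length l. as ! i \<in> snd (l ! i))"
  by (auto simp: tuples_def list_all2_conv_all_nth)

text \<open>The Cauchy product: \<open>P n i\<close> collects the tuples of weight \<open>n\<close>
  whose first component contributes \<open>i\<close>.\<close>

lemma gf_tuples:
  assumes "\<And>v. v \<in> set l \<Longrightarrow> 0 < fst v" "\<And>v p. v \<in> set l \<Longrightarrow> p \<in> snd v \<Longrightarrow> is_perm p"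
  shows "finite {as \<in> tuples l. weight l as = n}"
    and "Abs_fps (\<lambda>n. of_nat (card {as \<in> tuples l. weight l as = n})) = prod_list (map gfp l)"
proof -
  have "(\<forall>n. finite {as \<in> tuples l. weight l as = n}) \<and>
    Abs_fps (\<lambda>n. of_nat (card {as \<in> tuples l. weight l as = n})) = prod_list (map gfp l)"
    if "\<forall>v\<in>set l. 0 < fst v \<and> (\<forall>p\<in>snd v. is_perm p)" for l
    using that
  proof (induction l)
    case Nil
    have "{as \<in> tuples []. weight [] as = n} = (if n = 0 then {[]} else {})" for n
      by (auto simp: tuples_def weight_def)
    then show ?case by (auto intro!: fps_ext simp: fps_one_nth)
  next
    case (Cons v l)
    obtain k A where v: "v = (k, A)" by (cases v)
    have IH: "\<And>n. finite {as \<in> tuples l. weight l as = n}"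
      "Abs_fps (\<lambda>n. of_nat (card {as \<in> tuples l. weight l as = n})) = prod_list (map gfp l)"
      using Cons by auto
    have finA: "finite {a \<in> A. k * length a = i}" for i
      using Cons.prems v by (intro finite_perms_weight) auto
    have w: "weight (v # l) (a # as) = k * length a + weight l as" for a as
      by (simp add: weight_def v sum.lessThan_Suc_shift del: sum.lessThan_Suc)
    define P where "P n i = {a \<in> A. k * length a = i} \<times> {as \<in> tuples l. weight l as = n - i}" for n i
    have eq: "{as \<in> tuples (v # l). weight (v # l) as = n} = (\<lambda>(a, as). a # as) ` (\<Union>i\<in>{0..n}. P n i)" for n
    proof (intro equalityI subsetI)
      fix bs assume "bs \<in> {as \<in> tuples (v # l). weight (v # l) as = n}"
      then obtain a as where "bs = a # as" "a \<in> A" "as \<in> tuples l" "k * length a + weight l as = n"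
        using w v by (auto simp: tuples_def list_all2_Cons2)
      then show "bs \<in> (\<lambda>(a, as). a # as) ` (\<Union>i\<in>{0..n}. P n i)"
        by (intro image_eqI[of _ _ "(a, as)"] UN_I[of "k * length a"]) (auto simp: P_def)
    next
      fix bs assume "bs \<in> (\<lambda>(a, as). a # as) ` (\<Union>i\<in>{0..n}. P n i)"
      then show "bs \<in> {as \<in> tuples (v # l). weight (v # l) as = n}"
        by (auto simp: P_def tuples_def v w[unfolded v])
    qed
    have finP: "finite (P n i)" for n i unfolding P_def using finA IH(1) by blast
    have card: "card {as \<in> tuples (v # l). weight (v # l) as = n} =
      (\<Sum>i=0..n. card {a \<in> A. k * length a = i} * card {as \<in> tuples l. weight l as = n - i})" for n
    proof -
      have "card {as \<in> tuples (v # l). weight (v # l) as = n} = card (\<Union>i\<in>{0..n}. P n i)"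
        unfolding eq by (rule card_image) (auto simp: inj_on_def)
      also have "\<dots> = (\<Sum>i\<in>{0..n}. card (P n i))"
        by (rule card_UN_disjoint) (use finP in \<open>auto simp: P_def\<close>)
      finally show ?thesis by (simp add: P_def card_cartesian_product)
    qed
    show ?case
    proof
      show "\<forall>n. finite {as \<in> tuples (v # l). weight (v # l) as = n}"
        unfolding eq using finP by blast
      have "Abs_fps (\<lambda>n. of_nat (card {as \<in> tuples (v # l). weight (v # l) as = n})) =
        gf k A * Abs_fps (\<lambda>n. of_nat (card {as \<in> tuples l. weight l as = n}))"
        by (rule fps_ext) (simp add: card fps_mult_nth gf_nth)
      then show "Abs_fps (\<lambda>n. of_nat (card {as \<in> tuples (v # l). weight (v # l) as = n})) =
        prod_list (map gfp (v # l))"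
        using IH(2) v by simp
    qed
  qed
  from this[of l] show "finite {as \<in> tuples l. weight l as = n}"
    "Abs_fps (\<lambda>n. of_nat (card {as \<in> tuples l. weight l as = n})) = prod_list (map gfp l)"
    using assms by blast+
qed

lemma gf_image_tuples:
  assumes "\<And>v. v \<in> set l \<Longrightarrow> 0 < fst v" "\<And>v p. v \<in> set l \<Longrightarrow> p \<in> snd v \<Longrightarrow> is_perm p"
    and "inj_on f (tuples l)" "\<And>as. as \<in> tuples l \<Longrightarrow> k * length (f as) = weight l as"
  shows "gf k (f ` tuples l) = prod_list (map gfp l)"
proof -
  have "card {p \<in> f ` tuples l. k * length p = n} = card {as \<in> tuples l. weight l as = n}" for n
  proof -
    have "{p \<in> f ` tuples l. k * length p = n} = f ` {as \<in> tuples l. weight l as = n}"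
      using assms(4) by auto
    moreover have "inj_on f {as \<in> tuples l. weight l as = n}" using assms(3) by (rule inj_on_subset) auto
    ultimately show ?thesis by (simp add: card_image)
  qed
  then show ?thesis using gf_tuples(2)[OF assms(1,2)] by (simp add: gf_def)
qed

text \<open>An unknown of the system is indexed by the pair \<open>(k, A)\<close> itself; it stands for
  \<open>A(x\<^sup>k)\<close>, where \<open>k = 2\<close> accounts for a block together with its mirror image.\<close>

definition rhs :: "(nat \<times> nat list set) set \<Rightarrow> rat fps set" where
  "rhs V = {z. \<exists>ts. over V ts \<and> contractive ts \<and> z = peval gfp ts}"

lemma rhs_0: "0 \<in> rhs V"
  unfolding rhs_def by (intro CollectI exI[of _ "[]"]) simp

lemma rhs_add:
  assumes "y \<in> rhs V" "z \<in> rhs V"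
  shows "y + z \<in> rhs V"
proof -
  obtain ts us where "over V ts" "contractive ts" "y = peval gfp ts"
    "over V us" "contractive us" "z = peval gfp us"
    using assms by (auto simp: rhs_def)
  then show ?thesis unfolding rhs_def by (intro CollectI exI[of _ "ts @ us"]) simp
qed

lemma rhs_sum: "(\<And>x. x \<in> K \<Longrightarrow> g x \<in> rhs V) \<Longrightarrow> sum g K \<in> rhs V"
  by (induction K rule: infinite_finite_induct) (auto simp: rhs_0 intro: rhs_add)

lemma rhs_X: "fps_X ^ Suc k \<in> rhs V"
  unfolding rhs_def
  by (intro CollectI exI[of _ "[(monom 1 (Suc k), [])]"]) (simp add: fps_of_poly_monom' del: power_Suc)

lemma rhs_prod:
  assumes "set l \<subseteq> V" "2 \<le> length l"
  shows "prod_list (map gfp l) \<in> rhs V"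
  unfolding rhs_def by (intro CollectI exI[of _ "[(1, l)]"]) (use assms in simp)

lemma length_inflate_sum:
  "length as = length sigma \<Longrightarrow> length (inflate sigma as) = (\<Sum>i<length sigma. length (as ! i))"
  by (simp add: length_inflate sum_list_sum_nth atLeast0LessThan)

section \<open>The system for permutations and involutions of given type\<close>

text \<open>The type \<open>tau\<close> abstracts the answers to all queries. The equations need
  only that it takes finitely many values and that the types of inflations and inverses can be
  computed from those of the constituents; the law for \<open>C\<close> is two-way so that unions
  over types give exactly the class.\<close>

locale inflation_class =
  fixes C :: "nat list set" and T :: "'t set" and tau :: "nat list \<Rightarrow> 't"
    and opr :: "nat list \<Rightarrow> 't list \<Rightarrow> 't" and iv :: "'t \<Rightarrow> 't"
  assumes C_perm: "p \<in> C \<Longrightarrow> is_perm p"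
    and C_inflate: "inflatable sigma as \<Longrightarrow> inflate sigma as \<in> C \<longleftrightarrow> sigma \<in> C \<and> set as \<subseteq> C"
    and C_pinv: "p \<in> C \<Longrightarrow> pinv p \<in> C"
    and finite_simple: "finite {p \<in> C. simple p}"
    and finite_T: "finite T" and tau_T: "tau p \<in> T"
    and tau_inflate: "inflatable sigma as \<Longrightarrow> tau (inflate sigma as) = opr sigma (map tau as)"
    and tau_pinv: "is_perm p \<Longrightarrow> tau (pinv p) = iv (tau p)"
begin

text \<open>The empty permutation is left out because blocks are nonempty and because every unknown
  needs constant term 0.\<close>

definition Al :: "'t \<Rightarrow> nat list set" where
  "Al t = {p \<in> C. p \<noteq> [] \<and> tau p = t}"

definition Ind :: "bool \<Rightarrow> 't \<Rightarrow> nat list set" where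
  "Ind s t = {p \<in> Al t. \<not> dec s p}"

definition Inv :: "'t \<Rightarrow> nat list set" where
  "Inv t = {p \<in> Al t. pinv p = p}"

definition InvInd :: "'t \<Rightarrow> nat list set" where
  "InvInd t = {p \<in> Inv t. \<not> dec True p}"

definition Dec :: "bool \<Rightarrow> 't \<Rightarrow> nat list set" where
  "Dec s t = {p \<in> Al t. dec s p}"

definition Sim :: "'t \<Rightarrow> nat list set" where
  "Sim t = {p \<in> Al t. \<exists>sigma as. inflatable sigma as \<and> simple sigma \<and> 3 \<le> length sigma \<and>
    p = inflate sigma as}"

text \<open>Arbitrary permutations occur only with weight 2: in involutions they come with a mirror
  image of the same length, and their own equations stay at weight 2. Indecomposable variants serve
  as first components of sums and skew sums.\<close>

definition V :: "(nat \<times> nat list set) set" where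
  "V = (\<lambda>t. (2, Al t)) ` T \<union> (\<lambda>(s, t). (2, Ind s t)) ` (UNIV \<times> T) \<union>
    (\<lambda>t. (1, Inv t)) ` T \<union> (\<lambda>t. (1, InvInd t)) ` T"

lemmas class_defs = Al_def Ind_def Inv_def InvInd_def Dec_def Sim_def

lemma V_I:
  "t \<in> T \<Longrightarrow> (2, Al t) \<in> V" "t \<in> T \<Longrightarrow> (2, Ind s t) \<in> V"
  "t \<in> T \<Longrightarrow> (Suc 0, Inv t) \<in> V" "t \<in> T \<Longrightarrow> (Suc 0, InvInd t) \<in> V"
  unfolding V_def by auto

lemma finite_V: "finite V"
  unfolding V_def using finite_T by simp

lemma AlD: "p \<in> Al t \<Longrightarrow> p \<in> C \<and> is_perm p \<and> p \<noteq> [] \<and> tau p = t"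
  unfolding Al_def using C_perm by blast

lemma V_D:
  assumes "v \<in> V"
  shows "0 < fst v" "p \<in> snd v \<Longrightarrow> p \<in> C \<and> is_perm p \<and> p \<noteq> []"
  using assms C_perm unfolding V_def class_defs by auto

lemma gf_V_0:
  assumes "v \<in> V"
  shows "gfp v $ 0 = 0"
proof -
  have "{p \<in> snd v. fst v * length p = 0} = {}" using V_D[OF assms] by auto
  then show ?thesis unfolding gf_nth by (simp only: card.empty of_nat_0)
qed

lemma singleton_cases: "A \<subseteq> {[0]} \<Longrightarrow> gf (Suc k) A \<in> rhs V"
proof -
  assume "A \<subseteq> {[0]}"
  then consider "A = {}" | "A = {[0]}" by blast
  then show ?thesis
  proof cases
    case 1
    then have "gf (Suc k) A = 0" by (intro fps_ext) (simp add: gf_nth)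
    then show ?thesis using rhs_0 by simp
  next
    case 2
    have "{p \<in> {[0::nat]}. Suc k * length p = n} = (if n = Suc k then {[0]} else {})" for n by auto
    then have "gf (Suc k) A = fps_X ^ Suc k"
      unfolding 2 by (intro fps_ext) (simp add: gf_nth fps_X_power_nth del: power_Suc)
    then show ?thesis using rhs_X by simp
  qed
qed

lemma rhs_UN:
  assumes "finite K" "0 < k" "\<And>x. x \<in> K \<Longrightarrow> gf k (A x) \<in> rhs V"
    and "\<And>x p. x \<in> K \<Longrightarrow> p \<in> A x \<Longrightarrow> p \<in> C"
    and "\<And>x y. x \<in> K \<Longrightarrow> y \<in> K \<Longrightarrow> x \<noteq> y \<Longrightarrow> A x \<inter> A y = {}"
  shows "gf k (\<Union>x\<in>K. A x) \<in> rhs V"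
  using rhs_sum[of K "\<lambda>x. gf k (A x)" V] gf_UN[of K A k] assms C_perm by metis

lemma rhs_Un:
  assumes "0 < k" "gf k A \<in> rhs V" "gf k B \<in> rhs V" "A \<subseteq> C" "B \<subseteq> C" "A \<inter> B = {}"
  shows "gf k (A \<union> B) \<in> rhs V"
  using rhs_add[OF assms(2,3)] gf_Un[of A B k] assms C_perm by (metis Un_iff subsetD)

lemma rhs_Un3:
  assumes "gf k A \<in> rhs V" "gf k B \<in> rhs V" "gf k D \<in> rhs V" "0 < k" "A \<union> B \<union> D \<subseteq> C"
    and "A \<inter> B = {}" "A \<inter> D = {}" "B \<inter> D = {}"
  shows "gf k (A \<union> B \<union> D) \<in> rhs V"
  by (intro rhs_Un assms) (use assms in auto)

lemma rhs_image_tuples: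
  assumes "set l \<subseteq> V" "2 \<le> length l" "inj_on f (tuples l)"
    and "\<And>as. as \<in> tuples l \<Longrightarrow> k * length (f as) = weight l as"
  shows "gf k (f ` tuples l) \<in> rhs V"
proof -
  have "gf k (f ` tuples l) = prod_list (map gfp l)"
  proof (rule gf_image_tuples)
    show "0 < fst v" if "v \<in> set l" for v using V_D(1) that assms(1) by blast
    show "is_perm p" if "v \<in> set l" "p \<in> snd v" for v p using V_D(2) that assms(1) by blast
  qed (use assms in auto)
  then show ?thesis using rhs_prod[OF assms(1,2)] by simp
qed

lemma Al_cases:
  "Al t = (Al t \<inter> {[0]}) \<union> Dec True t \<union> Dec False t \<union> Sim t"
proof -
  have "p = [0] \<or> dec True p \<or> dec False p \<or> (\<exists>sigma as. inflatable sigma as \<and> simple sigma \<and>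
      3 \<le> length sigma \<and> p = inflate sigma as)" if "p \<in> Al t" for p
  proof -
    have "is_perm p" "p \<noteq> []" using AlD[OF that] by auto
    then show ?thesis
    proof (cases rule: perm_cases)
      case (dec s)
      then show ?thesis by (cases s) auto
    qed blast+
  qed
  then show ?thesis unfolding Dec_def Sim_def by blast
qed

lemma Sim_not_dec: "p \<in> Sim t \<Longrightarrow> \<not> dec s p"
  unfolding Sim_def using simple_inflate_not_dec by blast

lemma pieces_disjoint:
  "(Al t \<inter> {[0]}) \<inter> Dec s t = {}" "Dec s t \<inter> Dec (\<not> s) t = {}" "Sim t \<inter> Dec s t = {}"
  "(Al t \<inter> {[0]}) \<inter> Sim t = {}"
proof -
  show "(Al t \<inter> {[0]}) \<inter> Dec s t = {}" unfolding Dec_def using not_dec_singleton by blast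
  show "Dec s t \<inter> Dec (\<not> s) t = {}" unfolding Dec_def using dec_exclusive by blast
  show "Sim t \<inter> Dec s t = {}" unfolding Dec_def using Sim_not_dec by blast
  show "(Al t \<inter> {[0]}) \<inter> Sim t = {}"
  proof -
    have "[0] \<noteq> inflate sigma as" if "inflatable sigma as" "3 \<le> length sigma" for sigma as
    proof
      assume "[0] = inflate sigma as"
      then have "(\<Sum>i<length sigma. length (as ! i)) = 1"
        using length_inflate_sum[of as sigma] that by (simp add: inflatable_def flip: \<open>[0] = inflate sigma as\<close>)
      moreover have "(\<Sum>i<length sigma. 1) \<le> (\<Sum>i<length sigma. length (as ! i))"
        using that by (intro sum_mono) (auto simp: inflatable_def Suc_le_eq)
      ultimately show False using that by simp
    qed
    then show ?thesis unfolding Sim_def by blast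
  qed
qed

lemma pieces_subset: "Al t \<subseteq> C" "Dec s t \<subseteq> C" "Sim t \<subseteq> C"
  unfolding class_defs by auto

section \<open>Equations for sums and skew sums\<close>

lemma tuples_pair:
  "as \<in> tuples [(k, A), (j, B)] \<longleftrightarrow> (\<exists>a b. as = [a, b] \<and> a \<in> A \<and> b \<in> B)"
  by (auto simp: tuples_def list_all2_Cons2)

lemma weight_pair: "weight [(k, A), (j, B)] [a, b] = k * length a + j * length b"
  by (simp add: weight_def)

lemma inflatable_pm_Al: "a \<in> Al x \<Longrightarrow> b \<in> Al y \<Longrightarrow> inflatable (pm s) [a, b]"
  using AlD by (simp add: inflatable_pm)

lemma inflate_pm_Al_iff:
  assumes "inflatable (pm s) [a, b]"
  shows "inflate (pm s) [a, b] \<in> Al t \<longleftrightarrow>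
    pm s \<in> C \<and> a \<in> Al (tau a) \<and> b \<in> Al (tau b) \<and> opr (pm s) [tau a, tau b] = t"
  using C_inflate[OF assms] tau_inflate[OF assms] assms inflate_pm_cut(2)[OF assms]
  unfolding Al_def by (auto simp: inflatable_pm)

text \<open>The condition on \<open>pm s\<close> makes the set empty when the class contains no sums
  or skew sums.\<close>

definition pairs :: "bool \<Rightarrow> 't \<Rightarrow> ('t \<times> 't) set" where
  "pairs s t = {(x, y). x \<in> T \<and> y \<in> T \<and> pm s \<in> C \<and> opr (pm s) [x, y] = t}"

lemma finite_pairs: "finite (pairs s t)"
  by (rule finite_subset[of _ "T \<times> T"]) (auto simp: pairs_def finite_T)

lemma Dec_eq:
  "Dec s t = (\<Union>(x, y)\<in>pairs s t. inflate (pm s) ` tuples [(2, Ind s x), (2, Al y)])"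
proof (intro equalityI subsetI)
  fix p assume p: "p \<in> Dec s t"
  then have "is_perm p" "dec s p" using AlD unfolding Dec_def by blast+
  then obtain a b where ab: "inflatable (pm s) [a, b]" "\<not> dec s a" "p = inflate (pm s) [a, b]"
    by (rule dec_exists)
  have "pm s \<in> C \<and> a \<in> Al (tau a) \<and> b \<in> Al (tau b) \<and> opr (pm s) [tau a, tau b] = t"
    using p inflate_pm_Al_iff[OF ab(1)] unfolding Dec_def ab(3) by blast
  then show "p \<in> (\<Union>(x, y)\<in>pairs s t. inflate (pm s) ` tuples [(2, Ind s x), (2, Al y)])"
    using ab tau_T by (intro UN_I[of "(tau a, tau b)"]) (auto simp: pairs_def tuples_pair Ind_def)
next
  fix p assume "p \<in> (\<Union>(x, y)\<in>pairs s t. inflate (pm s) ` tuples [(2, Ind s x), (2, Al y)])"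
  then obtain x y a b where xy: "(x, y) \<in> pairs s t" "a \<in> Ind s x" "b \<in> Al y" "p = inflate (pm s) [a, b]"
    by (auto simp: tuples_pair)
  then have ab: "a \<in> Al x" "b \<in> Al y" by (auto simp: Ind_def)
  note inf = inflatable_pm_Al[OF ab, of s]
  show "p \<in> Dec s t"
    unfolding Dec_def using dec_inflate_pm[OF inf] inflate_pm_Al_iff[OF inf] xy ab AlD[OF ab(1)] AlD[OF ab(2)]
    by (auto simp: pairs_def)
qed

lemma inflate_Ind_inject:
  assumes "a \<in> Ind s x" "b \<in> Al y" "a' \<in> Ind s x'" "b' \<in> Al y'"
    and "inflate (pm s) [a, b] = inflate (pm s) [a', b']"
  shows "a = a' \<and> b = b' \<and> x = x' \<and> y = y'"
proof -
  have al: "a \<in> Al x" "a' \<in> Al x'" using assms by (auto simp: Ind_def)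
  have "a = a' \<and> b = b'"
    by (rule inflate_pm_inject[OF inflatable_pm_Al[OF al(1) assms(2)] inflatable_pm_Al[OF al(2) assms(4)] _ _ assms(5)])
      (use assms in \<open>auto simp: Ind_def\<close>)
  then show ?thesis using al assms AlD by metis
qed

lemma rhs_Dec: "gf 2 (Dec s t) \<in> rhs V"
  unfolding Dec_eq
proof (rule rhs_UN[OF finite_pairs])
  fix z assume z: "z \<in> pairs s t"
  obtain x y where xy: "z = (x, y)" by (cases z)
  have "gf 2 (inflate (pm s) ` tuples [(2, Ind s x), (2, Al y)]) \<in> rhs V"
  proof (rule rhs_image_tuples)
    show "set [(2, Ind s x), (2, Al y)] \<subseteq> V" using z xy by (auto simp: pairs_def V_I)
    show "inj_on (inflate (pm s)) (tuples [(2, Ind s x), (2, Al y)])"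
      by (rule inj_onI) (use inflate_Ind_inject in \<open>auto simp: tuples_pair\<close>)
    show "2 * length (inflate (pm s) as) = weight [(2, Ind s x), (2, Al y)] as"
      if "as \<in> tuples [(2, Ind s x), (2, Al y)]" for as
      using that by (auto simp: tuples_pair weight_pair inflate_pm)
  qed simp
  then show "gf 2 (case z of (x, y) \<Rightarrow> inflate (pm s) ` tuples [(2, Ind s x), (2, Al y)]) \<in> rhs V"
    using xy by simp
next
  fix z p assume "z \<in> pairs s t"
    "p \<in> (case z of (x, y) \<Rightarrow> inflate (pm s) ` tuples [(2, Ind s x), (2, Al y)])"
  then have "p \<in> Dec s t" unfolding Dec_eq by blast
  then show "p \<in> C" using pieces_subset by blast
next
  fix z w assume zw: "z \<in> pairs s t" "w \<in> pairs s t" "z \<noteq> w"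
  show "(case z of (x, y) \<Rightarrow> inflate (pm s) ` tuples [(2, Ind s x), (2, Al y)]) \<inter>
    (case w of (x, y) \<Rightarrow> inflate (pm s) ` tuples [(2, Ind s x), (2, Al y)]) = {}"
    using zw(3) inflate_Ind_inject by (cases z, cases w) (fastforce simp: tuples_pair)
qed simp

section \<open>Equations for inflations of longer simple permutations\<close>

definition frames :: "'t \<Rightarrow> (nat list \<times> 't list) set" where
  "frames t = {(sigma, ts). sigma \<in> C \<and> simple sigma \<and> 3 \<le> length sigma \<and> length ts = length sigma \<and>
    set ts \<subseteq> T \<and> opr sigma ts = t}"

lemma finite_frames: "finite (frames t)"
proof (rule finite_subset)
  show "frames t \<subseteq> (SIGMA sigma:{p \<in> C. simple p}. {ts. set ts \<subseteq> T \<and> length ts = length sigma})"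
    by (auto simp: frames_def)
  show "finite (SIGMA sigma:{p \<in> C. simple p}. {ts. set ts \<subseteq> T \<and> length ts = length sigma})"
    using finite_simple finite_lists_length_eq[OF finite_T] by (intro finite_SigmaI) auto
qed

definition slots :: "'t list \<Rightarrow> (nat \<times> nat list set) list" where
  "slots ts = map (\<lambda>t. (2, Al t)) ts"

lemma tuples_slots: "as \<in> tuples (slots ts) \<longleftrightarrow> length as = length ts \<and> (\<forall>i<length ts. as ! i \<in> Al (ts ! i))"
  by (auto simp: tuples_iff slots_def)

lemma tuples_slots_D:
  assumes "sigma \<in> C" "length ts = length sigma" "as \<in> tuples (slots ts)"
  shows "inflatable sigma as" "map tau as = ts" "set as \<subseteq> C"
proof -
  have as: "length as = length ts" "\<And>i. i < length ts \<Longrightarrow> as ! i \<in> Al (ts ! i)"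
    using assms by (auto simp: tuples_slots)
  then show "inflatable sigma as"
    using assms(1,2) C_perm AlD[OF as(2)] by (auto simp: inflatable_def in_set_conv_nth)
  show "map tau as = ts" using as AlD by (intro nth_equalityI) auto
  show "set as \<subseteq> C" using as(1) AlD[OF as(2)] by (auto simp: in_set_conv_nth)
qed

lemma inflate_nonempty:
  assumes "inflatable sigma as" "sigma \<noteq> []"
  shows "inflate sigma as \<noteq> []"
proof -
  have "0 < length as" using assms by (simp add: inflatable_def)
  then have "0 < length (as ! 0)" using assms unfolding inflatable_def by (metis length_greater_0_conv nth_mem)
  also have "\<dots> \<le> (\<Sum>i<length sigma. length (as ! i))"
    using assms by (intro member_le_sum) auto
  finally show ?thesis using length_inflate_sum[of as sigma] assms by (auto simp: inflatable_def)
qed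

lemma Sim_eq: "Sim t = (\<Union>(sigma, ts)\<in>frames t. inflate sigma ` tuples (slots ts))"
proof (intro equalityI subsetI)
  fix p assume p: "p \<in> Sim t"
  then obtain sigma as where sa: "inflatable sigma as" "simple sigma" "3 \<le> length sigma" "p = inflate sigma as"
    unfolding Sim_def by blast
  have pC: "p \<in> C" "tau p = t" using p AlD unfolding Sim_def by blast+
  then have C: "sigma \<in> C" "set as \<subseteq> C" using C_inflate[OF sa(1)] sa(4) by auto
  have "(sigma, map tau as) \<in> frames t"
    using C sa tau_inflate[OF sa(1)] pC tau_T by (auto simp: frames_def inflatable_def)
  moreover have "as \<in> tuples (slots (map tau as))"
    using C sa(1) by (auto simp: tuples_slots Al_def inflatable_def)
  ultimately show "p \<in> (\<Union>(sigma, ts)\<in>frames t. inflate sigma ` tuples (slots ts))"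
    using sa(4) by blast
next
  fix p assume "p \<in> (\<Union>(sigma, ts)\<in>frames t. inflate sigma ` tuples (slots ts))"
  then obtain sigma ts as where *: "(sigma, ts) \<in> frames t" "as \<in> tuples (slots ts)" "p = inflate sigma as"
    by blast
  then have f: "sigma \<in> C" "simple sigma" "3 \<le> length sigma" "length ts = length sigma" "opr sigma ts = t"
    by (auto simp: frames_def)
  note d = tuples_slots_D[OF f(1,4) *(2)]
  have "sigma \<noteq> []" using f(3) by auto
  then have "p \<in> Al t"
    using C_inflate[OF d(1)] tau_inflate[OF d(1)] inflate_nonempty[OF d(1)] d f *(3)
    unfolding Al_def by auto
  then show "p \<in> Sim t" using d f *(3) unfolding Sim_def by blast
qed

lemma frames_inject:
  assumes "(sigma, ts) \<in> frames t" "(sigma', ts') \<in> frames t"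
    and "as \<in> tuples (slots ts)" "as' \<in> tuples (slots ts')" "inflate sigma as = inflate sigma' as'"
  shows "sigma = sigma' \<and> ts = ts' \<and> as = as'"
proof -
  have f: "sigma \<in> C" "simple sigma" "3 \<le> length sigma" "length ts = length sigma"
    "sigma' \<in> C" "simple sigma'" "3 \<le> length sigma'" "length ts' = length sigma'"
    using assms(1,2) by (auto simp: frames_def)
  note d = tuples_slots_D[OF f(1,4) assms(3)] tuples_slots_D[OF f(5,8) assms(4)]
  show ?thesis
    using inflate_simple_inject[OF d(1) f(2,3) d(4) f(6,7) assms(5)] d(2,5) by auto
qed

lemma rhs_Sim: "gf 2 (Sim t) \<in> rhs V"
  unfolding Sim_eq
proof (rule rhs_UN[OF finite_frames])
  fix z assume z: "z \<in> frames t"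
  obtain sigma ts where st: "z = (sigma, ts)" by (cases z)
  have f: "sigma \<in> C" "3 \<le> length sigma" "length ts = length sigma" "set ts \<subseteq> T"
    using z st by (auto simp: frames_def)
  have "gf 2 (inflate sigma ` tuples (slots ts)) \<in> rhs V"
  proof (rule rhs_image_tuples)
    show "set (slots ts) \<subseteq> V" using f by (auto simp: slots_def V_I)
    show "2 \<le> length (slots ts)" using f by (simp add: slots_def)
    show "inj_on (inflate sigma) (tuples (slots ts))"
      using frames_inject z st unfolding inj_on_def by blast
    show "2 * length (inflate sigma as) = weight (slots ts) as" if as: "as \<in> tuples (slots ts)" for as
    proof -
      have "length as = length sigma" using as f by (simp add: tuples_slots)
      then show ?thesis
        using f(3) by (simp add: length_inflate_sum weight_def slots_def sum_distrib_left)
    qed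
  qed
  then show "gf 2 (case z of (sigma, ts) \<Rightarrow> inflate sigma ` tuples (slots ts)) \<in> rhs V"
    using st by simp
next
  fix z p assume "z \<in> frames t" "p \<in> (case z of (sigma, ts) \<Rightarrow> inflate sigma ` tuples (slots ts))"
  then have "p \<in> Sim t" unfolding Sim_eq by blast
  then show "p \<in> C" using pieces_subset by blast
next
  fix z w assume zw: "z \<in> frames t" "w \<in> frames t" "z \<noteq> w"
  obtain sigma ts sigma' ts' where "z = (sigma, ts)" "w = (sigma', ts')" by (cases z, cases w)
  then show "(case z of (sigma, ts) \<Rightarrow> inflate sigma ` tuples (slots ts)) \<inter>
    (case w of (sigma, ts) \<Rightarrow> inflate sigma ` tuples (slots ts)) = {}"
    using zw frames_inject[of sigma ts t sigma' ts'] by auto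
qed simp

lemma rhs_one: "gf (Suc k) (Al t \<inter> {[0]}) \<in> rhs V" "gf (Suc k) (Inv t \<inter> {[0]}) \<in> rhs V"
  by (rule singleton_cases; blast)+

text \<open>The complement of \<open>Dec s t\<close> is expressed by the remaining disjoint pieces,
  so the equation needs no subtraction.\<close>

lemma Ind_eq: "Ind s t = Al t \<inter> {[0]} \<union> Dec (\<not> s) t \<union> Sim t"
proof -
  have "Ind s t = Al t - Dec s t" by (auto simp: Ind_def Dec_def)
  also have "\<dots> = Al t \<inter> {[0]} \<union> Dec (\<not> s) t \<union> Sim t"
    using Al_cases[of t] pieces_disjoint(1)[of t s] pieces_disjoint(2)[of s t] pieces_disjoint(3)[of t s]
    by (cases s) auto
  finally show ?thesis .
qed

lemma Al_eq: "Al t = Ind s t \<union> Dec s t" "Ind s t \<inter> Dec s t = {}"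
  by (auto simp: Ind_def Dec_def)

lemma rhs_Ind: "gf 2 (Ind s t) \<in> rhs V"
  unfolding Ind_eq
proof (rule rhs_Un3)
  show "gf 2 (Al t \<inter> {[0]}) \<in> rhs V" using rhs_one(1)[of 1] by (simp only: numeral_2_eq_2 One_nat_def)
  show "Al t \<inter> {[0]} \<union> Dec (\<not> s) t \<union> Sim t \<subseteq> C" using pieces_subset by blast
  show "Dec (\<not> s) t \<inter> Sim t = {}" using pieces_disjoint(3) by blast
qed (rule rhs_Dec rhs_Sim pieces_disjoint zero_less_numeral)+

text \<open>The bare unknown \<open>Ind True t\<close> would not be a contractive term; its own
  right-hand side is inserted in its place.\<close>

lemma rhs_Al: "gf 2 (Al t) \<in> rhs V"
  unfolding Al_eq(1)[of t True]
  by (rule rhs_Un[OF _ rhs_Ind rhs_Dec _ _ Al_eq(2)]) (use pieces_subset in \<open>auto simp: Ind_def\<close>)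

end

section \<open>Equations for involutions\<close>

context inflation_class
begin

lemma InvD: "p \<in> Inv t \<Longrightarrow> p \<in> Al t \<and> pinv p = p"
  by (simp add: Inv_def)

text \<open>Inversion keeps the order and the lengths of the components of a sum, so a sum is an
  involution exactly when both components are.\<close>

lemma Dec_True_Inv_eq:
  "Dec True t \<inter> Inv t =
    (\<Union>(x, y)\<in>pairs True t. inflate (pm True) ` tuples [(Suc 0, InvInd x), (Suc 0, Inv y)])"
proof (intro equalityI subsetI)
  fix p assume p: "p \<in> Dec True t \<inter> Inv t"
  then obtain x y a b where xy: "(x, y) \<in> pairs True t" "a \<in> Ind True x" "b \<in> Al y"
    "p = inflate (pm True) [a, b]"
    unfolding Dec_eq by (auto simp: tuples_pair)
  then have inf: "inflatable (pm True) [a, b]" using inflatable_pm_Al by (auto simp: Ind_def)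
  note pi = pinv_inflate_pm[OF inf]
  have "inflate (pm True) [pinv a, pinv b] = inflate (pm True) [a, b]"
    using p InvD pi(1) xy(4) by auto
  then have "pinv a = a \<and> pinv b = b" using inflate_pm_inject_length[OF pi(2) inf] by simp
  then have "a \<in> InvInd x" "b \<in> Inv y" using xy by (auto simp: InvInd_def Inv_def Ind_def)
  then show "p \<in> (\<Union>(x, y)\<in>pairs True t. inflate (pm True) ` tuples [(Suc 0, InvInd x), (Suc 0, Inv y)])"
    using xy by (intro UN_I[of "(x, y)"]) (auto simp: tuples_pair)
next
  fix p assume "p \<in> (\<Union>(x, y)\<in>pairs True t. inflate (pm True) ` tuples [(Suc 0, InvInd x), (Suc 0, Inv y)])"
  then obtain x y a b where xy: "(x, y) \<in> pairs True t" "a \<in> InvInd x" "b \<in> Inv y"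
    "p = inflate (pm True) [a, b]"
    by (auto simp: tuples_pair)
  have ab: "a \<in> Ind True x" "b \<in> Al y" "a \<in> Al x" "pinv a = a" "pinv b = b"
    using xy by (auto simp: InvInd_def Inv_def Ind_def)
  then have D: "p \<in> Dec True t"
    unfolding Dec_eq using xy by (intro UN_I[of "(x, y)"]) (auto simp: tuples_pair)
  moreover have "pinv p = p"
    using pinv_inflate_pm(1)[OF inflatable_pm_Al[OF ab(3,2)], of True] ab(4,5) xy(4) by simp
  ultimately show "p \<in> Dec True t \<inter> Inv t" by (auto simp: Inv_def Dec_def)
qed

lemma inflate_InvInd_inject:
  assumes "a \<in> InvInd x" "b \<in> Inv y" "a' \<in> InvInd x'" "b' \<in> Inv y'"
    and "inflate (pm True) [a, b] = inflate (pm True) [a', b']"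
  shows "a = a' \<and> b = b' \<and> x = x' \<and> y = y'"
proof -
  have sub: "InvInd x \<subseteq> Ind True x" "Inv y \<subseteq> Al y" for x y
    by (auto simp: InvInd_def Inv_def Ind_def)
  show ?thesis
    by (rule inflate_Ind_inject[OF _ _ _ _ assms(5)]) (use assms sub in blast)+
qed

lemma rhs_Dec_True_Inv: "gf (Suc 0) (Dec True t \<inter> Inv t) \<in> rhs V"
  unfolding Dec_True_Inv_eq
proof (rule rhs_UN[OF finite_pairs])
  fix z assume z: "z \<in> pairs True t"
  obtain x y where xy: "z = (x, y)" by (cases z)
  have "gf (Suc 0) (inflate (pm True) ` tuples [(Suc 0, InvInd x), (Suc 0, Inv y)]) \<in> rhs V"
  proof (rule rhs_image_tuples)
    show "set [(Suc 0, InvInd x), (Suc 0, Inv y)] \<subseteq> V" using z xy by (auto simp: pairs_def V_I)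
    show "inj_on (inflate (pm True)) (tuples [(Suc 0, InvInd x), (Suc 0, Inv y)])"
      by (rule inj_onI) (use inflate_InvInd_inject in \<open>auto simp: tuples_pair\<close>)
    show "Suc 0 * length (inflate (pm True) as) = weight [(Suc 0, InvInd x), (Suc 0, Inv y)] as"
      if "as \<in> tuples [(Suc 0, InvInd x), (Suc 0, Inv y)]" for as
      using that by (auto simp: tuples_pair weight_pair inflate_pm)
  qed simp
  then show "gf (Suc 0) (case z of (x, y) \<Rightarrow> inflate (pm True) ` tuples [(Suc 0, InvInd x), (Suc 0, Inv y)]) \<in> rhs V"
    using xy by simp
next
  fix z p assume "z \<in> pairs True t"
    "p \<in> (case z of (x, y) \<Rightarrow> inflate (pm True) ` tuples [(Suc 0, InvInd x), (Suc 0, Inv y)])"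
  then have "p \<in> Dec True t \<inter> Inv t" unfolding Dec_True_Inv_eq by blast
  then show "p \<in> C" using pieces_subset by blast
next
  fix z w assume zw: "z \<in> pairs True t" "w \<in> pairs True t" "z \<noteq> w"
  show "(case z of (x, y) \<Rightarrow> inflate (pm True) ` tuples [(Suc 0, InvInd x), (Suc 0, Inv y)]) \<inter>
    (case w of (x, y) \<Rightarrow> inflate (pm True) ` tuples [(Suc 0, InvInd x), (Suc 0, Inv y)]) = {}"
    using zw(3) inflate_InvInd_inject by (cases z, cases w) (fastforce simp: tuples_pair)
qed simp

text \<open>A skew decomposable involution is either \<open>b \<ominus> b\<inverse>\<close> or \<open>b \<ominus> c \<ominus> b\<inverse>\<close> with an involution \<open>c\<close>,
  where \<open>b\<close> is skew indecomposable.\<close>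

definition sandwich :: "nat list list \<Rightarrow> nat list" where
  "sandwich as = inflate (pm False) [as ! 0, inflate (pm False) [as ! 1, pinv (as ! 0)]]"

definition mirrored :: "nat list \<Rightarrow> nat list" where
  "mirrored b = inflate (pm False) [b, pinv b]"

definition outer :: "'t \<Rightarrow> 't set" where
  "outer t = {x. (x, iv x) \<in> pairs False t}"

definition outer_inner :: "'t \<Rightarrow> ('t \<times> 't) set" where
  "outer_inner t = {(x, y). x \<in> T \<and> y \<in> T \<and> pm False \<in> C \<and>
    opr (pm False) [x, opr (pm False) [y, iv x]] = t}"

lemma finite_outer: "finite (outer t)" "finite (outer_inner t)"
  by (rule finite_subset[of _ T] finite_subset[of _ "T \<times> T"];
      auto simp: outer_def outer_inner_def pairs_def finite_T)+

lemma pinv_Al: "p \<in> Al t \<Longrightarrow> pinv p \<in> Al (iv t)"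
  using C_perm C_pinv tau_pinv unfolding Al_def by simp

lemma sandwich_parts:
  assumes "pm False \<in> C" "a \<in> Ind False x" "c \<in> Inv y"
  shows "inflate (pm False) [c, pinv a] \<in> Al (opr (pm False) [y, iv x])"
    "inflatable (pm False) [a, inflate (pm False) [c, pinv a]]"
    "inflatable (pm False) [c, pinv a]"
proof -
  have ac: "a \<in> Al x" "c \<in> Al y" using assms by (auto simp: Ind_def Inv_def)
  have pa: "pinv a \<in> Al (iv x)" by (rule pinv_Al[OF ac(1)])
  show inf: "inflatable (pm False) [c, pinv a]" by (rule inflatable_pm_Al[OF ac(2) pa])
  have "tau c = y" "tau (pinv a) = iv x" using AlD ac(2) pa by blast+
  then show b: "inflate (pm False) [c, pinv a] \<in> Al (opr (pm False) [y, iv x])"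
    using inflate_pm_Al_iff[OF inf, of "opr (pm False) [y, iv x]"] assms(1) ac(2) pa by simp
  show "inflatable (pm False) [a, inflate (pm False) [c, pinv a]]"
    by (rule inflatable_pm_Al[OF ac(1) b])
qed

text \<open>The outer part is the skew indecomposable first component, hence determined; the length
  of the middle part follows, and with it the middle part.\<close>

lemma sandwich_inject:
  assumes "pm False \<in> C" "a \<in> Ind False x" "c \<in> Inv y" "a' \<in> Ind False x'" "c' \<in> Inv y'"
    and "sandwich [a, c] = sandwich [a', c']"
  shows "a = a' \<and> c = c' \<and> x = x' \<and> y = y'"
proof -
  note s = sandwich_parts[OF assms(1-3)] and s' = sandwich_parts[OF assms(1,4,5)]
  have "inflate (pm False) [a, inflate (pm False) [c, pinv a]] =
    inflate (pm False) [a', inflate (pm False) [c', pinv a']]"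
    using assms(6) by (simp add: sandwich_def)
  then have 1: "a = a' \<and> inflate (pm False) [c, pinv a] = inflate (pm False) [c', pinv a'] \<and> x = x'"
    using inflate_Ind_inject[OF assms(2) s(1) assms(4) s'(1)] by blast
  then have "length c + length (pinv a) = length c' + length (pinv a')"
    using inflate_pm_cut(2)[OF s(3)] inflate_pm_cut(2)[OF s'(3)] by metis
  then have "length c = length c'" using 1 by simp
  then have "c = c'" using inflate_pm_inject_length[OF s(3) s'(3)] 1 by blast
  then show ?thesis using 1 assms(3,5) AlD InvD by metis
qed

lemma mirrored_inject:
  assumes "a \<in> Ind False x" "a' \<in> Ind False x'" "mirrored a = mirrored a'"
  shows "a = a' \<and> x = x'"
  using inflate_Ind_inject[OF assms(1) pinv_Al assms(2) pinv_Al] assms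
  by (auto simp: mirrored_def Ind_def)

text \<open>Equality would make the outer parts agree, and comparing the lengths of the remainders
  would leave an empty middle.\<close>

lemma mirrored_neq_sandwich:
  assumes "pm False \<in> C" "a \<in> Ind False x" "c \<in> Inv y" "a' \<in> Ind False x'"
  shows "mirrored a' \<noteq> sandwich [a, c]"
proof
  assume eq: "mirrored a' = sandwich [a, c]"
  note s = sandwich_parts[OF assms(1-3)]
  have "a' \<in> Al x'" using assms(4) by (simp add: Ind_def)
  then have "a' = a \<and> pinv a' = inflate (pm False) [c, pinv a]"
    using inflate_Ind_inject[OF assms(4) pinv_Al assms(2) s(1)] eq
    by (simp add: mirrored_def sandwich_def)
  then have "length a = length c + length a" using inflate_pm_cut(2)[OF s(3)] by (metis length_pinv)
  then show False using assms(3) InvD AlD by fastforce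
qed

text \<open>Write \<open>p\<close> as the skew sum of an indecomposable \<open>a\<close> and
  \<open>b\<close>. As \<open>p\<close> equals its inverse, it is also the skew sum of
  \<open>pinv b\<close> and \<open>pinv a\<close>. If \<open>b\<close> is shorter than
  \<open>a\<close>, this puts a cut inside \<open>a\<close>, which is impossible; equal lengths give
  the mirrored form, and a longer \<open>b\<close> gives the sandwich.\<close>

lemma Dec_False_Inv_eq:
  "Dec False t \<inter> Inv t = (\<Union>x\<in>outer t. mirrored ` Ind False x) \<union>
    (\<Union>(x, y)\<in>outer_inner t. sandwich ` tuples [(2, Ind False x), (Suc 0, Inv y)])"
proof (intro equalityI subsetI)
  fix p assume p: "p \<in> Dec False t \<inter> Inv t"
  then obtain x y a b where xy: "(x, y) \<in> pairs False t" "a \<in> Ind False x" "b \<in> Al y"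
    "p = inflate (pm False) [a, b]"
    unfolding Dec_eq by (auto simp: tuples_pair)
  then have aA: "a \<in> Al x" by (simp add: Ind_def)
  have perms: "is_perm a" "is_perm b" "b \<in> C" "tau a = x" "tau b = y"
    using AlD aA xy(3) by blast+
  have t: "pm False \<in> C" "x \<in> T" "y \<in> T" "opr (pm False) [x, y] = t" using xy(1) by (auto simp: pairs_def)
  have inf: "inflatable (pm False) [a, b]" by (rule inflatable_pm_Al[OF aA xy(3)])
  note pi = pinv_inflate_pm[OF inf]
  have inf': "inflatable (pm False) [pinv b, pinv a]"
    using inf by (simp add: inflatable_pm is_perm_pinv)
  have eq: "inflate (pm False) [pinv b, pinv a] = p" using p InvD pi(1) xy(4) by auto
  consider "length b < length a" | "length b = length a" | "length a < length b" by linarith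
  then show "p \<in> (\<Union>x\<in>outer t. mirrored ` Ind False x) \<union>
    (\<Union>(x, y)\<in>outer_inner t. sandwich ` tuples [(2, Ind False x), (Suc 0, Inv y)])"
  proof cases
    case 1
    have "cut False p (length b)" using inflate_pm_cut(1)[OF inf'] eq by simp
    then have "dec False a" using cut_left_part[OF inf] 1 xy(4) unfolding dec_def by blast
    then show ?thesis using xy(2) by (simp add: Ind_def)
  next
    case 2
    then have "length a = length (pinv b)" by simp
    then have "a = pinv b" using inflate_pm_inject_length[OF inf inf' trans[OF xy(4)[symmetric] eq[symmetric]]] by blast
    then have b: "b = pinv a" using pinv_pinv[OF perms(2)] by simp
    then have "y = iv x" using tau_pinv[OF perms(1)] perms by simp
    then have "x \<in> outer t" using xy(1) by (simp add: outer_def)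
    then show ?thesis using xy(2,4) b by (auto simp: mirrored_def)
  next
    case 3
    \<comment> \<open>The cut of \<open>p\<close> in front of its last \<open>length a\<close>
      entries, read as a cut of \<open>b\<close>.\<close>
    define k where "k = length b - length a"
    define c where "c = std (take k b)"
    define d where "d = std (drop k b)"
    have "cut False p (length b)" using inflate_pm_cut(1)[OF inf'] eq by simp
    then have cb: "cut False b k" using cut_right_part[OF inf 3] xy(4) by (simp add: k_def)
    note ci = cut_inflate[OF perms(2) cb, folded c_def d_def]
    have len: "length d = length a" using 3 by (simp add: d_def k_def)
    have pcd: "pinv b = inflate (pm False) [pinv d, pinv c]"
      using pinv_inflate_pm(1)[OF ci(2)] ci(1) by simp
    have cd: "is_perm c" "is_perm d" "c \<noteq> []" "d \<noteq> []" "c \<in> C" "d \<in> C"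
      using ci(2) C_inflate[OF ci(2)] ci(1) perms(3) by (auto simp: inflatable_pm)
    have inf_ca: "inflatable (pm False) [pinv c, pinv a]"
      using cd inf by (simp add: inflatable_pm is_perm_pinv)
    have inf_d: "inflatable (pm False) [pinv d, inflate (pm False) [pinv c, pinv a]]"
    proof -
      have "pm False \<noteq> []" by (simp add: pm_def)
      then show ?thesis
        using cd blocks_inflate(2)[OF inf_ca] inflate_nonempty[OF inf_ca]
        by (simp add: inflatable_pm is_perm_pinv)
    qed
    \<comment> \<open>Grouped so that \<open>a\<close> meets \<open>pinv d\<close>, and then
      \<open>c\<close> meets \<open>pinv c\<close>, in equal lengths; each comparison is decided by
      length alone.\<close>
    have "p = inflate (pm False) [pinv d, inflate (pm False) [pinv c, pinv a]]"
      using eq pcd by (simp add: inflate_pm_assoc)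
    then have ad: "a = pinv d" "inflate (pm False) [c, d] = inflate (pm False) [pinv c, pinv a]"
      using inflate_pm_inject_length[OF inf inf_d] xy(4) len ci(1) by auto
    have cc: "pinv c = c" "d = pinv a" using inflate_pm_inject_length[OF ci(2) inf_ca ad(2)] by auto
    have cI: "c \<in> Inv (tau c)" using cd cc by (simp add: Inv_def Al_def)
    have "y = opr (pm False) [tau c, iv x]"
      using tau_inflate[OF ci(2)] ci(1) perms cc(2) tau_pinv[OF perms(1)] by simp
    then have "(x, tau c) \<in> outer_inner t" using t tau_T by (simp add: outer_inner_def)
    moreover have "p = sandwich [a, c]" using xy(4) ci(1) cc(2) by (simp add: sandwich_def)
    ultimately show ?thesis using xy(2) cI
      by (intro UnI2 UN_I[of "(x, tau c)"]) (auto simp: tuples_pair)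
  qed
next
  fix p assume "p \<in> (\<Union>x\<in>outer t. mirrored ` Ind False x) \<union>
    (\<Union>(x, y)\<in>outer_inner t. sandwich ` tuples [(2, Ind False x), (Suc 0, Inv y)])"
  then show "p \<in> Dec False t \<inter> Inv t"
  proof
    assume "p \<in> (\<Union>x\<in>outer t. mirrored ` Ind False x)"
    then obtain x a where xa: "(x, iv x) \<in> pairs False t" "a \<in> Ind False x"
      "p = inflate (pm False) [a, pinv a]"
      by (auto simp: outer_def mirrored_def)
    then have aA: "a \<in> Al x" by (simp add: Ind_def)
    have "p \<in> Dec False t"
      unfolding Dec_eq using xa pinv_Al[OF aA] by (intro UN_I[of "(x, iv x)"]) (auto simp: tuples_pair)
    moreover have "pinv p = p"
      using pinv_inflate_pm(1)[OF inflatable_pm_Al[OF aA pinv_Al[OF aA]], of False] xa(3)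
        pinv_pinv AlD[OF aA] by simp
    ultimately show ?thesis by (auto simp: Inv_def Dec_def)
  next
    assume "p \<in> (\<Union>(x, y)\<in>outer_inner t. sandwich ` tuples [(2, Ind False x), (Suc 0, Inv y)])"
    then obtain x y a c where xy: "(x, y) \<in> outer_inner t" "a \<in> Ind False x" "c \<in> Inv y"
      "p = inflate (pm False) [a, inflate (pm False) [c, pinv a]]"
      by (auto simp: tuples_pair sandwich_def)
    then have pmC: "pm False \<in> C" and t: "opr (pm False) [x, opr (pm False) [y, iv x]] = t"
      by (auto simp: outer_inner_def)
    note s = sandwich_parts[OF pmC xy(2,3)]
    have aA: "a \<in> Al x" using xy(2) by (simp add: Ind_def)
    have "p \<in> Al t"
      using inflate_pm_Al_iff[OF s(2), of t] pmC aA s(1) AlD[OF aA] AlD[OF s(1)] t xy(4) by simp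
    then have "p \<in> Dec False t" using dec_inflate_pm[OF s(2)] xy(4) by (simp add: Dec_def)
    moreover have "pinv (inflate (pm False) [c, pinv a]) = inflate (pm False) [a, c]"
      using pinv_inflate_pm(1)[OF s(3)] pinv_pinv AlD[OF aA] InvD[OF xy(3)] by simp
    then have "pinv p = p"
      using pinv_inflate_pm(1)[OF s(2)] xy(4) by (simp add: inflate_pm_assoc)
    ultimately show ?thesis by (auto simp: Inv_def Dec_def)
  qed
qed

lemma rhs_Dec_False_Inv: "gf (Suc 0) (Dec False t \<inter> Inv t) \<in> rhs V"
proof -
  let ?A = "\<Union>x\<in>outer t. mirrored ` Ind False x"
  let ?F = "\<lambda>(x, y). sandwich ` tuples [(2, Ind False x), (Suc 0, Inv y)]"
  let ?B = "\<Union>z\<in>outer_inner t. ?F z"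
  have eq: "Dec False t \<inter> Inv t = ?A \<union> ?B" by (rule Dec_False_Inv_eq)
  have sub: "?A \<union> ?B \<subseteq> C" unfolding eq[symmetric] using pieces_subset by blast
  have "gf (Suc 0) ?A \<in> rhs V"
  proof (rule rhs_UN[OF finite_outer(1)])
    fix x
    \<comment> \<open>\<open>mirrored\<close> doubles the length, which turns x into
      \<open>x^2\<close>; the series of \<open>Ind False x\<close> then enters through its own
      contractive right-hand side.\<close>
    have "gf (Suc 0) (mirrored ` Ind False x) = gf 2 (Ind False x)"
    proof (rule gf_image)
      show "inj_on mirrored (Ind False x)" by (rule inj_onI) (use mirrored_inject in blast)
      show "Suc 0 * length (mirrored a) = 2 * length a" if "a \<in> Ind False x" for a
        by (simp add: mirrored_def inflate_pm)
    qed
    then show "gf (Suc 0) (mirrored ` Ind False x) \<in> rhs V" using rhs_Ind by simp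
  next
    show "p \<in> C" if "x \<in> outer t" "p \<in> mirrored ` Ind False x" for x p using that sub by blast
    show "mirrored ` Ind False x \<inter> mirrored ` Ind False y = {}" if "x \<noteq> y" for x y
      using that mirrored_inject by blast
  qed simp
  moreover have "gf (Suc 0) ?B \<in> rhs V"
  proof (rule rhs_UN[OF finite_outer(2)])
    fix z assume z: "z \<in> outer_inner t"
    obtain x y where xy: "z = (x, y)" by (cases z)
    have C: "pm False \<in> C" using z by (auto simp: outer_inner_def)
    have "gf (Suc 0) (sandwich ` tuples [(2, Ind False x), (Suc 0, Inv y)]) \<in> rhs V"
    proof (rule rhs_image_tuples)
      show "set [(2, Ind False x), (Suc 0, Inv y)] \<subseteq> V" using z xy by (auto simp: outer_inner_def V_I)
      show "inj_on sandwich (tuples [(2, Ind False x), (Suc 0, Inv y)])"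
        by (rule inj_onI) (use sandwich_inject[OF C] in \<open>fastforce simp: tuples_pair\<close>)
      show "Suc 0 * length (sandwich as) = weight [(2, Ind False x), (Suc 0, Inv y)] as"
        if "as \<in> tuples [(2, Ind False x), (Suc 0, Inv y)]" for as
        using that by (auto simp: tuples_pair weight_pair inflate_pm sandwich_def)
    qed simp
    then show "gf (Suc 0) (?F z) \<in> rhs V" using xy by simp
  next
    show "p \<in> C" if "z \<in> outer_inner t" "p \<in> ?F z" for z p using that sub by blast
    fix z w assume zw: "z \<in> outer_inner t" "w \<in> outer_inner t" "z \<noteq> w"
    have C: "pm False \<in> C" using zw by (auto simp: outer_inner_def)
    show "?F z \<inter> ?F w = {}"
      using zw(3) sandwich_inject[OF C] by (cases z, cases w) (fastforce simp: tuples_pair)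
  qed simp
  moreover have "?A \<inter> ?B = {}"
    using mirrored_neq_sandwich by (fastforce simp: outer_inner_def tuples_pair)
  ultimately show ?thesis unfolding eq using sub by (intro rhs_Un) auto
qed

text \<open>A block decomposition of an involution is determined by the blocks at the smaller element of
  each cycle of \<open>sigma\<close>.\<close>

definition reps :: "nat list \<Rightarrow> nat list" where
  "reps sigma = filter (\<lambda>i. i \<le> sigma ! i) [0..<length sigma]"

definition islots :: "nat list \<Rightarrow> 't list \<Rightarrow> (nat \<times> nat list set) list" where
  "islots sigma ts = map (\<lambda>i. if sigma ! i = i then (Suc 0, Inv (ts ! i)) else (2, Al (ts ! i))) (reps sigma)"

text \<open>Blocks at the larger element of a 2-cycle are filled in as inverses. For an involution
  \<open>sigma\<close> the lookup only happens at smaller elements or fixed points, where it is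
  defined when \<open>xs\<close> has the length of \<open>reps sigma\<close>.\<close>

definition symmetrize :: "nat list \<Rightarrow> nat list list \<Rightarrow> nat list list" where
  "symmetrize sigma xs = (let g = \<lambda>i. the (map_of (zip (reps sigma) xs) i) in
    map (\<lambda>i. if i \<le> sigma ! i then g i else pinv (g (sigma ! i))) [0..<length sigma])"

definition iframes :: "'t \<Rightarrow> (nat list \<times> 't list) set" where
  "iframes t = {(sigma, ts) \<in> frames t. pinv sigma = sigma \<and>
    (\<forall>i<length sigma. ts ! (sigma ! i) = iv (ts ! i))}"

lemma reps_iff: "i \<in> set (reps sigma) \<longleftrightarrow> i < length sigma \<and> i \<le> sigma ! i"
  by (auto simp: reps_def)

lemma distinct_reps: "distinct (reps sigma)"
  by (simp add: reps_def)

lemma iframesD: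
  assumes "(sigma, ts) \<in> iframes t"
  shows "(sigma, ts) \<in> frames t" "is_perm sigma" "length ts = length sigma" "set ts \<subseteq> T"
    "3 \<le> length sigma" "sigma \<in> C"
    "\<And>i. i < length sigma \<Longrightarrow> sigma ! i < length sigma"
    "\<And>i. i < length sigma \<Longrightarrow> sigma ! (sigma ! i) = i"
    "\<And>i. i < length sigma \<Longrightarrow> ts ! (sigma ! i) = iv (ts ! i)"
proof -
  have f: "(sigma, ts) \<in> frames t" "pinv sigma = sigma" using assms by (auto simp: iframes_def)
  then show "(sigma, ts) \<in> frames t" "length ts = length sigma" "set ts \<subseteq> T"
    "3 \<le> length sigma" and C: "sigma \<in> C"
    by (auto simp: frames_def)
  show p: "is_perm sigma" by (rule C_perm[OF C])
  show "sigma ! i < length sigma" "sigma ! (sigma ! i) = i" if "i < length sigma" for i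
    using perm_nth_less[OF p that] pinv_nth[OF p that] f(2) by auto
  show "ts ! (sigma ! i) = iv (ts ! i)" if "i < length sigma" for i
    using assms that by (auto simp: iframes_def)
qed

lemma symmetrize_map:
  assumes "(sigma, ts) \<in> iframes t"
  shows "symmetrize sigma (map g (reps sigma)) =
    map (\<lambda>i. if i \<le> sigma ! i then g i else pinv (g (sigma ! i))) [0..<length sigma]"
proof -
  note f = iframesD[OF assms]
  have "the (map_of (zip (reps sigma) (map g (reps sigma))) i) = g i" if "i \<in> set (reps sigma)" for i
    using that by (simp add: map_of_zip_map)
  then show ?thesis
    using f(7,8) by (auto simp: symmetrize_def Let_def reps_iff)
qed

text \<open>The second claim makes the inflation an involution, the third makes the construction
  injective, and the fourth says that weight 2 in a slot pays for a block and its inverse.\<close>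

lemma symmetrize_props:
  assumes st: "(sigma, ts) \<in> iframes t" and xs: "xs \<in> tuples (islots sigma ts)"
  defines "as \<equiv> symmetrize sigma xs"
  shows "as \<in> tuples (slots ts)"
    and "\<And>v. v < length sigma \<Longrightarrow> as ! v = pinv (as ! (sigma ! v))"
    and "xs = map ((!) as) (reps sigma)"
    and "(\<Sum>i<length sigma. length (as ! i)) = weight (islots sigma ts) xs"
proof -
  note f = iframesD[OF st]
  let ?m = "length sigma"
  define g where "g i = the (map_of (zip (reps sigma) xs) i)" for i
  have lx: "length xs = length (reps sigma)" using xs by (simp add: tuples_iff islots_def)
  have xg: "xs = map g (reps sigma)"
    by (rule nth_equalityI) (use lx distinct_reps in \<open>auto simp: g_def map_of_zip_nth\<close>)
  have as: "as = map (\<lambda>i. if i \<le> sigma ! i then g i else pinv (g (sigma ! i))) [0..<?m]"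
    unfolding as_def by (subst xg) (rule symmetrize_map[OF st])
  have gm: "g i \<in> (if sigma ! i = i then Inv (ts ! i) else Al (ts ! i))" if i: "i \<in> set (reps sigma)" for i
  proof -
    obtain k where k: "k < length (reps sigma)" "reps sigma ! k = i" using i by (metis in_set_conv_nth)
    have "k < length (islots sigma ts)" using k by (simp add: islots_def)
    then have "xs ! k \<in> snd (islots sigma ts ! k)" using xs by (simp only: tuples_iff)
    then show ?thesis using k xg by (simp add: islots_def split: if_splits)
  qed
  have gA: "g i \<in> Al (ts ! i)" if "i \<in> set (reps sigma)" for i
    using gm[OF that] by (auto simp: Inv_def split: if_splits)
  show "as \<in> tuples (slots ts)"
    unfolding tuples_slots
  proof (intro conjI allI impI)
    show "length as = length ts" by (simp add: as f)
    fix i assume "i < length ts"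
    then have i: "i < ?m" using f(3) by simp
    show "as ! i \<in> Al (ts ! i)"
    proof (cases "i \<le> sigma ! i")
      case True
      then show ?thesis using gA[of i] i by (simp add: as reps_iff)
    next
      case False
      have "g (sigma ! i) \<in> Al (ts ! (sigma ! i))" using gA f(7,8)[OF i] False by (simp add: reps_iff)
      then have "pinv (g (sigma ! i)) \<in> Al (ts ! i)"
        using pinv_Al f(9)[OF f(7)[OF i]] f(8)[OF i] by fastforce
      then show ?thesis using False i by (simp add: as)
    qed
  qed
  show sym: "as ! v = pinv (as ! (sigma ! v))" if v: "v < ?m" for v
  proof -
    have pp: "pinv (pinv (g i)) = g i" if "i \<in> set (reps sigma)" for i
      using gA[OF that] AlD pinv_pinv by blast
    consider "v < sigma ! v" | "v = sigma ! v" | "sigma ! v < v" by linarith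
    then show ?thesis
    proof cases
      case 1
      then show ?thesis using pp[of v] v f(7,8)[OF v] by (simp add: as reps_iff)
    next
      case 2
      then have "g v \<in> Inv (ts ! v)" using gm[of v] v by (simp add: reps_iff)
      then have "pinv (g v) = g v" using InvD by blast
      then show ?thesis using 2 v by (simp add: as)
    next
      case 3
      then show ?thesis using v f(7,8)[OF v] by (simp add: as)
    qed
  qed
  show "xs = map ((!) as) (reps sigma)"
    unfolding xg by (rule map_cong) (auto simp: as reps_iff)
  let ?R = "set (reps sigma)"
  have "weight (islots sigma ts) xs =
    (\<Sum>k<length (reps sigma). (\<lambda>i. (if sigma ! i = i then 1 else 2) * length (g i)) (reps sigma ! k))"
    unfolding weight_def by (rule sum.cong) (auto simp: islots_def xg)
  also have "\<dots> = (\<Sum>i\<in>?R. (if sigma ! i = i then 1 else 2) * length (g i))"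
    by (rule sum.reindex_bij_betw) (rule bij_betw_nth, use distinct_reps in auto)
  \<comment> \<open>Weight 2 is split into the block at \<open>i\<close> and a second copy for its
    partner.\<close>
  also have "\<dots> = (\<Sum>i\<in>?R. length (as ! i) + (if i < sigma ! i then length (as ! i) else 0))"
    by (rule sum.cong) (auto simp: as reps_iff)
  also have "\<dots> = (\<Sum>i\<in>?R. length (as ! i)) + (\<Sum>i\<in>{i \<in> ?R. i < sigma ! i}. length (as ! i))"
    by (simp add: sum.distrib sum.inter_filter)
  \<comment> \<open>The involution \<open>sigma\<close> pairs the smaller elements of 2-cycles with
    the larger ones, which are exactly the indices without a representative; inverse blocks have
    equal length.\<close>
  also have "(\<Sum>i\<in>{i \<in> ?R. i < sigma ! i}. length (as ! i)) = (\<Sum>i\<in>{..<?m} - ?R. length (as ! i))"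
  proof (rule sum.reindex_bij_witness[of _ "\<lambda>i. sigma ! i" "\<lambda>i. sigma ! i"])
    show "length (as ! (sigma ! i)) = length (as ! i)" if "i \<in> {i \<in> ?R. i < sigma ! i}" for i
      using sym[of i] that by (simp add: reps_iff)
  qed (use f(7,8) in \<open>auto simp: reps_iff\<close>)
  also have "(\<Sum>i\<in>?R. length (as ! i)) + (\<Sum>i\<in>{..<?m} - ?R. length (as ! i)) = (\<Sum>i<?m. length (as ! i))"
    by (subst add.commute, rule sum.subset_diff[symmetric]) (auto simp: reps_iff)
  finally show "(\<Sum>i<?m. length (as ! i)) = weight (islots sigma ts) xs" by simp
qed

lemma symmetrize_surj:
  assumes st: "(sigma, ts) \<in> iframes t" and as: "as \<in> tuples (slots ts)"
    and sym: "\<And>v. v < length sigma \<Longrightarrow> as ! v = pinv (as ! (sigma ! v))"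
  shows "\<exists>xs\<in>tuples (islots sigma ts). symmetrize sigma xs = as"
proof (rule bexI)
  note f = iframesD[OF st]
  have la: "length as = length sigma" "\<And>i. i < length sigma \<Longrightarrow> as ! i \<in> Al (ts ! i)"
    using as f(3) by (auto simp: tuples_slots)
  show "symmetrize sigma (map ((!) as) (reps sigma)) = as"
    unfolding symmetrize_map[OF st]
    by (rule nth_equalityI) (use la(1) in \<open>auto simp flip: sym\<close>)
  show "map ((!) as) (reps sigma) \<in> tuples (islots sigma ts)"
    unfolding tuples_iff
  proof (intro conjI allI impI)
    fix k assume k: "k < length (islots sigma ts)"
    let ?i = "reps sigma ! k"
    have k': "k < length (reps sigma)" using k by (simp add: islots_def)
    then have i: "?i < length sigma" using nth_mem reps_iff by metis
    have "as ! ?i \<in> Inv (ts ! ?i)" if fixed: "sigma ! ?i = ?i"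
      using la(2)[OF i] sym[OF i, unfolded fixed, symmetric] by (simp add: Inv_def)
    then show "map ((!) as) (reps sigma) ! k \<in> snd (islots sigma ts ! k)"
      using la(2)[OF i] k' by (simp add: islots_def)
  qed (simp add: islots_def)
qed

text \<open>By \<open>pinv_inflate\<close> the inverse is again an inflation of a simple
  permutation, namely \<open>pinv sigma\<close>. Uniqueness then turns \<open>pinv p = p\<close>
  into equality of the quotients and of the blocks.\<close>

lemma Sim_Inv_eq:
  "Sim t \<inter> Inv t =
    (\<Union>(sigma, ts)\<in>iframes t. (\<lambda>xs. inflate sigma (symmetrize sigma xs)) ` tuples (islots sigma ts))"
proof (intro equalityI subsetI)
  fix p assume p: "p \<in> Sim t \<inter> Inv t"
  then obtain sigma ts as where sa: "(sigma, ts) \<in> frames t" "as \<in> tuples (slots ts)" "p = inflate sigma as"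
    unfolding Sim_eq by blast
  then have f: "sigma \<in> C" "simple sigma" "3 \<le> length sigma" "length ts = length sigma" "set ts \<subseteq> T"
    by (auto simp: frames_def)
  note d = tuples_slots_D[OF f(1,4) sa(2)] and pi = pinv_inflate[OF tuples_slots_D(1)[OF f(1,4) sa(2)]]
  have sg: "is_perm sigma" by (rule C_perm[OF f(1)])
  have as: "length as = length sigma" "\<And>i. i < length sigma \<Longrightarrow> as ! i \<in> Al (ts ! i)"
    using sa(2) f(4) by (auto simp: tuples_slots)
  have "pinv p = p" using p InvD by blast
  then have "inflate (pinv sigma) (map (\<lambda>v. pinv (as ! (pinv sigma ! v))) [0..<length sigma]) =
    inflate sigma as" using pi(1) sa(3) by simp
  moreover have "3 \<le> length (pinv sigma)" using f(3) by simp
  ultimately have "pinv sigma = sigma \<and> map (\<lambda>v. pinv (as ! (pinv sigma ! v))) [0..<length sigma] = as"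
    using inflate_simple_inject[OF pi(2) simple_pinv[OF sg f(2)] _ d(1) f(2,3)] by blast
  then have ps: "pinv sigma = sigma" and eq: "map (\<lambda>v. pinv (as ! (sigma ! v))) [0..<length sigma] = as"
    by auto
  have sym: "as ! v = pinv (as ! (sigma ! v))" if v: "v < length sigma" for v
    using arg_cong[OF eq, of "\<lambda>l. l ! v"] v by simp
  have ss: "sigma ! i < length sigma" "sigma ! (sigma ! i) = i" if "i < length sigma" for i
    using perm_nth_less[OF sg that] pinv_nth[OF sg that] ps by auto
  have "ts ! (sigma ! i) = iv (ts ! i)" if i: "i < length sigma" for i
  proof -
    have "as ! (sigma ! i) = pinv (as ! i)" using sym[OF ss(1)[OF i]] ss(2)[OF i] by simp
    moreover have "as ! (sigma ! i) \<in> Al (ts ! (sigma ! i))" "pinv (as ! i) \<in> Al (iv (ts ! i))"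
      using as(2) ss(1)[OF i] i pinv_Al by auto
    ultimately show ?thesis using AlD by metis
  qed
  then have st: "(sigma, ts) \<in> iframes t" using sa(1) ps by (simp add: iframes_def)
  obtain xs where "xs \<in> tuples (islots sigma ts)" "symmetrize sigma xs = as"
    using symmetrize_surj[OF st sa(2) sym] by blast
  then show "p \<in> (\<Union>(sigma, ts)\<in>iframes t.
      (\<lambda>xs. inflate sigma (symmetrize sigma xs)) ` tuples (islots sigma ts))"
    using st sa(3) by blast
next
  fix p assume "p \<in> (\<Union>(sigma, ts)\<in>iframes t.
      (\<lambda>xs. inflate sigma (symmetrize sigma xs)) ` tuples (islots sigma ts))"
  then obtain sigma ts xs where st: "(sigma, ts) \<in> iframes t" and xs: "xs \<in> tuples (islots sigma ts)"
    and p: "p = inflate sigma (symmetrize sigma xs)" by blast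
  note f = iframesD[OF st] and s = symmetrize_props[OF st xs]
  let ?as = "symmetrize sigma xs"
  have S: "p \<in> Sim t" unfolding Sim_eq using f(1) s(1) p by blast
  have ps: "pinv sigma = sigma" using st by (auto simp: iframes_def)
  have "length ?as = length sigma" using s(1) f(3) by (simp add: tuples_slots)
  then have "map (\<lambda>v. pinv (?as ! (sigma ! v))) [0..<length sigma] = ?as"
    by (intro nth_equalityI) (use s(2) in auto)
  then have "pinv p = p"
    using pinv_inflate(1)[OF tuples_slots_D(1)[OF f(6,3) s(1)]] ps p by simp
  then show "p \<in> Sim t \<inter> Inv t" using S by (auto simp: Inv_def Sim_def)
qed

lemma symmetrize_inject:
  assumes "(sigma, ts) \<in> iframes t" "xs \<in> tuples (islots sigma ts)"
    and "(sigma', ts') \<in> iframes t" "xs' \<in> tuples (islots sigma' ts')"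
    and "inflate sigma (symmetrize sigma xs) = inflate sigma' (symmetrize sigma' xs')"
  shows "sigma = sigma' \<and> ts = ts' \<and> xs = xs'"
proof -
  note s = symmetrize_props[OF assms(1,2)] and s' = symmetrize_props[OF assms(3,4)]
  have "sigma = sigma' \<and> ts = ts' \<and> symmetrize sigma xs = symmetrize sigma' xs'"
    by (rule frames_inject[OF iframesD(1)[OF assms(1)] iframesD(1)[OF assms(3)] s(1) s'(1) assms(5)])
  then show ?thesis using s(3) s'(3) by metis
qed

text \<open>Each cycle has at most two elements and \<open>sigma\<close> at least three, so two
  slots remain; this makes the product of their series a contractive term.\<close>

lemma length_reps:
  assumes "(sigma, ts) \<in> iframes t"
  shows "2 \<le> length (reps sigma)"
proof -
  note f = iframesD[OF assms]
  have "{0..<length sigma} \<subseteq> set (reps sigma) \<union> (!) sigma ` set (reps sigma)"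
  proof
    fix i assume "i \<in> {0..<length sigma}"
    then have i: "i < length sigma" by simp
    show "i \<in> set (reps sigma) \<union> (!) sigma ` set (reps sigma)"
    proof (cases "i \<le> sigma ! i")
      case False
      then have "sigma ! i \<in> set (reps sigma)" using f(7,8)[OF i] by (simp add: reps_iff)
      moreover have "i = sigma ! (sigma ! i)" using f(8)[OF i] by simp
      ultimately show ?thesis by blast
    qed (use i in \<open>simp add: reps_iff\<close>)
  qed
  then have "length sigma \<le> card (set (reps sigma) \<union> (!) sigma ` set (reps sigma))"
    using card_mono[of "set (reps sigma) \<union> (!) sigma ` set (reps sigma)" "{0..<length sigma}"] by simp
  also have "\<dots> \<le> card (set (reps sigma)) + card ((!) sigma ` set (reps sigma))"
    by (rule card_Un_le)
  also have "\<dots> \<le> length (reps sigma) + length (reps sigma)"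
    using card_image_le[of "set (reps sigma)" "(!) sigma"] card_length[of "reps sigma"]
    by (intro add_mono) auto
  finally show ?thesis using f(5) by simp
qed

lemma rhs_Sim_Inv: "gf (Suc 0) (Sim t \<inter> Inv t) \<in> rhs V"
proof -
  let ?F = "\<lambda>(sigma, ts). (\<lambda>xs. inflate sigma (symmetrize sigma xs)) ` tuples (islots sigma ts)"
  have eq: "Sim t \<inter> Inv t = (\<Union>z\<in>iframes t. ?F z)" by (rule Sim_Inv_eq)
  have "gf (Suc 0) (\<Union>z\<in>iframes t. ?F z) \<in> rhs V"
  proof (rule rhs_UN)
    show "finite (iframes t)" by (rule finite_subset[OF _ finite_frames]) (auto simp: iframes_def)
    fix z assume z: "z \<in> iframes t"
    obtain sigma ts where st: "z = (sigma, ts)" by (cases z)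
    have i: "(sigma, ts) \<in> iframes t" using z st by simp
    note f = iframesD[OF i]
    have "gf (Suc 0) ((\<lambda>xs. inflate sigma (symmetrize sigma xs)) ` tuples (islots sigma ts)) \<in> rhs V"
    proof (rule rhs_image_tuples)
      have "ts ! j \<in> T" if "j \<in> set (reps sigma)" for j
        using that f(3,4) by (auto simp: reps_iff)
      then show "set (islots sigma ts) \<subseteq> V" by (auto simp: islots_def V_I)
      show "2 \<le> length (islots sigma ts)" using length_reps[OF i] by (simp add: islots_def)
      show "inj_on (\<lambda>xs. inflate sigma (symmetrize sigma xs)) (tuples (islots sigma ts))"
        by (rule inj_onI) (use symmetrize_inject[OF i _ i] in blast)
      show "Suc 0 * length (inflate sigma (symmetrize sigma xs)) = weight (islots sigma ts) xs"
        if xs: "xs \<in> tuples (islots sigma ts)" for xs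
      proof -
        note s = symmetrize_props[OF i xs]
        have "length (symmetrize sigma xs) = length sigma" using s(1) f(3) by (simp add: tuples_slots)
        then show ?thesis using s(4) by (simp add: length_inflate_sum)
      qed
    qed
    then show "gf (Suc 0) (?F z) \<in> rhs V" using st by simp
  next
    fix z p assume "z \<in> iframes t" "p \<in> ?F z"
    then have "p \<in> Sim t \<inter> Inv t" unfolding eq by blast
    then show "p \<in> C" using pieces_subset by blast
  next
    fix z w assume zw: "z \<in> iframes t" "w \<in> iframes t" "z \<noteq> w"
    obtain sigma ts sigma' ts' where "z = (sigma, ts)" "w = (sigma', ts')" by (cases z, cases w)
    then show "?F z \<inter> ?F w = {}" using zw symmetrize_inject[of sigma ts t _ sigma' ts'] by auto
  qed simp
  then show ?thesis by (simp only: eq)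
qed

section \<open>The complete system\<close>

lemma InvInd_eq: "InvInd t = Inv t \<inter> {[0]} \<union> (Dec False t \<inter> Inv t) \<union> (Sim t \<inter> Inv t)"
proof -
  have "InvInd t = Ind True t \<inter> Inv t" by (auto simp: InvInd_def Ind_def Inv_def)
  moreover have "Inv t \<subseteq> Al t" by (auto simp: Inv_def)
  ultimately show ?thesis using Ind_eq[of True t] by auto
qed

lemma rhs_InvInd: "gf (Suc 0) (InvInd t) \<in> rhs V"
  unfolding InvInd_eq
proof (rule rhs_Un3)
  have "Inv t \<subseteq> Al t" by (auto simp: Inv_def)
  then show "Inv t \<inter> {[0]} \<union> Dec False t \<inter> Inv t \<union> Sim t \<inter> Inv t \<subseteq> C"
    "Inv t \<inter> {[0]} \<inter> (Dec False t \<inter> Inv t) = {}" "Inv t \<inter> {[0]} \<inter> (Sim t \<inter> Inv t) = {}"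
    using pieces_subset pieces_disjoint(1)[of t False] pieces_disjoint(4)[of t] by blast+
  show "Dec False t \<inter> Inv t \<inter> (Sim t \<inter> Inv t) = {}" using pieces_disjoint(3)[of t False] by blast
qed (rule rhs_one rhs_Dec_False_Inv rhs_Sim_Inv zero_less_Suc)+

lemma rhs_Inv: "gf (Suc 0) (Inv t) \<in> rhs V"
proof -
  have "Inv t = InvInd t \<union> (Dec True t \<inter> Inv t)" "InvInd t \<inter> (Dec True t \<inter> Inv t) = {}"
    by (auto simp: InvInd_def Inv_def Dec_def)
  moreover have "Inv t \<subseteq> C" by (auto simp: Inv_def Al_def)
  ultimately show ?thesis
    using rhs_Un[OF _ rhs_InvInd rhs_Dec_True_Inv, of t] by (metis le_sup_iff zero_less_Suc)
qed

lemma gfp_rhs: "v \<in> V \<Longrightarrow> gfp v \<in> rhs V"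
  by (subst (asm) V_def) (use rhs_Al rhs_Ind rhs_Inv rhs_InvInd in auto)

text \<open>\<open>E\<close> accounts for the empty permutation, which belongs to no
  \<open>Inv t\<close> and contributes only a constant.\<close>

theorem algebraic_involutions:
  assumes "T' \<subseteq> T" "E \<subseteq> {[]}"
  shows "algebraic_fps (gf 1 (E \<union> (\<Union>t\<in>T'. Inv t)))"
proof -
  have "\<forall>v\<in>V. \<exists>ts. over V ts \<and> contractive ts \<and> gfp v = peval gfp ts"
    using gfp_rhs unfolding rhs_def by blast
  from bchoice[OF this] obtain p
    where "\<forall>v\<in>V. over V (p v) \<and> contractive (p v) \<and> gfp v = peval gfp (p v)" by blast
  then have p: "over V (p v)" "contractive (p v)" "gfp v = peval gfp (p v)" if "v \<in> V" for v
    using that by blast+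
  have finT: "finite T'" using assms(1) finite_T finite_subset by blast
  then obtain l where l: "set l = T'" "distinct l" using finite_distinct_list by blast
  have perm: "is_perm q" if "q \<in> Inv t" for q t using that AlD InvD by blast
  have E: "is_perm q" if "q \<in> E" for q using that assms(2) by (auto simp: is_perm_def)
  define e where "e = (rat_of_nat (card E))"
  \<comment> \<open>The wanted series as a polynomial in the solution: a constant plus a sum of
    unknowns. It is only evaluated, so it may contain terms that are not contractive.\<close>
  define q where "q = ([:e:], []) # map (\<lambda>t. (1, [(Suc 0, Inv t)])) l"
  have "gf 1 (E \<union> (\<Union>t\<in>T'. Inv t)) = gf 1 E + gf 1 (\<Union>t\<in>T'. Inv t)"
    by (rule gf_Un) (use perm E assms(2) InvD AlD in \<open>auto dest!: InvD AlD\<close>)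
  also have "gf 1 (\<Union>t\<in>T'. Inv t) = (\<Sum>t\<in>T'. gf 1 (Inv t))"
    by (rule gf_UN[OF finT]) (use perm InvD AlD in \<open>auto dest!: InvD AlD\<close>)
  also have "gf 1 E = fps_of_poly [:e:]"
  proof (rule fps_ext)
    fix n
    have "{x \<in> E. 1 * length x = n} = (if n = 0 then E else {})" using assms(2) by auto
    then show "gf 1 E $ n = fps_of_poly [:e:] $ n"
      by (simp add: gf_nth e_def coeff_pCons split: nat.split)
  qed
  also have "fps_of_poly [:e:] + (\<Sum>t\<in>T'. gf 1 (Inv t)) = peval gfp q"
    using sum_list_distinct_conv_sum_set[OF l(2), of "\<lambda>t. gf 1 (Inv t)"] l(1)
    by (simp add: q_def peval_def comp_def)
  finally have eq: "gf 1 (E \<union> (\<Union>t\<in>T'. Inv t)) = peval gfp q" .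
  have "over V q" using assms(1) l(1) V_I(3) by (auto simp: q_def over_def)
  then show ?thesis
    unfolding eq using system_algebraic[OF finite_V p(1,2) p(3) gf_V_0] by blast
qed

end

section \<open>Types from query answers\<close>

lemma class_inflate_iff:
  assumes "perm_class C" "wreath_closed C" "inflatable sigma as"
  shows "inflate sigma as \<in> C \<longleftrightarrow> sigma \<in> C \<and> set as \<subseteq> C"
proof
  assume "sigma \<in> C \<and> set as \<subseteq> C"
  then show "inflate sigma as \<in> C"
    using assms(2,3) unfolding wreath_closed_def inflatable_def by (metis subsetD)
qed (use class_inflate[OF assms(1,3)] in blast)

lemma query_completeD:
  assumes "query_complete PP" "inflatable sigma as" "inflatable sigma bs" "P \<in> PP"
    and "\<And>i Q. i < length sigma \<Longrightarrow> Q \<in> PP \<Longrightarrow> as ! i \<in> Q \<longleftrightarrow> bs ! i \<in> Q"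
  shows "inflate sigma as \<in> P \<longleftrightarrow> inflate sigma bs \<in> P"
  using assms(1)[unfolded query_complete_def, rule_format, of sigma P as bs] assms(2-)
  unfolding inflatable_def by blast

text \<open>The second component is the first one for the inverse, so inversion swaps the
  pair.\<close>

definition types :: "nat list set set \<Rightarrow> nat list \<Rightarrow> nat list set set \<times> nat list set set" where
  "types PP p = ({Q \<in> PP. p \<in> Q}, {Q \<in> PP. pinv p \<in> Q})"

text \<open>Query-completeness is applied twice: to the inflation, and to its inverse, which is an
  inflation of \<open>pinv sigma\<close> by the inverted blocks.\<close>

lemma types_inflate_eq:
  assumes qc: "query_complete PP" and inf: "inflatable sigma as" "inflatable sigma bs"
    and eq: "map (types PP) as = map (types PP) bs"
  shows "types PP (inflate sigma as) = types PP (inflate sigma bs)"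
proof -
  have len: "length as = length sigma" "length bs = length sigma" and sg: "is_perm sigma"
    using inf by (auto simp: inflatable_def)
  have "types PP (as ! i) = types PP (bs ! i)" if "i < length sigma" for i
    using arg_cong[OF eq, of "\<lambda>l. l ! i"] that len by simp
  then have same: "as ! i \<in> Q \<longleftrightarrow> bs ! i \<in> Q" "pinv (as ! i) \<in> Q \<longleftrightarrow> pinv (bs ! i) \<in> Q"
    if "i < length sigma" "Q \<in> PP" for i Q
    using that unfolding types_def by blast+
  have "inflate sigma as \<in> P \<longleftrightarrow> inflate sigma bs \<in> P" if "P \<in> PP" for P
    by (rule query_completeD[OF qc inf that same(1)])
  moreover have "pinv (inflate sigma as) \<in> P \<longleftrightarrow> pinv (inflate sigma bs) \<in> P" if P: "P \<in> PP" for P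
    unfolding pinv_inflate(1)[OF inf(1)] pinv_inflate(1)[OF inf(2)]
    by (rule query_completeD[OF qc pinv_inflate(2)[OF inf(1)] pinv_inflate(2)[OF inf(2)] P])
      (use same(2) nth_pinv(1)[OF sg] in simp)
  ultimately show ?thesis unfolding types_def by blast
qed

text \<open>The operation on types inflates an arbitrarily chosen family of blocks with the given
  types; \<open>types_inflate_eq\<close> makes the result independent of the choice.\<close>

lemma inflation_class_symmetric_part:
  assumes C: "perm_class C" "wreath_closed C" and fin: "finite {p \<in> C. simple p}"
    and PP: "finite PP" "query_complete PP"
  shows "inflation_class {p \<in> C. pinv p \<in> C} (Pow PP \<times> Pow PP) (types PP)
    (\<lambda>sigma ts. types PP (inflate sigma (SOME as. inflatable sigma as \<and> map (types PP) as = ts)))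
    prod.swap"
proof
  have perm: "is_perm p" if "p \<in> C" for p using C(1) that unfolding perm_class_def by blast
  show "is_perm p" if "p \<in> {p \<in> C. pinv p \<in> C}" for p using perm that by blast
  show "pinv p \<in> {p \<in> C. pinv p \<in> C}" if "p \<in> {p \<in> C. pinv p \<in> C}" for p
    using that pinv_pinv perm by auto
  show "finite {p \<in> {p \<in> C. pinv p \<in> C}. simple p}" by (rule finite_subset[OF _ fin]) auto
  show "finite (Pow PP \<times> Pow PP)" using PP(1) by simp
  show "types PP p \<in> Pow PP \<times> Pow PP" for p by (auto simp: types_def)
  show "types PP (pinv p) = prod.swap (types PP p)" if "is_perm p" for p
    by (simp add: types_def pinv_pinv[OF that])
  fix sigma as assume inf: "inflatable sigma as"
  let ?cs = "map (\<lambda>v. pinv (as ! (pinv sigma ! v))) [0..<length sigma]"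
  have sg: "is_perm sigma" and len: "length as = length sigma" using inf by (auto simp: inflatable_def)
  \<comment> \<open>Indexing through the bijection \<open>pinv sigma\<close> reaches every block, so
    the conditions on the blocks of the inverse concern exactly the inverses of all blocks.\<close>
  have cs: "set ?cs = pinv ` set as"
  proof -
    have "set ?cs = (\<lambda>i. pinv (as ! i)) ` ((!) (pinv sigma) ` {0..<length sigma})"
      by (simp add: image_image)
    also have "(!) (pinv sigma) ` {0..<length sigma} = {0..<length sigma}"
      using perm_image_nth[OF is_perm_pinv[OF sg]] by simp
    also have "(\<lambda>i. pinv (as ! i)) ` {0..<length sigma} = pinv ` set as"
    proof -
      have "set as = (!) as ` {0..<length sigma}" using arg_cong[OF map_nth[of as], of set] len by simp
      then show ?thesis by (simp only: image_image)
    qed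
    finally show ?thesis .
  qed
  show "inflate sigma as \<in> {p \<in> C. pinv p \<in> C} \<longleftrightarrow>
    sigma \<in> {p \<in> C. pinv p \<in> C} \<and> set as \<subseteq> {p \<in> C. pinv p \<in> C}"
    using class_inflate_iff[OF C inf] class_inflate_iff[OF C pinv_inflate(2)[OF inf]]
      pinv_inflate(1)[OF inf] cs by auto
  define bs where "bs = (SOME bs. inflatable sigma bs \<and> map (types PP) bs = map (types PP) as)"
  have bs: "inflatable sigma bs \<and> map (types PP) bs = map (types PP) as"
    unfolding bs_def by (rule someI[of _ as]) (use inf in simp)
  show "types PP (inflate sigma as) = types PP (inflate sigma
      (SOME bs. inflatable sigma bs \<and> map (types PP) bs = map (types PP) as))"
    unfolding bs_def[symmetric]
    by (rule types_inflate_eq[OF PP(2) inf conjunct1[OF bs] conjunct2[OF bs, symmetric]])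
qed

theorem theorem5p3:
  fixes C :: "nat list set" and PP QQ :: "nat list set set"
  assumes "perm_class C" and "wreath_closed C"
    and "finite {p \<in> C. simple p}"
    and "finite PP" and "query_complete PP" and "QQ \<subseteq> PP"
  shows "algebraic_fps (Abs_fps (\<lambda>n. of_nat (card
           {p \<in> C \<inter> S n. involution p \<and> (\<forall>Q\<in>QQ. p \<in> Q)})))"
proof -
  interpret inflation_class "{p \<in> C. pinv p \<in> C}" "Pow PP \<times> Pow PP" "types PP"
    "\<lambda>sigma ts. types PP (inflate sigma (SOME as. inflatable sigma as \<and> map (types PP) as = ts))"
    prod.swap
    by (rule inflation_class_symmetric_part[OF assms(1-5)])
  have perm: "is_perm p" if "p \<in> C" for p using assms(1) that unfolding perm_class_def by blast
  define E where "E = {p \<in> C. p = [] \<and> (\<forall>Q\<in>QQ. p \<in> Q)}"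
  \<comment> \<open>Properties outside \<open>QQ\<close> are left free, so the count is a sum over
    all these types.\<close>
  define T' where "T' = {t \<in> Pow PP \<times> Pow PP. QQ \<subseteq> fst t}"
  have inv: "involution [] \<and> is_perm []" by (simp add: involution_def is_perm_def)
  \<comment> \<open>Passing to the inverse-closed part of \<open>C\<close> loses no involution,
    since an involution is its own inverse.\<close>
  have "p \<in> E \<union> (\<Union>t\<in>T'. Inv t) \<longleftrightarrow> p \<in> C \<and> involution p \<and> (\<forall>Q\<in>QQ. p \<in> Q)" for p
  proof
    assume "p \<in> E \<union> (\<Union>t\<in>T'. Inv t)"
    then show "p \<in> C \<and> involution p \<and> (\<forall>Q\<in>QQ. p \<in> Q)"
      using inv perm involution_iff by (auto simp: E_def T'_def Inv_def Al_def types_def)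
  next
    assume p: "p \<in> C \<and> involution p \<and> (\<forall>Q\<in>QQ. p \<in> Q)"
    then have pp: "pinv p = p" using perm involution_iff by blast
    show "p \<in> E \<union> (\<Union>t\<in>T'. Inv t)"
    proof (cases "p = []")
      case False
      then have "p \<in> Inv (types PP p)" "types PP p \<in> T'"
        using p pp assms(6) by (auto simp: T'_def Inv_def Al_def types_def)
      then show ?thesis by blast
    qed (use p in \<open>simp add: E_def\<close>)
  qed
  then have "{p \<in> C \<inter> S n. involution p \<and> (\<forall>Q\<in>QQ. p \<in> Q)} =
      {p \<in> E \<union> (\<Union>t\<in>T'. Inv t). 1 * length p = n}" for n
    using perm unfolding S_def by auto
  then have "Abs_fps (\<lambda>n. of_nat (card {p \<in> C \<inter> S n. involution p \<and> (\<forall>Q\<in>QQ. p \<in> Q)})) =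
      gf 1 (E \<union> (\<Union>t\<in>T'. Inv t))"
    unfolding gf_def by simp
  then show ?thesis
    using algebraic_involutions[of T' E] by (auto simp: T'_def E_def)
qed

end
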